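(* Let $g_E=h_E^4(t)\,g_o=\bigl(1+EH(t)+E^2G(t)+\mathcal{O}(E^3)\bigr)g_o$ be a deformation of the flat metric $g_o=dt^2+dy^2$ on the torus $T^2$ such that $h_E^4(t)=h_E^4(1-t)$ for all $t$ and all $E$, and $$\int_0^1H(t)\sin^2(2\pi t)\,dt=\int_0^1H(t)\cos^2(2\pi t)\,dt=0 .$$ Let $\mu_\alpha(E)$ and $\lambda_\alpha^2(E)$, $\alpha=1,2,3$, be the spectral functions described in the context, and suppose that for $E\neq0$ the numbers $\mu_1(E)\neq\mu_2(E)$ are simple eigenvalues of the periodic problem $-A''(t)=\mu\,h_E^4(t)A(t)$ (the case $k=0$). Then $$\ddot{(\lambda_3^2)}(0)=\ddot\mu_3(0)+2\pi^2\int_0^1H^2(t)\,dt ,$$ where two dots denote the second derivative with respect to $E$. In particular, for all parameters $E\neq0$ near zero one has $\mu_3(E)<\lambda_3^2(E)$. Moreover, the first positive eigenvalue $\mu_1(g_E)$ of the Laplace operator is always smaller than the corresponding eigenvalue $\lambda_1^2(g_E)$ of the Dirac operator (the first positive eigenvalue of its square) for any metric $g_E$ with $E\neq0$ near zero, i.e. $\mu_1(g_E)<\lambda_1^2(g_E)$.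
   Context: $T^2=\mathbb{R}^2/\mathbb{Z}^2$ with coordinates $0\le t\le 1$, $0\le y\le 1$ and the trivial spin structure. A deformation of the flat metric means a family $g_E=h_E^4(t)g_o$, where $h_E$ is a positive $1$-periodic function depending smoothly on $(E,t)$, for $E$ in an interval around $0$, with $h_0\equiv 1$. Derivatives in $t$ are denoted by $'$. For a metric $g$ on $T^2$, $\mu_1(g)$ denotes the first positive eigenvalue of the (positive) Laplace operator $\Delta_g$ on functions and $\lambda_1^2(g)$ the first positive eigenvalue of the square $D_g^2$ of the Dirac operator with respect to the trivial spin structure (these are not to be confused with the branches $\mu_1(E)$, $\lambda_1^2(E)$ below). Functions of the form $A(t)e^{2\pi i k y}$, $k\in\mathbb{Z}$, are eigenfunctions of the Laplace operator $\Delta_{g_E}$ with eigenvalue $\mu$ iff $A$ is a $1$-periodic nontrivial solution of $$-A''(t)=\{\mu\,h_E^4(t)-4\pi^2k^2\}A(t).$$ Sections of the positive half-spinor bundle $S^+$ of weight $l\in\mathbb{Z}$ under the isometric $S^1$-action in the $y$-variable are given by functions $A(t)e^{2\pi i l y}$, and they are eigenspinors of $D_{g_E}^2$ with eigenvalue $\lambda^2$ iff $A$ is a $1$-periodic nontrivial solution of $$-A''(t)=\Bigl\{\lambda^2 h_E^4(t)+\frac{h_E(t)h_E''(t)-2(h_E'(t))^2}{h_E^2(t)}-4\pi^2l^2+4\pi l\,\frac{h_E'(t)}{h_E(t)}\Bigr\}A(t).$$ $D_g^2$ has the same eigenvalues on sections of $S^+$ and of $S^-$. At $E=0$ the first positive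 eigenvalue of each of $\Delta_{g_o}$ and $D_{g_o}^2|_{S^+}$ is $4\pi^2$, of multiplicity four. The spectral functions are the branches (smooth in $E$, with smooth families of eigenfunctions) with value $4\pi^2$ at $E=0$: - $\mu_1(E)$ and $\mu_2(E)$: eigenvalues of the Laplace problem with $k=0$ whose eigenfunctions are deformations of $\sin(2\pi t)$ and $\cos(2\pi t)$, respectively; - $\mu_3(E)$: the eigenvalue of the Laplace problem with $k=\pm1$ whose eigenfunction is a deformation of the constant function $1$; - $\lambda_1^2(E)$: the eigenvalue (of multiplicity two) of the Dirac problem with $l=0$; - $\lambda_2^2(E),\lambda_3^2(E)$: the eigenvalues of the Dirac problem with $l=-1$ and $l=1$, respectively, whose eigenfunctions are deformations of the constant function $1$. *)

theory Defs
  imports "HOL-Analysis.Analysis" "HOL-Library.Landau_Symbols"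
begin

section \<open>Smooth functions\<close>

text \<open>Only meant for open sets \<open>S\<close> in finite-dimensional spaces.\<close>

primrec Ck_on :: "nat \<Rightarrow> 'a::real_normed_vector set \<Rightarrow> ('a \<Rightarrow> 'b::real_normed_vector) \<Rightarrow> bool"
  where
    "Ck_on 0 S f \<longleftrightarrow> continuous_on S f"
  | "Ck_on (Suc n) S f \<longleftrightarrow>
       (\<forall>x\<in>S. f differentiable (at x)) \<and>
       (\<forall>v. Ck_on n S (\<lambda>x. frechet_derivative f (at x) v))"

definition smooth_on :: "'a::real_normed_vector set \<Rightarrow> ('a \<Rightarrow> 'b::real_normed_vector) \<Rightarrow> bool"
  where "smooth_on S f \<longleftrightarrow> (\<forall>n. Ck_on n S f)"


section \<open>Laplace and Dirac operator of \<open>h\<^sup>4(t) (dt\<^sup>2 + dy\<^sup>2)\<close> on the torus\<close>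

text \<open>Points of the plane are \<open>(t, y)\<close>; functions on the torus are doubly periodic functions on
  the plane. For the trivial spin structure the spinor bundle is globally trivialised by periodic
  frames, so spinor fields are doubly periodic functions with values in \<open>\<complex>\<^sup>2\<close>, the two components
  being the \<open>S\<^sup>+\<close> and the \<open>S\<^sup>-\<close> part.\<close>

definition doubly_periodic :: "(real \<times> real \<Rightarrow> 'a) \<Rightarrow> bool"
  where "doubly_periodic f \<longleftrightarrow> (\<forall>t y. f (t + 1, y) = f (t, y) \<and> f (t, y + 1) = f (t, y))"

definition partial_t :: "(real \<times> real \<Rightarrow> 'a::real_normed_vector) \<Rightarrow> real \<times> real \<Rightarrow> 'a"
  where "partial_t f p = frechet_derivative f (at p) (1, 0)"

definition partial_y :: "(real \<times> real \<Rightarrow> 'a::real_normed_vector) \<Rightarrow> real \<times> real \<Rightarrow> 'a"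
  where "partial_y f p = frechet_derivative f (at p) (0, 1)"

definition laplace_op :: "(real \<Rightarrow> real) \<Rightarrow> (real \<times> real \<Rightarrow> complex) \<Rightarrow> real \<times> real \<Rightarrow> complex"
  where "laplace_op h f p =
    - (1 / h (fst p) ^ 4) *\<^sub>R (partial_t (partial_t f) p + partial_y (partial_y f) p)"

text \<open>Clifford multiplication by the flat orthonormal frame: both maps square to \<open>-1\<close> and they
  anticommute.\<close>

definition clifford_t :: "complex \<times> complex \<Rightarrow> complex \<times> complex"
  where "clifford_t s = (\<i> * snd s, \<i> * fst s)"

definition clifford_y :: "complex \<times> complex \<Rightarrow> complex \<times> complex"
  where "clifford_y s = (snd s, - fst s)"

text \<open>In dimension 2 the Dirac operator of \<open>h\<^sup>4 g\<^sub>o\<close> is \<open>h\<^sup>-\<^sup>3 D\<^sub>o h\<close>, where \<open>D\<^sub>o\<close> is the flat Dirac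
  operator. In the orthonormal frame \<open>h\<^sup>-\<^sup>2 \<partial>\<^sub>t, h\<^sup>-\<^sup>2 \<partial>\<^sub>y\<close> this is
  \<open>h\<^sup>-\<^sup>2 (\<gamma>\<^sub>t (\<partial>\<^sub>t + h'/h) + \<gamma>\<^sub>y \<partial>\<^sub>y)\<close>.\<close>

definition dirac_op ::
  "(real \<Rightarrow> real) \<Rightarrow> (real \<times> real \<Rightarrow> complex \<times> complex) \<Rightarrow> real \<times> real \<Rightarrow> complex \<times> complex"
  where "dirac_op h \<psi> p = (1 / h (fst p) ^ 3) *\<^sub>R
    (clifford_t (partial_t (\<lambda>q. h (fst q) *\<^sub>R \<psi> q) p)
     + clifford_y (partial_y (\<lambda>q. h (fst q) *\<^sub>R \<psi> q) p))"

definition torus_eigenvalue ::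
  "((real \<times> real \<Rightarrow> 'a::real_normed_vector) \<Rightarrow> real \<times> real \<Rightarrow> 'a) \<Rightarrow> real \<Rightarrow> bool"
  where "torus_eigenvalue P m \<longleftrightarrow>
    (\<exists>f. smooth_on UNIV f \<and> doubly_periodic f \<and> (\<exists>p. f p \<noteq> 0) \<and> (\<forall>p. P f p = m *\<^sub>R f p))"

text \<open>The operators below have discrete spectrum, so the infimum is attained.\<close>

definition first_positive_eigenvalue ::
  "((real \<times> real \<Rightarrow> 'a::real_normed_vector) \<Rightarrow> real \<times> real \<Rightarrow> 'a) \<Rightarrow> real"
  where "first_positive_eigenvalue P = Inf {m. 0 < m \<and> torus_eigenvalue P m}"

definition laplace_first_eigenvalue :: "(real \<Rightarrow> real) \<Rightarrow> real"
  where "laplace_first_eigenvalue h = first_positive_eigenvalue (laplace_op h)"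

definition dirac_sq_first_eigenvalue :: "(real \<Rightarrow> real) \<Rightarrow> real"
  where "dirac_sq_first_eigenvalue h = first_positive_eigenvalue (\<lambda>\<psi>. dirac_op h (dirac_op h \<psi>))"


section \<open>The reduced periodic problems\<close>

text \<open>1-periodic solutions of \<open>-A'' = q A\<close>.\<close>

definition periodic_solution :: "(real \<Rightarrow> real) \<Rightarrow> (real \<Rightarrow> complex) \<Rightarrow> bool"
  where "periodic_solution q A \<longleftrightarrow>
    (\<forall>t. A (t + 1) = A t) \<and>
    (\<exists>A'. \<forall>t. (A has_vector_derivative A' t) (at t) \<and>
              (A' has_vector_derivative - (q t *\<^sub>R A t)) (at t))"

text \<open>The space of periodic solutions has a basis with \<open>n\<close> elements.\<close>

definition multiplicity_is :: "(real \<Rightarrow> real) \<Rightarrow> nat \<Rightarrow> bool"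
  where "multiplicity_is q n \<longleftrightarrow>
    (\<exists>B :: nat \<Rightarrow> real \<Rightarrow> complex. (\<forall>i<n. periodic_solution q (B i)) \<and>
      (\<forall>A. periodic_solution q A \<longrightarrow>
        (\<exists>!c. c \<in> extensional {..<n} \<and> (\<forall>t. A t = (\<Sum>i<n. c i * B i t)))))"

definition laplace_potential :: "(real \<Rightarrow> real) \<Rightarrow> int \<Rightarrow> real \<Rightarrow> real \<Rightarrow> real"
  where "laplace_potential h k m t = m * h t ^ 4 - 4 * pi\<^sup>2 * (of_int k)\<^sup>2"

definition dirac_potential :: "(real \<Rightarrow> real) \<Rightarrow> int \<Rightarrow> real \<Rightarrow> real \<Rightarrow> real"
  where "dirac_potential h l m t =
    m * h t ^ 4
    + (h t * deriv (deriv h) t - 2 * (deriv h t)\<^sup>2) / (h t)\<^sup>2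
    - 4 * pi\<^sup>2 * (of_int l)\<^sup>2
    + 4 * pi * of_int l * (deriv h t / h t)"

text \<open>\<open>m\<close> is a branch of eigenvalues through \<open>4\<pi>\<^sup>2\<close>, smooth in the parameter, carried by a smooth
  family of eigenfunctions deforming \<open>A\<^sub>0\<close>; \<open>Q E \<mu>\<close> is the potential at parameter \<open>E\<close> and
  spectral value \<open>\<mu>\<close>. For a Dirac problem \<open>m\<close> is the branch \<open>\<lambda>\<^sup>2\<close>, not \<open>\<lambda>\<close>.\<close>

definition spectral_branch ::
  "real set \<Rightarrow> (real \<Rightarrow> real \<Rightarrow> real \<Rightarrow> real) \<Rightarrow> (real \<Rightarrow> complex) \<Rightarrow> (real \<Rightarrow> real) \<Rightarrow> bool"
  where "spectral_branch J Q A\<^sub>0 m \<longleftrightarrow>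
    smooth_on J m \<and> m 0 = 4 * pi\<^sup>2 \<and>
    (\<exists>A. smooth_on (J \<times> UNIV) (\<lambda>(E, t). A E t) \<and> A 0 = A\<^sub>0 \<and>
         (\<forall>E\<in>J. periodic_solution (Q E (m E)) (A E) \<and> (\<exists>t. A E t \<noteq> 0)))"

definition flat_deformation :: "real set \<Rightarrow> (real \<Rightarrow> real \<Rightarrow> real) \<Rightarrow> bool"
  where "flat_deformation J h \<longleftrightarrow>
    open J \<and> is_interval J \<and> 0 \<in> J \<and>
    smooth_on (J \<times> UNIV) (\<lambda>(E, t). h E t) \<and>
    (\<forall>E\<in>J. \<forall>t. 0 < h E t \<and> h E (t + 1) = h E t) \<and>
    (\<forall>t. h 0 t = 1)"

end

theory Submission
  imports Defs
begin

text \<open>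
  Write \<open>\<rho> = h\<^sup>2\<close>, so that the metric is \<open>\<rho>\<^sup>2 g\<^sub>o\<close>. In the Fourier mode of weight \<open>l\<close> the Dirac equation
  with eigenvalue \<open>\<lambda>\<close> is a first order system for the two components of \<open>h \<psi>\<close>; half their sum and
  half their difference, \<open>p\<close> and \<open>q\<close>, satisfy \<open>p' = -(\<lambda>\<rho> + c) q\<close>, \<open>q' = (\<lambda>\<rho> - c) p\<close> with \<open>c = 2\<pi>\<bar>l\<bar>\<close>
  (after a swap if the sign of the constant is wrong). Near the flat metric and for \<open>l = \<plusminus>1\<close> the coefficient
  \<open>\<lambda>\<rho> - c\<close> is small, so \<open>p\<close> is almost constant and \<open>q\<close> is of the size of \<open>\<lambda>\<rho> - c\<close>. Pairing \<open>(p, q)\<close>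
  with the Laplace solution \<open>A\<close> of weight \<open>\<plusminus>1\<close> yields the exact identity
  \<open>(\<lambda>\<^sup>2 - \<mu>) \<integral>\<rho>\<^sup>2 p A = \<integral>(\<lambda>\<rho> - c)\<^sup>2 p A + \<integral>(\<lambda>\<rho> - c) q A'\<close>. Its right hand side is dominated by the
  first integral because \<open>A'\<close> is small. Dividing by \<open>E\<^sup>2\<close> gives the second derivatives. Bounding
  \<open>\<integral>(\<lambda>\<rho> - c)\<^sup>2\<close> below by \<open>\<lambda>\<^sup>2\<close> times the variance of \<open>\<rho>\<close> gives a gap without any expansion in \<open>E\<close>,
  which is needed since \<open>H\<close> may vanish identically; \<open>\<rho>\<close> is not constant because \<open>\<mu>\<^sub>1(E)\<close> is simple.

  For the remaining Dirac eigenvalues, \<open>l = 0\<close> forces \<open>\<lambda>\<^sup>2 \<ge> 4\<pi>\<^sup>2 / (\<integral>\<rho>)\<^sup>2 > 4\<pi>\<^sup>2 / \<integral>\<rho>\<^sup>2 \<ge> \<mu>\<^sub>3\<close>, and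
  \<open>\<bar>l\<bar> \<ge> 2\<close> forces \<open>\<lambda>\<close> to be close to \<open>4\<pi>\<close> or larger.
\<close>

section \<open>The first order system\<close>

text \<open>Real functions suffice: the coefficients are real, so the real and imaginary parts of a
  complex spinor mode solve the system separately. For \<open>c = 0\<close> the vector
  \<open>(p, q)\<close> rotates with angular speed \<open>lam * \<rho>\<close>. Where
  \<open>lam * \<rho> = c\<close> identically, the constant \<open>(1, 0)\<close> is a solution; for
  \<open>c = 2 * pi\<close> this is the resonance at the flat metric.\<close>

definition spin_system :: "real \<Rightarrow> real \<Rightarrow> (real \<Rightarrow> real) \<Rightarrow> (real \<Rightarrow> real) \<Rightarrow> (real \<Rightarrow> real) \<Rightarrow> bool"
  where "spin_system c lam \<rho> p q \<longleftrightarrow>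
    (\<forall>t. p (t + 1) = p t \<and> q (t + 1) = q t \<and>
         (p has_real_derivative - (lam * \<rho> t + c) * q t) (at t) \<and>
         (q has_real_derivative (lam * \<rho> t - c) * p t) (at t))"

lemma spin_systemD:
  assumes "spin_system c lam \<rho> p q"
  shows "p (t + 1) = p t" "q (t + 1) = q t"
    "(p has_real_derivative - (lam * \<rho> t + c) * q t) (at t within S)"
    "(q has_real_derivative (lam * \<rho> t - c) * p t) (at t within S)"
    "continuous_on S p" "continuous_on S q"
  using assms unfolding spin_system_def
  by (auto intro: has_field_derivative_at_within DERIV_isCont continuous_at_imp_continuous_on)

text \<open>A quarter turn of \<open>(p, q)\<close> reverses the sign of the weight, so later
  arguments may take it nonnegative.\<close>

lemma spin_system_swap:
  assumes "spin_system c lam \<rho> p q"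
  shows "spin_system (- c) lam \<rho> q (\<lambda>t. - p t)"
  using DERIV_minus[OF spin_systemD(3)[OF assms]] spin_systemD(1,2,4)[OF assms]
  unfolding spin_system_def by (simp add: algebra_simps)

lemma spin_system_scale:
  assumes "spin_system c lam \<rho> p q"
  shows "spin_system c lam \<rho> (\<lambda>t. a * p t) (\<lambda>t. a * q t)"
  using spin_systemD[OF assms] unfolding spin_system_def
  by (auto intro!: derivative_eq_intros)

lemma periodic_reduce_unit_interval:
  fixes f :: "real \<Rightarrow> 'a"
  assumes "\<And>t. f (t + 1) = f t"
  shows "\<exists>s\<in>{0..1}. f t = f s"
proof -
  have nat_shift: "f (t + of_nat n) = f t" for t n
  proof (induction n)
    case (Suc n)
    then show ?case using assms[of "t + of_nat n"] by (simp add: add.assoc add.commute[of 1])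
  qed simp
  have "f (frac t) = f t"
  proof (cases "0 \<le> \<lfloor>t\<rfloor>")
    case True
    then show ?thesis using nat_shift[of "frac t" "nat \<lfloor>t\<rfloor>"] by (simp add: frac_def)
  next
    case False
    then show ?thesis using nat_shift[of t "nat (- \<lfloor>t\<rfloor>)"] by (simp add: frac_def)
  qed
  then show ?thesis
    by (intro bexI[of _ "frac t"]) (auto simp: frac_lt_1 less_imp_le)
qed

lemma integral_periodic_derivative:
  fixes W w :: "real \<Rightarrow> real"
  assumes "\<And>t. (W has_real_derivative w t) (at t)" and "W (1::real) = W 0"
  shows "(w has_integral 0) {0..1}"
  using fundamental_theorem_of_calculus[of 0 1 W w] assms
  by (auto simp: has_real_derivative_iff_has_vector_derivative[symmetric]
      intro: has_field_derivative_at_within)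

lemma continuous_integral_zero_imp_zero:
  fixes f :: "real \<Rightarrow> real"
  assumes "continuous_on {0..1} f" "\<And>t. t \<in> {0..1} \<Longrightarrow> 0 \<le> f t" "(f has_integral 0) {0..1}"
    and "t \<in> {0..1}"
  shows "f t = 0"
  using has_integral_0_cbox_imp_0[of 0 1 f t] assms by auto

section \<open>Lower bounds for the spectral parameter of the system\<close>

text \<open>If \<open>lam * \<rho>\<close> stayed below \<open>c\<close>, then \<open>p * q\<close>
  would have derivative \<open>- w\<close> with \<open>w\<close> a positive definite form in
  \<open>(p, q)\<close>. Periodicity makes the integral of \<open>w\<close> vanish, hence the whole
  solution. The bound disposes of the weights of modulus at least 2 and keeps \<open>lam\<close>
  away from small values at weight 1.\<close>

lemma spin_system_lower_bound:
  assumes sys: "spin_system c lam \<rho> p q" and nz: "p t0 \<noteq> 0 \<or> q t0 \<noteq> 0"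
    and "0 < c" "0 < lam" and cont: "continuous_on {0..1} \<rho>"
    and \<rho>: "\<And>t. 0 < \<rho> t" "\<And>t. \<rho> t \<le> R"
  shows "c \<le> lam * R"
proof (rule ccontr)
  assume "\<not> c \<le> lam * R"
  then have less: "lam * \<rho> t < c" for t
    using \<rho>(2)[of t] \<open>0 < lam\<close> by (smt (verit) mult_left_mono)
  define w where "w t = (c - lam * \<rho> t) * (p t)\<^sup>2 + (lam * \<rho> t + c) * (q t)\<^sup>2" for t
  note D = spin_systemD[OF sys]
  have pos: "0 < lam * \<rho> t + c" for t using \<rho>(1)[of t] \<open>0 < c\<close> \<open>0 < lam\<close> by (simp add: add_pos_pos)
  have nonneg: "0 \<le> w t" for t
  proof -
    have "0 \<le> (c - lam * \<rho> t) * (p t)\<^sup>2" "0 \<le> (lam * \<rho> t + c) * (q t)\<^sup>2"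
      using less[of t] pos[of t] by (intro mult_nonneg_nonneg; simp del: mult_nonneg_nonneg)+
    then show ?thesis by (simp add: w_def)
  qed
  have "(w has_integral 0) {0..1}"
  proof (rule integral_periodic_derivative)
    show "((\<lambda>t. - (p t * q t)) has_real_derivative w t) (at t)" for t
      unfolding w_def
      by (auto intro!: derivative_eq_intros D(3,4) simp: algebra_simps power2_eq_square)
    show "- (p 1 * q 1) = - (p 0 * q 0)" using D(1)[of 0] D(2)[of 0] by simp
  qed
  moreover have "continuous_on {0..1} w"
    unfolding w_def by (intro continuous_intros cont D)
  ultimately have w0: "w t = 0" if "t \<in> {0..1}" for t
    using continuous_integral_zero_imp_zero nonneg that by blast
  obtain s where s: "s \<in> {0..1}" "(p t0, q t0) = (p s, q s)"
    using periodic_reduce_unit_interval[of "\<lambda>t. (p t, q t)" t0] D(1,2) by auto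
  have "(c - lam * \<rho> s) * (p s)\<^sup>2 \<ge> 0" "(lam * \<rho> s + c) * (q s)\<^sup>2 \<ge> 0"
    using less[of s] pos[of s] by auto
  then have "(c - lam * \<rho> s) * (p s)\<^sup>2 = 0 \<and> (lam * \<rho> s + c) * (q s)\<^sup>2 = 0"
    using w0[OF s(1)] unfolding w_def by linarith
  then have "p s = 0 \<and> q s = 0" using less[of s] pos[of s] by auto
  then show False using s nz by auto
qed

text \<open>Without weight, \<open>z = p + \<i> q\<close> satisfies
  \<open>z' = \<i> lam \<rho> z\<close>, so its argument grows by \<open>lam\<close> times the
  integral of \<open>\<rho>\<close> over a period. For a nonzero periodic solution this is a
  positive multiple of \<open>2 * pi\<close>.\<close>

lemma spin_system_zero_weight:
  assumes sys: "spin_system 0 lam \<rho> p q" and nz: "p t0 \<noteq> 0 \<or> q t0 \<noteq> 0"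
    and "0 < lam" and cont: "continuous_on UNIV \<rho>" and \<rho>: "\<And>t. 0 < \<rho> t"
  shows "2 * pi \<le> lam * integral {0..1} \<rho>"
proof -
  note D = spin_systemD[OF sys]
  define \<Phi> where "\<Phi> t = integral {-1..t} \<rho>" for t
  have per: "(p (t + 1), q (t + 1)) = (p t, q t)" for t using D by auto
  obtain s where s: "s \<in> {0..1}" "(p t0, q t0) = (p s, q s)"
    using periodic_reduce_unit_interval[of "\<lambda>t. (p t, q t)" t0] per by blast
  define z where "z t = Complex (p t) (q t)" for t
  have d\<Phi>: "(\<Phi> has_vector_derivative \<rho> t) (at t within {0..1})" if "t \<in> {0..1}" for t
  proof -
    have "(\<Phi> has_vector_derivative \<rho> t) (at t within {-1..1})"
      unfolding \<Phi>_def using that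
      by (intro integral_has_vector_derivative continuous_on_subset[OF cont]) auto
    then show ?thesis by (rule has_vector_derivative_within_subset) auto
  qed
  have dz: "(z has_vector_derivative (\<i> * of_real (lam * \<rho> t) * z t)) (at t within {0..1})" for t
  proof -
    have "((\<lambda>t. of_real (p t) + \<i> * of_real (q t)) has_vector_derivative
        (of_real (- (lam * \<rho> t) * q t) + \<i> * of_real (lam * \<rho> t * p t))) (at t within {0..1})"
      using D(3,4)[of t "{0..1}"]
      by (auto intro!: derivative_eq_intros simp: has_real_derivative_iff_has_vector_derivative)
    moreover have "(\<lambda>t. of_real (p t) + \<i> * of_real (q t)) = z"
      by (auto simp: z_def complex_eq_iff)
    moreover have "of_real (- (lam * \<rho> t) * q t) + \<i> * of_real (lam * \<rho> t * p t) = \<i> * of_real (lam * \<rho> t) * z t"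
      by (simp add: z_def complex_eq_iff)
    ultimately show ?thesis by (simp only:)
  qed
  \<comment> \<open>The integrating factor undoes the rotation, so \<open>u\<close> is constant;
    comparing \<open>t = 0\<close> with \<open>t = 1\<close> then gives an equation between two
    exponentials.\<close>
  define u where "u t = z t * exp (- (\<i> * of_real (lam * \<Phi> t)))" for t
  have "(u has_vector_derivative 0) (at t within {0..1})" if "t \<in> {0..1}" for t
  proof -
    have e: "((\<lambda>t. exp (- (\<i> * of_real (lam * \<Phi> t)))) has_vector_derivative
        ((- (\<i> * of_real (lam * \<rho> t))) * exp (- (\<i> * of_real (lam * \<Phi> t))))) (at t within {0..1})"
    proof -
      have "((\<lambda>t. - (\<i> * of_real (lam * \<Phi> t))) has_vector_derivative - (\<i> * of_real (lam * \<rho> t)))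
          (at t within {0..1})"
        using d\<Phi>[OF that]
        by (auto intro!: derivative_eq_intros simp flip: has_real_derivative_iff_has_vector_derivative)
      from field_vector_diff_chain_within[OF this DERIV_exp[THEN has_field_derivative_at_within]]
      show ?thesis by (simp add: o_def)
    qed
    show ?thesis unfolding u_def
      by (rule has_vector_derivative_eq_rhs[OF has_vector_derivative_mult[OF dz e]]) (simp add: algebra_simps)
  qed
  then have k: "u t = u 0" if "t \<in> {0..1}" for t
    using has_derivative_zero_unique[of "{0..1}" u 0 t] that
    by (simp add: has_vector_derivative_def)
  have "z s \<noteq> 0" using nz s by (simp add: z_def complex_eq_iff)
  then have "u s \<noteq> 0" by (simp add: u_def)
  then have "u 0 \<noteq> 0" using k[OF s(1)] by simp
  then have "z 0 \<noteq> 0" by (simp add: u_def)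
  have "u 1 = u 0" using k[of 1] by simp
  moreover have "z 1 = z 0" using per[of 0] by (simp add: z_def)
  ultimately have "exp (- (\<i> * of_real (lam * \<Phi> 0))) = exp (- (\<i> * of_real (lam * \<Phi> 1)))"
    using \<open>z 0 \<noteq> 0\<close> by (simp add: u_def)
  then have "\<exists>n::int. - (\<i> * of_real (lam * \<Phi> 0)) = - (\<i> * of_real (lam * \<Phi> 1)) + (of_int (2 * n) * pi) * \<i>"
    unfolding exp_eq by simp
  then obtain n :: int where "- (\<i> * of_real (lam * \<Phi> 0)) = - (\<i> * of_real (lam * \<Phi> 1)) + (of_int (2 * n) * pi) * \<i>"
    by blast
  then have "lam * \<Phi> 1 - lam * \<Phi> 0 = of_int (2 * n) * pi"
    by (auto simp: complex_eq_iff)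
  moreover have "\<Phi> 1 - \<Phi> 0 = integral {0..1} \<rho>"
    unfolding \<Phi>_def
    using Henstock_Kurzweil_Integration.integral_combine[of "-1" 0 1 \<rho>] continuous_on_subset[OF cont]
    by (simp add: integrable_continuous_interval)
  ultimately have eq: "lam * integral {0..1} \<rho> = of_int (2 * n) * pi"
    by (simp flip: right_diff_distrib)
  \<comment> \<open>Positivity of the total angle excludes \<open>n \<le> 0\<close>.\<close>
  have "0 < integral {0..1} \<rho>"
  proof -
    have "(\<rho> has_integral integral {0..1} \<rho>) {0..1}"
      by (intro integrable_integral integrable_continuous_interval continuous_on_subset[OF cont]) simp
    then have "integral {0..1} \<rho> \<noteq> 0"
      using continuous_integral_zero_imp_zero[OF continuous_on_subset[OF cont] less_imp_le[OF \<rho>], of 0] \<rho>[of 0]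
      by fastforce
    moreover have "0 \<le> integral {0..1} \<rho>"
      using \<rho> by (intro integral_nonneg integrable_continuous_interval continuous_on_subset[OF cont]) (auto intro: less_imp_le)
    ultimately show ?thesis by simp
  qed
  then have "0 < of_int (2 * n) * pi" unfolding eq[symmetric] using \<open>0 < lam\<close> by simp
  then have "1 \<le> n" by (simp add: zero_less_mult_iff)
  then show ?thesis unfolding eq by simp
qed

text \<open>Passing to \<open>F + X\<close> and \<open>F - X\<close> moves the weight
  \<open>c\<close> from the diagonal of the system into the off-diagonal entries, next to
  \<open>lam * \<rho>\<close>. A real or imaginary part that does not vanish at \<open>t0\<close>
  supplies the real solution, and a negative \<open>c\<close> is removed by the swap.\<close>

lemma spin_system_of_complex:
  fixes F X :: "real \<Rightarrow> complex"
  assumes per: "\<And>t. F (t + 1) = F t" "\<And>t. X (t + 1) = X t"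
    and dF: "\<And>t. (F has_vector_derivative (lam * \<rho> t) *\<^sub>R X t - c *\<^sub>R F t) (at t)"
    and dX: "\<And>t. (X has_vector_derivative c *\<^sub>R X t - (lam * \<rho> t) *\<^sub>R F t) (at t)"
    and nz: "F t0 \<noteq> 0 \<or> X t0 \<noteq> 0"
  shows "\<exists>p q t. spin_system \<bar>c\<bar> lam \<rho> p q \<and> (p t \<noteq> 0 \<or> q t \<noteq> 0)"
proof -
  define P Q where "P t = F t + X t" and "Q t = F t - X t" for t
  have dP: "(P has_vector_derivative - (lam * \<rho> t + c) *\<^sub>R Q t) (at t)" for t
    unfolding P_def by (rule has_vector_derivative_eq_rhs[OF has_vector_derivative_add[OF dF dX]])
      (simp add: Q_def algebra_simps)
  have dQ: "(Q has_vector_derivative (lam * \<rho> t - c) *\<^sub>R P t) (at t)" for t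
    unfolding Q_def by (rule has_vector_derivative_eq_rhs[OF has_vector_derivative_diff[OF dF dX]])
      (simp add: P_def algebra_simps)
  have part: "spin_system c lam \<rho> (\<lambda>t. L (P t)) (\<lambda>t. L (Q t))"
    if "bounded_linear L" for L :: "complex \<Rightarrow> real"
    using bounded_linear.has_vector_derivative[OF that dP] bounded_linear.has_vector_derivative[OF that dQ]
      bounded_linear.linear[OF that] per
    by (simp add: spin_system_def has_real_derivative_iff_has_vector_derivative linear_scale
        linear_neg P_def Q_def)
  have "F t0 = (P t0 + Q t0) / 2" "X t0 = (P t0 - Q t0) / 2" by (auto simp: P_def Q_def)
  with nz have "P t0 \<noteq> 0 \<or> Q t0 \<noteq> 0" by auto
  then have "\<exists>p q. spin_system c lam \<rho> p q \<and> (p t0 \<noteq> 0 \<or> q t0 \<noteq> 0)"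
    using part[OF bounded_linear_Re] part[OF bounded_linear_Im] by (auto simp: complex_eq_iff)
  then obtain p q where pq: "spin_system c lam \<rho> p q" "p t0 \<noteq> 0 \<or> q t0 \<noteq> 0" by blast
  show ?thesis
  proof (cases "0 \<le> c")
    case True
    then show ?thesis using pq by auto
  next
    case False
    then have "spin_system \<bar>c\<bar> lam \<rho> q (\<lambda>t. - p t)" using spin_system_swap[OF pq(1)] by simp
    moreover have "q t0 \<noteq> 0 \<or> - p t0 \<noteq> 0" using pq(2) by auto
    ultimately show ?thesis by blast
  qed
qed

section \<open>Quantitative control of solutions near resonance\<close>

text \<open>The gauge integral makes \<open>f'\<close> integrable without any continuity of
  \<open>f'\<close>. Enlarging the interval from \<open>s..t\<close> to \<open>0..1\<close> is
  harmless because \<open>g\<close> dominates an absolute value.\<close>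

lemma oscillation_le_integral:
  fixes f :: "real \<Rightarrow> real"
  assumes "\<And>t. t \<in> {0..1} \<Longrightarrow> (f has_real_derivative f' t) (at t)"
    and bound: "\<And>t. t \<in> {0..1} \<Longrightarrow> \<bar>f' t\<bar> \<le> g t" and "continuous_on {0..1} g"
    and "s \<in> {0..1}" "t \<in> {0..1}"
  shows "\<bar>f t - f s\<bar> \<le> integral {0..1} g"
  using assms(4,5)
proof (induction s t rule: linorder_wlog)
  case (le s t)
  have "(f' has_integral f t - f s) {s..t}"
    using le assms(1)
    by (intro fundamental_theorem_of_calculus)
      (auto simp flip: has_real_derivative_iff_has_vector_derivative intro: has_field_derivative_at_within)
  moreover have int: "g integrable_on {s..t}" "g integrable_on {0..1}"
    using le assms(3) by (auto intro!: integrable_continuous_interval intro: continuous_on_subset)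
  moreover have "norm (f' x) \<le> g x" if "x \<in> {s..t}" for x using bound[of x] that le by auto
  ultimately have "norm (f t - f s) \<le> integral {s..t} g"
    using integral_norm_bound_integral[of f' "{s..t}" g] by (simp add: has_integral_iff)
  also have "\<dots> \<le> integral {0..1} g"
    using le int bound by (intro integral_subset_le) force+
  finally show ?case by simp
next
  case (sym s t)
  then show ?case by (simp add: abs_minus_commute)
qed

text \<open>The difference of the two sides is the variance, the integral of
  \<open>(f t - m)\<^sup>2\<close> with \<open>m\<close> the mean; for continuous \<open>f\<close>
  it vanishes only if \<open>f\<close> equals \<open>m\<close> throughout.\<close>

lemma square_integral_le:
  fixes f :: "real \<Rightarrow> real"
  assumes cont: "continuous_on {0..1} f"
  shows "(integral {0..1} f)\<^sup>2 \<le> integral {0..1} (\<lambda>t. (f t)\<^sup>2)"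
    and "\<lbrakk>s \<in> {0..1}; t \<in> {0..1}; f s \<noteq> f t\<rbrakk> \<Longrightarrow>
      (integral {0..1} f)\<^sup>2 < integral {0..1} (\<lambda>t. (f t)\<^sup>2)"
proof -
  define m where "m = integral {0..1} f"
  have "(f has_integral m) {0..1}"
    unfolding m_def by (intro integrable_integral integrable_continuous_interval cont)
  moreover have "((\<lambda>t. (f t)\<^sup>2) has_integral integral {0..1} (\<lambda>t. (f t)\<^sup>2)) {0..1}"
    by (intro integrable_integral integrable_continuous_interval continuous_intros cont)
  moreover have "((\<lambda>t. m\<^sup>2) has_integral m\<^sup>2) {0..1::real}"
    using has_integral_const_real[of "m\<^sup>2" 0 1] by simp
  ultimately have "((\<lambda>t. (f t)\<^sup>2 - 2 * m * f t + m\<^sup>2) has_integral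
      integral {0..1} (\<lambda>t. (f t)\<^sup>2) - 2 * m * m + m\<^sup>2) {0..1}"
    by (intro has_integral_add has_integral_diff has_integral_mult_right)
  then have var: "((\<lambda>t. (f t - m)\<^sup>2) has_integral integral {0..1} (\<lambda>t. (f t)\<^sup>2) - m\<^sup>2) {0..1}"
    by (simp add: power2_eq_square algebra_simps)
  have le: "m\<^sup>2 \<le> integral {0..1} (\<lambda>t. (f t)\<^sup>2)"
    using has_integral_nonneg[OF var] by simp
  then show "(integral {0..1} f)\<^sup>2 \<le> integral {0..1} (\<lambda>t. (f t)\<^sup>2)" by (simp add: m_def)
  assume st: "s \<in> {0..1}" "t \<in> {0..1}" "f s \<noteq> f t"
  have "m\<^sup>2 \<noteq> integral {0..1} (\<lambda>t. (f t)\<^sup>2)"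
  proof
    assume "m\<^sup>2 = integral {0..1} (\<lambda>t. (f t)\<^sup>2)"
    then have 0: "((\<lambda>t. (f t - m)\<^sup>2) has_integral 0) {0..1}" using var by simp
    have "continuous_on {0..1} (\<lambda>t. (f t - m)\<^sup>2)" by (intro continuous_intros cont)
    from continuous_integral_zero_imp_zero[OF this _ 0]
    have "(f t - m)\<^sup>2 = 0" if "t \<in> {0..1}" for t using that by simp
    from this[OF st(1)] this[OF st(2)] st(3) show False by simp
  qed
  with le show "(integral {0..1} f)\<^sup>2 < integral {0..1} (\<lambda>t. (f t)\<^sup>2)" by (simp add: m_def)
qed

text \<open>A bootstrap with \<open>M\<close>, the maximum of \<open>\<bar>p\<bar>\<close>. Since
  \<open>q\<close> has a zero and \<open>\<bar>q'\<bar>\<close> is at most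
  \<open>M * \<bar>lam * \<rho> - 2 * pi\<bar>\<close>, one gets
  \<open>\<bar>q\<bar> \<le> M * N\<close>. Then \<open>p'\<close> is small as well, so
  \<open>p\<close> stays near \<open>p 0\<close>, which bounds \<open>M\<close> by
  \<open>2 * \<bar>p 0\<bar>\<close>. Dividing the solution by \<open>p 0\<close> gives the
  normalised one.\<close>

lemma near_resonant_spin_system:
  assumes sys: "spin_system (2 * pi) lam \<rho> p q" and nz: "p t0 \<noteq> 0 \<or> q t0 \<noteq> 0"
    and cont: "continuous_on UNIV \<rho>"
    and \<epsilon>: "\<And>t. \<bar>lam * \<rho> t - 2 * pi\<bar> \<le> \<epsilon>" "\<epsilon> \<le> 1 / 100"
  shows "\<exists>p q. spin_system (2 * pi) lam \<rho> p q \<and>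
    (\<forall>t\<in>{0..1}. \<bar>p t - 1\<bar> \<le> 26 * \<epsilon> \<and>
      \<bar>q t\<bar> \<le> 2 * integral {0..1} (\<lambda>t. \<bar>lam * \<rho> t - 2 * pi\<bar>))"
proof -
  note D = spin_systemD[OF sys]
  define N where "N = integral {0..1} (\<lambda>t. \<bar>lam * \<rho> t - 2 * pi\<bar>)"
  have cont': "continuous_on {0..1} (\<lambda>t. \<bar>lam * \<rho> t - 2 * pi\<bar>)"
    by (intro continuous_intros continuous_on_subset[OF cont]) simp
  have "N \<le> integral {0..1::real} (\<lambda>t. \<epsilon>)"
    unfolding N_def using \<epsilon> by (intro integral_le integrable_continuous_interval cont') auto
  then have N\<epsilon>: "N \<le> \<epsilon>" by simp
  have "\<exists>x\<in>{0..1}. \<forall>t\<in>{0..1}. \<bar>p t\<bar> \<le> \<bar>p x\<bar>"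
    by (rule continuous_attains_sup) (auto intro!: continuous_intros D)
  then obtain x where x: "x \<in> {0..1}" "\<And>t. t \<in> {0..1} \<Longrightarrow> \<bar>p t\<bar> \<le> \<bar>p x\<bar>" by blast
  define M where "M = \<bar>p x\<bar>"
  have pos: "0 < lam * \<rho> t + 2 * pi" for t using \<epsilon>(1)[of t] \<epsilon>(2) pi_gt3 by linarith
  \<comment> \<open>A zero of \<open>q\<close>, from which \<open>q\<close> is bounded by its total variation.\<close>
  have "\<exists>z>0. z < 1 \<and> DERIV p z :> 0"
    using D(1)[of 0] by (intro Rolle D) (auto simp: real_differentiable_def intro: D(3))
  then obtain z where z: "0 < z" "z < 1" "DERIV p z :> 0" by blast
  from DERIV_unique[OF z(3) D(3)] have qz: "q z = 0" using pos[of z] by simp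
  have qM: "\<bar>q t\<bar> \<le> M * N" if "t \<in> {0..1}" for t
  proof -
    have "\<bar>q t - q z\<bar> \<le> integral {0..1} (\<lambda>t. M * \<bar>lam * \<rho> t - 2 * pi\<bar>)"
    proof (rule oscillation_le_integral[where f = q and f' = "\<lambda>t. (lam * \<rho> t - 2 * pi) * p t"])
      show "\<bar>(lam * \<rho> t - 2 * pi) * p t\<bar> \<le> M * \<bar>lam * \<rho> t - 2 * pi\<bar>" if "t \<in> {0..1}" for t
        using mult_right_mono[OF x(2)[OF that], of "\<bar>lam * \<rho> t - 2 * pi\<bar>"]
        by (simp add: abs_mult M_def mult.commute)
    qed (use that z cont' D(4) in \<open>auto intro!: continuous_intros\<close>)
    then show ?thesis by (simp add: qz N_def)
  qed
  have M0: "0 \<le> M" by (simp add: M_def)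
  have pi_le: "pi \<le> 16 / 5" using pi_approx(2) by simp
  have q\<epsilon>: "\<bar>q t\<bar> \<le> M * \<epsilon>" if "t \<in> {0..1}" for t
    using qM[OF that] mult_left_mono[OF N\<epsilon> M0] by linarith
  have posc: "\<bar>p t - p 0\<bar> \<le> 13 * \<epsilon> * M" if "t \<in> {0..1}" for t
  proof -
    have "\<bar>p t - p 0\<bar> \<le> integral {0..1::real} (\<lambda>t. 13 * \<epsilon> * M)"
    proof (rule oscillation_le_integral[where f = p and f' = "\<lambda>t. - (lam * \<rho> t + 2 * pi) * q t"])
      show "\<bar>- (lam * \<rho> t + 2 * pi) * q t\<bar> \<le> 13 * \<epsilon> * M" if "t \<in> {0..1}" for t
      proof -
        \<comment> \<open>The sum is at most \<open>4 * pi + 1 / 100\<close>, which is below 13. The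
          final constant 26 is twice this, the factor 2 coming from
          \<open>M \<le> 2 * \<bar>p 0\<bar>\<close>.\<close>
        have "\<bar>lam * \<rho> t + 2 * pi\<bar> \<le> 13" using \<epsilon>(1)[of t] \<epsilon>(2) pi_le pi_gt3 by linarith
        then have "\<bar>lam * \<rho> t + 2 * pi\<bar> * \<bar>q t\<bar> \<le> 13 * (M * \<epsilon>)"
          by (intro mult_mono q\<epsilon> that) auto
        moreover have "13 * (M * \<epsilon>) = 13 * \<epsilon> * M" by simp
        ultimately show ?thesis by (simp only: abs_mult abs_minus_cancel)
      qed
    qed (use that D(3) in \<open>auto intro!: continuous_intros\<close>)
    then show ?thesis by simp
  qed
  have "\<epsilon> \<ge> 0" using \<epsilon>(1)[of 0] by linarith
  \<comment> \<open>Here \<open>\<epsilon> \<le> 1 / 100\<close> is used to absorb: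
    \<open>M \<le> \<bar>p 0\<bar> + M / 2\<close>.\<close>
  have "13 * \<epsilon> * M \<le> (1/2) * M" using \<epsilon>(2) M0 by (intro mult_right_mono) auto
  then have M2: "M \<le> 2 * \<bar>p 0\<bar>" using posc[OF x(1)] unfolding M_def by linarith
  have p0: "p 0 \<noteq> 0"
  proof
    assume "p 0 = 0"
    then have "M = 0" using M2 M0 by simp
    have "p t = 0 \<and> q t = 0" if "t \<in> {0..1}" for t
      using x(2)[OF that] qM[OF that] \<open>M = 0\<close> by (auto simp: M_def)
    moreover obtain s where "s \<in> {0..1}" "(p t0, q t0) = (p s, q s)"
      using periodic_reduce_unit_interval[of "\<lambda>t. (p t, q t)" t0] D(1,2) by auto
    ultimately show False using nz by auto
  qed
  show ?thesis
  proof (intro exI conjI ballI)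
    show "spin_system (2 * pi) lam \<rho> (\<lambda>t. (1 / p 0) * p t) (\<lambda>t. (1 / p 0) * q t)"
      by (rule spin_system_scale[OF sys])
    fix t :: real assume t: "t \<in> {0..1}"
    have "1 / p 0 * p t - 1 = (p t - p 0) / p 0" using p0 by (simp add: field_simps)
    then have "\<bar>1 / p 0 * p t - 1\<bar> = \<bar>p t - p 0\<bar> / \<bar>p 0\<bar>" by simp
    also have "\<dots> \<le> 13 * \<epsilon> * (2 * \<bar>p 0\<bar>) / \<bar>p 0\<bar>"
      using \<open>\<epsilon> \<ge> 0\<close> by (intro divide_right_mono order_trans[OF posc[OF t]] mult_left_mono M2) auto
    finally show "\<bar>1 / p 0 * p t - 1\<bar> \<le> 26 * \<epsilon>" using p0 by simp
    have "0 \<le> N" unfolding N_def by (intro integral_nonneg integrable_continuous_interval cont') auto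
    have "\<bar>1 / p 0 * q t\<bar> = \<bar>q t\<bar> / \<bar>p 0\<bar>" by (simp add: abs_mult)
    also have "\<dots> \<le> (2 * \<bar>p 0\<bar>) * N / \<bar>p 0\<bar>"
      using qM[OF t] mult_right_mono[OF M2 \<open>0 \<le> N\<close>] by (intro divide_right_mono) auto
    finally show "\<bar>1 / p 0 * q t\<bar> \<le> 2 * integral {0..1} (\<lambda>t. \<bar>lam * \<rho> t - 2 * pi\<bar>)"
      using p0 by (simp add: N_def)
  qed
qed

section \<open>Comparison with the Laplace equation of the same weight\<close>

text \<open>The integrand is the derivative of the periodic function
  \<open>A' * p + 2 * c * q * A\<close>. The Wronskian \<open>A' * p - A * p'\<close> would contain
  \<open>(lam * \<rho> + c) * q * A\<close> and its derivative would involve that of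
  \<open>\<rho>\<close>; with the resonant value \<open>2 * c\<close> in that place, no derivative
  of \<open>\<rho>\<close> appears. The square comes from \<open>2 * c * lam * \<rho> - c\<^sup>2 =
  (lam * \<rho>)\<^sup>2 - (lam * \<rho> - c)\<^sup>2\<close>.\<close>

lemma spin_laplace_identity:
  assumes sys: "spin_system c lam \<rho> p q"
    and A: "\<And>t. (A has_real_derivative A' t) (at t)"
      "\<And>t. (A' has_real_derivative - ((mu * (\<rho> t)\<^sup>2 - c\<^sup>2) * A t)) (at t)"
    and per: "A 1 = A 0" "A' 1 = A' 0"
  shows "((\<lambda>t. (lam\<^sup>2 - mu) * ((\<rho> t)\<^sup>2 * p t * A t) -
    ((lam * \<rho> t - c)\<^sup>2 * p t * A t + (lam * \<rho> t - c) * q t * A' t)) has_integral 0) {0..1}"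
proof (rule integral_periodic_derivative)
  note D = spin_systemD[OF sys]
  show "((\<lambda>t. A' t * p t + 2 * c * (q t * A t)) has_real_derivative
    ((lam\<^sup>2 - mu) * ((\<rho> t)\<^sup>2 * p t * A t) -
    ((lam * \<rho> t - c)\<^sup>2 * p t * A t + (lam * \<rho> t - c) * q t * A' t))) (at t)" for t
    by (auto intro!: derivative_eq_intros A D(3,4)) (simp add: algebra_simps power2_eq_square)
  show "A' 1 * p 1 + 2 * c * (q 1 * A 1) = A' 0 * p 0 + 2 * c * (q 0 * A 0)"
    using per D(1,2)[of 0] by simp
qed

text \<open>Riccati: integrate the derivative of \<open>A' / A\<close> over a period.\<close>

lemma laplace_ground_state_bound:
  assumes A: "\<And>t. (A has_real_derivative A' t) (at t)"
      "\<And>t. (A' has_real_derivative - ((mu * (\<rho> t)\<^sup>2 - c\<^sup>2) * A t)) (at t)"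
    and per: "A 1 = A 0" "A' 1 = A' 0" and pos: "\<And>t. t \<in> {0..1} \<Longrightarrow> 0 < A t"
    and cont: "continuous_on {0..1} \<rho>"
  shows "mu * integral {0..1} (\<lambda>t. (\<rho> t)\<^sup>2) \<le> c\<^sup>2"
proof -
  have "((\<lambda>t. c\<^sup>2 - mu * (\<rho> t)\<^sup>2 - (A' t / A t)\<^sup>2) has_integral A' 1 / A 1 - A' 0 / A 0) {0..1}"
  proof (rule fundamental_theorem_of_calculus)
    fix t :: real assume t: "t \<in> {0..1}"
    then have "((\<lambda>t. A' t / A t) has_real_derivative c\<^sup>2 - mu * (\<rho> t)\<^sup>2 - (A' t / A t)\<^sup>2) (at t)"
      using pos[OF t]
      by (auto intro!: derivative_eq_intros A) (simp add: field_simps power2_eq_square)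
    then show "((\<lambda>t. A' t / A t) has_vector_derivative c\<^sup>2 - mu * (\<rho> t)\<^sup>2 - (A' t / A t)\<^sup>2)
        (at t within {0..1})"
      by (simp flip: has_real_derivative_iff_has_vector_derivative add: has_field_derivative_at_within)
  qed simp
  moreover have "((\<lambda>t. c\<^sup>2 - mu * (\<rho> t)\<^sup>2) has_integral c\<^sup>2 - mu * integral {0..1} (\<lambda>t. (\<rho> t)\<^sup>2)) {0..1}"
    using has_integral_const_real[of "c\<^sup>2" 0 1]
    by (intro has_integral_diff has_integral_mult_right integrable_integral integrable_continuous_interval
        continuous_intros cont) simp
  ultimately show ?thesis
    using has_integral_le[of "\<lambda>t. c\<^sup>2 - mu * (\<rho> t)\<^sup>2 - (A' t / A t)\<^sup>2" _ "{0..1}" "\<lambda>t. c\<^sup>2 - mu * (\<rho> t)\<^sup>2"] per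
    by fastforce
qed

text \<open>In the pairing identity the right hand side is at least \<open>5/16 * I\<close>, with
  \<open>I\<close> the integral of \<open>d\<^sup>2\<close>, and the integral \<open>X\<close>
  multiplying \<open>lam\<^sup>2 - mu\<close> is at most 10. So the gap is at least
  \<open>I / 32\<close>, and \<open>I\<close> dominates the variance \<open>V\<close> of
  \<open>\<rho>\<close>. The constant 100 is a rounded form of 32.\<close>

lemma spin_laplace_gap:
  assumes sys: "spin_system (2 * pi) lam \<rho> p q"
    and pq: "\<And>t. t \<in> {0..1} \<Longrightarrow> \<bar>p t - 1\<bar> \<le> 1 / 4"
      "\<And>t. t \<in> {0..1} \<Longrightarrow> \<bar>q t\<bar> \<le> 2 * integral {0..1} (\<lambda>t. \<bar>lam * \<rho> t - 2 * pi\<bar>)"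
    and A: "\<And>t. (A has_real_derivative A' t) (at t)"
      "\<And>t. (A' has_real_derivative - ((mu * (\<rho> t)\<^sup>2 - (2 * pi)\<^sup>2) * A t)) (at t)"
    and per: "A 1 = A 0" "A' 1 = A' 0"
    and A_bounds: "\<And>t. t \<in> {0..1} \<Longrightarrow> 1 / 2 \<le> A t \<and> A t \<le> 2 \<and> \<bar>A' t\<bar> \<le> 1 / 32"
    and cont: "continuous_on {0..1} \<rho>" and \<rho>: "\<And>t. t \<in> {0..1} \<Longrightarrow> 0 < \<rho> t \<and> \<rho> t \<le> 2"
    and lam: "1 \<le> lam"
  shows "mu + (integral {0..1} (\<lambda>t. (\<rho> t)\<^sup>2) - (integral {0..1} \<rho>)\<^sup>2) / 100 \<le> lam\<^sup>2"
proof -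
  define d where "d t = lam * \<rho> t - 2 * pi" for t
  define I where "I = integral {0..1} (\<lambda>t. (d t)\<^sup>2)"
  define N where "N = integral {0..1} (\<lambda>t. \<bar>d t\<bar>)"
  define X where "X = integral {0..1} (\<lambda>t. (\<rho> t)\<^sup>2 * p t * A t)"
  define V where "V = integral {0..1} (\<lambda>t. (\<rho> t)\<^sup>2) - (integral {0..1} \<rho>)\<^sup>2"
  note D = spin_systemD[OF sys]
  have contd: "continuous_on {0..1} d" unfolding d_def by (intro continuous_intros cont)
  have contA: "continuous_on {0..1} A" "continuous_on {0..1} A'"
    using A by (auto intro!: continuous_at_imp_continuous_on DERIV_isCont)
  have hX: "((\<lambda>t. (\<rho> t)\<^sup>2 * p t * A t) has_integral X) {0..1}"
    unfolding X_def
    by (intro integrable_integral integrable_continuous_interval continuous_intros cont D contA)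
  have hI: "((\<lambda>t. (d t)\<^sup>2) has_integral I) {0..1}"
    unfolding I_def by (intro integrable_integral integrable_continuous_interval continuous_intros contd)
  have hN: "((\<lambda>t. \<bar>d t\<bar>) has_integral N) {0..1}"
    unfolding N_def by (intro integrable_integral integrable_continuous_interval continuous_intros contd)
  have h\<rho>: "(\<rho> has_integral integral {0..1} \<rho>) {0..1}"
    "((\<lambda>t. (\<rho> t)\<^sup>2) has_integral integral {0..1} (\<lambda>t. (\<rho> t)\<^sup>2)) {0..1}"
    by (intro integrable_integral integrable_continuous_interval continuous_intros cont)+
  have N0: "0 \<le> N" using has_integral_nonneg[OF hN] by simp
  have NI: "N\<^sup>2 \<le> I"
    using square_integral_le(1)[of "\<lambda>t. \<bar>d t\<bar>"] contd by (simp add: N_def I_def continuous_intros)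
  have "((\<lambda>t. (lam\<^sup>2 - mu) * ((\<rho> t)\<^sup>2 * p t * A t) - ((d t)\<^sup>2 * p t * A t + d t * q t * A' t)) has_integral 0) {0..1}"
    using spin_laplace_identity[OF sys A per] by (simp add: d_def)
  from has_integral_diff[OF has_integral_mult_right[OF hX, of "lam\<^sup>2 - mu"] this]
  have Y: "((\<lambda>t. (d t)\<^sup>2 * p t * A t + d t * q t * A' t) has_integral (lam\<^sup>2 - mu) * X) {0..1}" by simp
  \<comment> \<open>Pointwise \<open>p * A\<close> is at least \<open>3/4 * 1/2\<close>, and the
    cross term is at most \<open>N/16 * \<bar>d\<bar>\<close> because
    \<open>2 * N * 1/32 = N/16\<close>. The resulting \<open>N\<^sup>2 / 16\<close> is then absorbed
    through \<open>N\<^sup>2 \<le> I\<close>.\<close>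
  have "3/8 * I - (N/16) * N \<le> (lam\<^sup>2 - mu) * X"
  proof (rule has_integral_le[OF has_integral_diff[OF has_integral_mult_right[OF hI] has_integral_mult_right[OF hN]] Y])
    fix t :: real assume t: "t \<in> {0..1}"
    have "3/4 \<le> p t" using pq(1)[OF t] by linarith
    then have "3/4 * (1/2) \<le> p t * A t" using A_bounds[OF t] by (intro mult_mono) auto
    from mult_left_mono[OF this, of "(d t)\<^sup>2"]
    have 1: "3/8 * (d t)\<^sup>2 \<le> (d t)\<^sup>2 * p t * A t" by (simp add: mult.assoc mult.commute)
    have "\<bar>q t\<bar> * \<bar>A' t\<bar> \<le> (2 * N) * (1/32)"
      using pq(2)[OF t] A_bounds[OF t] N0 by (intro mult_mono) (auto simp: N_def d_def)
    from mult_left_mono[OF this, of "\<bar>d t\<bar>"]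
    have "\<bar>d t * q t * A' t\<bar> \<le> N/16 * \<bar>d t\<bar>" by (simp add: abs_mult ac_simps)
    with 1 show "3/8 * (d t)\<^sup>2 - N/16 * \<bar>d t\<bar> \<le> (d t)\<^sup>2 * p t * A t + d t * q t * A' t" by linarith
  qed
  then have YI: "5/16 * I \<le> (lam\<^sup>2 - mu) * X" using NI by (simp add: power2_eq_square)
  have pA: "3/8 \<le> p t * A t \<and> p t * A t \<le> 5/2" if t: "t \<in> {0..1}" for t
  proof -
    have p: "3/4 \<le> p t" "p t \<le> 5/4" using pq(1)[OF t] by linarith+
    then have "3/4 * (1/2) \<le> p t * A t" "p t * A t \<le> 5/4 * 2"
      using A_bounds[OF t] by (intro mult_mono; simp)+
    then show ?thesis by simp
  qed
  have X10: "X \<le> 10"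
  proof -
    have "X \<le> 10 * (1 - 0)"
    proof (rule has_integral_le[OF hX])
      show "((\<lambda>t. 10) has_integral (10 * (1 - 0) :: real)) {0..1::real}"
        using has_integral_const_real[of "10::real" 0 1] by simp
      fix t :: real assume t: "t \<in> {0..1}"
      have "(\<rho> t)\<^sup>2 \<le> 2\<^sup>2" using \<rho>[OF t] by (intro power_mono) auto
      then have "(\<rho> t)\<^sup>2 * (p t * A t) \<le> 4 * (5/2)" using pA[OF t] by (intro mult_mono) auto
      then show "(\<rho> t)\<^sup>2 * p t * A t \<le> 10" by (simp add: mult.assoc)
    qed
    then show ?thesis by simp
  qed
  have pos: "0 < (\<rho> t)\<^sup>2 * p t * A t" if t: "t \<in> {0..1}" for t
    using \<rho>[OF t] pA[OF t] by (simp add: mult.assoc)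
  have "X \<noteq> 0"
  proof
    assume "X = 0"
    then have "(\<rho> 0)\<^sup>2 * p 0 * A 0 = 0"
      using hX less_imp_le[OF pos]
      by (intro continuous_integral_zero_imp_zero[where t = 0 and f = "\<lambda>t. (\<rho> t)\<^sup>2 * p t * A t"])
         (auto intro!: continuous_intros cont D contA)
    moreover have "0 < (\<rho> 0)\<^sup>2 * p 0 * A 0" by (rule pos) simp
    ultimately show False by linarith
  qed
  moreover have "0 \<le> X" using has_integral_nonneg[OF hX] less_imp_le[OF pos] by blast
  ultimately have X0: "0 < X" by simp
  have I0: "0 \<le> I" using has_integral_nonneg[OF hI] by simp
  \<comment> \<open>The sign has to be settled first: only for a nonnegative factor may
    \<open>X\<close> be replaced by its upper bound 10.\<close>
  have "0 \<le> lam\<^sup>2 - mu"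
  proof (rule ccontr)
    assume "\<not> 0 \<le> lam\<^sup>2 - mu"
    then have "(lam\<^sup>2 - mu) * X < 0" using X0 by (simp add: mult_neg_pos)
    then show False using YI I0 by simp
  qed
  then have "(lam\<^sup>2 - mu) * X \<le> (lam\<^sup>2 - mu) * 10" using X10 by (rule mult_left_mono[rotated])
  then have gap: "I / 32 \<le> lam\<^sup>2 - mu" using YI by simp
  have "((\<lambda>t. lam\<^sup>2 * (\<rho> t)\<^sup>2 - (4 * pi * lam) * \<rho> t + (2 * pi)\<^sup>2) has_integral
      lam\<^sup>2 * integral {0..1} (\<lambda>t. (\<rho> t)\<^sup>2) - (4 * pi * lam) * integral {0..1} \<rho> + (2 * pi)\<^sup>2) {0..1}"
    using has_integral_const_real[of "(2 * pi)\<^sup>2" 0 1]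
    by (intro has_integral_add has_integral_diff has_integral_mult_right h\<rho>) simp
  moreover have "(\<lambda>t. lam\<^sup>2 * (\<rho> t)\<^sup>2 - (4 * pi * lam) * \<rho> t + (2 * pi)\<^sup>2) = (\<lambda>t. (d t)\<^sup>2)"
    by (auto simp: d_def power2_eq_square algebra_simps)
  ultimately have "I = lam\<^sup>2 * integral {0..1} (\<lambda>t. (\<rho> t)\<^sup>2) - (4 * pi * lam) * integral {0..1} \<rho> + (2 * pi)\<^sup>2"
    using has_integral_unique[OF hI] by simp
  \<comment> \<open>Completing the square in \<open>lam\<close> times the mean of
    \<open>\<rho>\<close> separates the variance from the mean detuning.\<close>
  then have "I = lam\<^sup>2 * V + (lam * integral {0..1} \<rho> - 2 * pi)\<^sup>2"
    by (simp add: V_def power2_eq_square algebra_simps)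
  then have "lam\<^sup>2 * V \<le> I" by simp
  moreover have "0 \<le> V" using square_integral_le(1)[OF cont] by (simp add: V_def)
  moreover have "1 \<le> lam\<^sup>2" using lam by simp
  ultimately have "V \<le> I" using mult_right_mono[of 1 "lam\<^sup>2" V] by simp
  then show ?thesis using gap \<open>0 \<le> V\<close> unfolding V_def[symmetric] by simp
qed

section \<open>Fourier modes\<close>

definition wave :: "int \<Rightarrow> real \<Rightarrow> complex"
  where "wave l y = cis (2 * pi * of_int l * y)"

lemma wave_simps [simp]: "wave l (y + 1) = wave l y" "wave 0 y = 1" "norm (wave l y) = 1"
  by (simp_all add: wave_def distrib_left cis_mult[symmetric] cis_multiple_2pi)

lemma wave_mult: "wave k y * wave l y = wave (k + l) y"
  by (simp add: wave_def cis_mult algebra_simps)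

lemma wave_has_vector_derivative [derivative_intros]:
  "(wave l has_vector_derivative 2 * of_real pi * \<i> * of_int l * wave l y) (at y within S)"
proof -
  have "((\<lambda>y. of_real (2 * pi * of_int l * y) * \<i>) has_vector_derivative (2 * of_real pi * of_int l) * \<i>) (at y within S)"
    by (auto intro!: derivative_eq_intros)
  from field_vector_diff_chain_within[OF this DERIV_exp[THEN has_field_derivative_at_within]]
  show ?thesis
    by (simp add: o_def wave_def[abs_def] cis_conv_exp algebra_simps)
qed

lemma continuous_on_wave [continuous_intros]: "continuous_on S (wave l)"
  unfolding wave_def[abs_def] by (intro continuous_intros)

section \<open>Fourier coefficients in one variable and their completeness\<close>

definition fourier_coeff :: "int \<Rightarrow> (real \<Rightarrow> complex) \<Rightarrow> complex"
  where "fourier_coeff l f = integral {0..1} (\<lambda>y. wave (- l) y * f y)"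

text \<open>Integration by parts; the boundary terms cancel by periodicity.\<close>

lemma fourier_coeff_derivative:
  assumes der: "\<And>y. (f has_vector_derivative f' y) (at y)" and cont: "continuous_on UNIV f'"
    and per: "f (1::real) = f 0"
  shows "fourier_coeff l f' = 2 * of_real pi * \<i> * of_int l * fourier_coeff l f"
proof -
  have contf: "continuous_on UNIV f"
    using der by (auto intro!: continuous_at_imp_continuous_on has_vector_derivative_continuous)
  have "((\<lambda>y. wave (- l) y * f' y - 2 * of_real pi * \<i> * of_int l * (wave (- l) y * f y)) has_integral
      (wave (- l) 1 * f 1 - wave (- l) 0 * f 0)) {0..1}"
  proof (rule fundamental_theorem_of_calculus)
    show "((\<lambda>y. wave (- l) y * f y) has_vector_derivative
      wave (- l) y * f' y - 2 * of_real pi * \<i> * of_int l * (wave (- l) y * f y)) (at y within {0..1})" for y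
      by (rule has_vector_derivative_eq_rhs[OF has_vector_derivative_mult[OF wave_has_vector_derivative
            has_vector_derivative_at_within[OF der]]]) (simp add: algebra_simps)
  qed simp
  moreover have "wave (- l) 1 = wave (- l) 0" using wave_simps(1)[of "- l" 0] by simp
  ultimately have 0: "((\<lambda>y. wave (- l) y * f' y - 2 * of_real pi * \<i> * of_int l * (wave (- l) y * f y)) has_integral 0) {0..1}"
    using per by simp
  have "((\<lambda>y. wave (- l) y * f' y) has_integral fourier_coeff l f') {0..1}"
    "((\<lambda>y. wave (- l) y * f y) has_integral fourier_coeff l f) {0..1}"
    unfolding fourier_coeff_def
    by (intro integrable_integral integrable_continuous_interval continuous_intros
        continuous_on_subset[OF cont] continuous_on_subset[OF contf]; simp)+
  from has_integral_unique[OF 0 has_integral_diff[OF this(1) has_integral_mult_right[OF this(2)]]]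
  show ?thesis by simp
qed

text \<open>Testing \<open>f\<close> against powers of the trigonometric polynomial \<open>T\<close>, which exceeds \<open>1\<close> near a point
  \<open>y0\<close> and is bounded by \<open>1\<close> away from it, isolates the value of \<open>f\<close> at \<open>y0\<close>.\<close>

lemma fourier_coeffs_zero_imp_zero:
  fixes f :: "real \<Rightarrow> complex"
  assumes cont: "continuous_on UNIV f" and per: "\<And>y. f (y + 1) = f y"
    and zero: "\<And>l. fourier_coeff l f = 0"
  shows "f y = 0"
proof -
  \<comment> \<open>Interior points leave room for a window around \<open>y0\<close> inside the unit
    interval; the endpoints follow by continuity at the end.\<close>
  have inner: "f y0 = 0" if y0: "y0 \<in> {0<..<1}" for y0
  proof (rule ccontr)
    assume nz: "f y0 \<noteq> 0"
    define g where "g y = Re (cnj (f y0) * f y)" for y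
    have contg: "continuous_on S g" for S
      unfolding g_def by (intro continuous_intros continuous_on_subset[OF cont]) simp
    have g0: "0 < g y0"
      using nz unfolding g_def by (simp add: complex_mult_cnj mult.commute[of "cnj _"] sum_power2_gt_zero_iff complex_eq_iff)
    have "\<exists>d>0. \<forall>y. dist y y0 < d \<longrightarrow> dist (g y) (g y0) < g y0 / 2"
      using contg[of UNIV] g0 unfolding continuous_on_iff by (metis UNIV_I half_gt_zero)
    then obtain d where d: "0 < d" "\<And>y. \<bar>y - y0\<bar> < d \<Longrightarrow> \<bar>g y - g y0\<bar> < g y0 / 2"
      by (auto simp: dist_real_def)
    \<comment> \<open>The bound by \<open>d\<close> keeps \<open>g\<close> above half its value at
      \<open>y0\<close> on the window. The bound by \<open>y0\<close> and \<open>1 - y0\<close>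
      keeps the window inside the unit interval and the periodic copies of \<open>y0\<close> at
      distance at least \<open>\<delta>\<close> from it.\<close>
    define \<delta> where "\<delta> = min (d / 2) (min y0 (1 - y0) / 2)"
    have \<delta>: "0 < \<delta>" "\<delta> < d" "\<delta> \<le> y0" "\<delta> \<le> 1 - y0" "\<delta> < 1 / 2"
      using d(1) y0 unfolding \<delta>_def by (auto simp: min_def)
    define T where "T y = cos (2 * pi * (y - y0)) + (1 - cos (2 * pi * \<delta>))" for y
    have contT: "continuous_on S T" for S unfolding T_def by (intro continuous_intros)
    \<comment> \<open>Multiplication by \<open>T\<close> only mixes the frequency \<open>l\<close>
      with its neighbours, so the vanishing of all moments passes from \<open>T ^ n\<close> to
      \<open>T ^ Suc n\<close> when \<open>l\<close> is kept arbitrary in the induction.\<close>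
    have T_wave: "of_real (T y) * wave l y =
        cis (- 2 * pi * y0) / 2 * wave (l + 1) y + cis (2 * pi * y0) / 2 * wave (l - 1) y
          + of_real (1 - cos (2 * pi * \<delta>)) * wave l y" for l y
    proof -
      have "of_real (cos (2 * pi * (y - y0))) = (cis (2 * pi * (y - y0)) + cis (- (2 * pi * (y - y0)))) / 2"
        by (simp add: complex_eq_iff)
      also have "\<dots> = cis (- 2 * pi * y0) / 2 * wave 1 y + cis (2 * pi * y0) / 2 * wave (- 1) y"
        by (simp add: wave_def cis_mult algebra_simps add_divide_distrib)
      finally have "of_real (T y) * wave l y = (cis (- 2 * pi * y0) / 2 * wave 1 y
          + cis (2 * pi * y0) / 2 * wave (- 1) y) * wave l y + of_real (1 - cos (2 * pi * \<delta>)) * wave l y"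
        by (simp only: T_def of_real_add distrib_right)
      also have "\<dots> = cis (- 2 * pi * y0) / 2 * (wave 1 y * wave l y)
          + cis (2 * pi * y0) / 2 * (wave (- 1) y * wave l y) + of_real (1 - cos (2 * pi * \<delta>)) * wave l y"
        by (simp only: distrib_right mult.assoc)
      finally show ?thesis
        by (simp only: wave_mult add.commute[of l]) simp
    qed
    have moments: "((\<lambda>y. of_real (T y ^ n) * wave l y * f y) has_integral 0) {0..1}" for n l
    proof (induction n arbitrary: l)
      case 0
      have "((\<lambda>y. wave l y * f y) has_integral fourier_coeff (- l) f) {0..1}"
        unfolding fourier_coeff_def minus_minus
        by (intro integrable_integral integrable_continuous_interval continuous_intros continuous_on_subset[OF cont]) simp
      then show ?case using zero by simp
    next
      case (Suc n)
      have "((\<lambda>y. cis (- 2 * pi * y0) / 2 * (of_real (T y ^ n) * wave (l + 1) y * f y)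
          + cis (2 * pi * y0) / 2 * (of_real (T y ^ n) * wave (l - 1) y * f y)
          + of_real (1 - cos (2 * pi * \<delta>)) * (of_real (T y ^ n) * wave l y * f y)) has_integral
          cis (- 2 * pi * y0) / 2 * 0 + cis (2 * pi * y0) / 2 * 0 + of_real (1 - cos (2 * pi * \<delta>)) * 0) {0..1}"
        by (intro has_integral_add has_integral_mult_right Suc.IH)
      moreover have "cis (- 2 * pi * y0) / 2 * (of_real (T y ^ n) * wave (l + 1) y * f y)
          + cis (2 * pi * y0) / 2 * (of_real (T y ^ n) * wave (l - 1) y * f y)
          + of_real (1 - cos (2 * pi * \<delta>)) * (of_real (T y ^ n) * wave l y * f y)
          = of_real (T y ^ Suc n) * wave l y * f y" for y
      proof -
        have "of_real (T y ^ Suc n) * wave l y * f y = of_real (T y ^ n) * f y * (of_real (T y) * wave l y)"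
          by (simp add: mult_ac)
        then show ?thesis unfolding T_wave by (simp add: algebra_simps)
      qed
      ultimately show ?case by simp
    qed
    have Tg: "((\<lambda>y. T y ^ n * g y) has_integral 0) {0..1}" for n
    proof -
      have "((\<lambda>y. Re (cnj (f y0) * (of_real (T y ^ n) * wave 0 y * f y))) has_integral Re (cnj (f y0) * 0)) {0..1}"
        by (rule has_integral_Re[OF has_integral_mult_right[OF moments]])
      moreover have "Re (cnj (f y0) * (of_real (T y ^ n) * wave 0 y * f y)) = T y ^ n * g y" for y
        by (simp add: g_def algebra_simps flip: of_real_power)
      ultimately show ?thesis by simp
    qed
    have "\<exists>x\<in>{0..1}. \<forall>y\<in>{0..1}. \<bar>g y\<bar> \<le> \<bar>g x\<bar>"
      by (rule continuous_attains_sup) (auto intro!: continuous_intros contg)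
    then obtain K where K: "\<And>y. y \<in> {0..1} \<Longrightarrow> \<bar>g y\<bar> \<le> K" by blast
    \<comment> \<open>The amount by which \<open>T\<close> exceeds 1 at distance
      \<open>\<delta> / 2\<close> from \<open>y0\<close>; it drives the exponential growth.\<close>
    define \<eta> where "\<eta> = cos (pi * \<delta>) - cos (2 * pi * \<delta>)"
    have \<eta>: "0 < \<eta>" unfolding \<eta>_def using \<delta> pi_gt_zero by (simp add: cos_monotone_0_pi)
    have Tabs: "cos (2 * pi * (y - y0)) = cos (2 * pi * \<bar>y - y0\<bar>)" for y
      using cos_abs_real[of "2 * pi * (y - y0)"] by (simp add: abs_mult)
    have T_near: "1 \<le> T y" if "\<bar>y - y0\<bar> \<le> \<delta>" for y
    proof -
      have "cos (2 * pi * \<delta>) \<le> cos (2 * pi * \<bar>y - y0\<bar>)"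
        using that \<delta> by (intro cos_monotone_0_pi_le) auto
      then show ?thesis using Tabs[of y] by (simp add: T_def)
    qed
    have T_nearer: "1 + \<eta> \<le> T y" if "\<bar>y - y0\<bar> \<le> \<delta> / 2" for y
    proof -
      have "cos (2 * pi * (\<delta> / 2)) \<le> cos (2 * pi * \<bar>y - y0\<bar>)"
        using that \<delta> by (intro cos_monotone_0_pi_le mult_left_mono) auto
      then show ?thesis using Tabs[of y] by (simp add: T_def \<eta>_def)
    qed
    have T_far: "\<bar>T y\<bar> \<le> 1" if "\<bar>y - y0\<bar> \<ge> \<delta>" "y \<in> {0..1}" for y
    proof -
      have far: "\<bar>y - y0\<bar> \<le> 1 - \<delta>" using that \<delta> y0 by (auto simp: abs_if)
      have "cos (2 * pi * \<bar>y - y0\<bar>) \<le> cos (2 * pi * \<delta>)"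
      proof (cases "\<bar>y - y0\<bar> \<le> 1 / 2")
        case True
        then show ?thesis using that \<delta> by (intro cos_monotone_0_pi_le) auto
      next
        case False
        \<comment> \<open>Past half a period the cosine grows again, so distance is measured to the
          next periodic copy of \<open>y0\<close>.\<close>
        have "cos (2 * pi * \<bar>y - y0\<bar>) = cos (2 * pi * (1 - \<bar>y - y0\<bar>))"
          by (simp add: right_diff_distrib cos_diff)
        also have "\<dots> \<le> cos (2 * pi * \<delta>)"
          using False far \<delta> by (intro cos_monotone_0_pi_le) auto
        finally show ?thesis .
      qed
      then show ?thesis
        using Tabs[of y] cos_ge_minus_one[of "2 * pi * \<bar>y - y0\<bar>"] cos_le_one[of "2 * pi * \<delta>"]
        unfolding T_def abs_le_iff by linarith
    qed
    have g_near: "g y0 / 2 \<le> g y" if "\<bar>y - y0\<bar> \<le> \<delta>" for y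
      using d(2)[of y] that \<delta>(2) by linarith
    have lower: "0 \<le> T y ^ n * g y + K" if y: "y \<in> {0..1}" for y n
    proof (cases "\<bar>y - y0\<bar> \<le> \<delta>")
      case True
      have "0 \<le> K" using K[OF y] by linarith
      moreover have "0 \<le> T y ^ n * g y"
        using T_near[OF True] g_near[OF True] g0 by (intro mult_nonneg_nonneg) auto
      ultimately show ?thesis by simp
    next
      case False
      then have "\<bar>T y\<bar> ^ n \<le> 1" using T_far[of y] y by (intro power_le_one) auto
      then have "\<bar>T y ^ n * g y\<bar> \<le> 1 * K" using K[OF y]
        unfolding abs_mult power_abs by (intro mult_mono) auto
      then show ?thesis by linarith
    qed
    \<comment> \<open>Adding \<open>K\<close> makes the integrand nonnegative on the whole period,
      where its integral is \<open>K\<close> because the moments vanish. The half-size window alone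
      contributes at least the left hand side, which is unbounded in \<open>n\<close>.\<close>
    have growth: "(1 + \<eta>) ^ n * (g y0 / 2) * \<delta> \<le> K" for n
    proof -
      let ?I = "{y0 - \<delta>/2..y0 + \<delta>/2}"
      have sub: "?I \<subseteq> {0..1}" using \<delta> by auto
      have hi: "((\<lambda>y. T y ^ n * g y + K) has_integral 0 + K * (1 - 0)) {0..1}"
        using has_integral_const_real[of K 0 1] by (intro has_integral_add Tg) simp
      have int: "(\<lambda>y. T y ^ n * g y + K) integrable_on ?I"
        by (intro integrable_continuous_interval continuous_intros contT contg)
      have "integral ?I (\<lambda>y. (1 + \<eta>) ^ n * (g y0 / 2)) \<le> integral ?I (\<lambda>y. T y ^ n * g y + K)"
      proof (rule integral_le)
        fix y assume y: "y \<in> ?I"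
        then have "y0 - \<delta> / 2 \<le> y" "y \<le> y0 + \<delta> / 2" by auto
        then have near: "\<bar>y - y0\<bar> \<le> \<delta> / 2" "\<bar>y - y0\<bar> \<le> \<delta>" using \<delta>(1) by linarith+
        have "0 \<le> K" using K[of y] y sub by fastforce
        moreover have "(1 + \<eta>) ^ n * (g y0 / 2) \<le> T y ^ n * g y"
          using T_nearer[OF near(1)] T_near[OF near(2)] g_near[OF near(2)] g0 \<eta>
          by (intro mult_mono power_mono) auto
        ultimately show "(1 + \<eta>) ^ n * (g y0 / 2) \<le> T y ^ n * g y + K" by linarith
      qed (use int in auto)
      also have "\<dots> \<le> integral {0..1} (\<lambda>y. T y ^ n * g y + K)"
        using hi int sub lower by (intro integral_subset_le) auto
      also have "\<dots> = K" using hi by (simp add: integral_unique)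
      finally show ?thesis using \<delta> by (simp add: mult_ac)
    qed
    have "0 < g y0 / 2 * \<delta>" using g0 \<delta> by simp
    moreover obtain n where "K / (g y0 / 2 * \<delta>) < (1 + \<eta>) ^ n"
      using real_arch_pow[of "1 + \<eta>"] \<eta> by auto
    ultimately show False using growth[of n] by (simp add: field_simps)
  qed
  obtain s where s: "s \<in> {0..1}" "f y = f s" using periodic_reduce_unit_interval[of f y] per by blast
  have "f s = 0"
  proof (rule continuous_constant_on_closure[where S = "{0<..<1::real}" and f = f])
    show "continuous_on (closure {0<..<1}) f" using cont by (rule continuous_on_subset) simp
    show "s \<in> closure {0<..<1}" using s by simp
  qed (use inner in auto)
  with s show ?thesis by simp
qed

text \<open>\<open>F\<close> is one component of \<open>h \<psi>\<close> and \<open>K / \<rho>\<close> is \<open>h\<close> times the opposite component of \<open>D \<psi>\<close>; the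
  sign \<open>s\<close> distinguishes the two half-spinor bundles.\<close>

lemma dirac_mode_reduction:
  fixes F K Ft Fy Kt Ky :: "real \<Rightarrow> real \<Rightarrow> complex" and s :: real
  assumes per: "\<And>t y. F (t + 1) y = F t y \<and> F t (y + 1) = F t y"
      "\<And>t y. K (t + 1) y = K t y \<and> K t (y + 1) = K t y"
    and nz: "F t0 y0 \<noteq> 0" and lam: "0 < lam"
    and F: "\<And>t y. ((\<lambda>t. F t y) has_vector_derivative Ft t y) (at t)"
      "\<And>t y. (F t has_vector_derivative Fy t y) (at y)"
      "continuous_on UNIV (\<lambda>(t, y). Ft t y)" "continuous_on UNIV (\<lambda>(t, y). Fy t y)"
    and K: "\<And>t y. ((\<lambda>t. K t y) has_vector_derivative Kt t y) (at t)"
      "\<And>t y. (K t has_vector_derivative Ky t y) (at y)"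
      "continuous_on UNIV (\<lambda>(t, y). Kt t y)" "continuous_on UNIV (\<lambda>(t, y). Ky t y)"
    and \<rho>: "\<And>t. 0 < \<rho> t" "\<And>t. (\<rho> has_real_derivative \<rho>' t) (at t)" "\<And>t. \<rho> (t + 1) = \<rho> t"
    and eqK: "\<And>t y. K t y = \<i> * Ft t y - s * Fy t y"
    and eqF: "\<And>t y. \<i> * (Kt t y / \<rho> t - K t y * \<rho>' t / (\<rho> t)\<^sup>2) + s * Ky t y / \<rho> t = of_real (lam\<^sup>2 * \<rho> t) * F t y"
  shows "\<exists>(l::int) p q t. spin_system \<bar>2 * pi * l * s\<bar> lam \<rho> p q \<and> (p t \<noteq> 0 \<or> q t \<noteq> 0)"
proof -
  have slice: "continuous_on S (\<lambda>y. f t y)" if "continuous_on UNIV (\<lambda>(t, y). f t y)"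
    for f :: "real \<Rightarrow> real \<Rightarrow> complex" and t S
  proof -
    have "continuous_on S ((\<lambda>(t, y). f t y) \<circ> (\<lambda>y. (t, y)))"
      by (intro continuous_on_compose continuous_intros continuous_on_subset[OF that]) simp
    then show ?thesis by (simp add: o_def)
  qed
  have cont_y: "continuous_on S (F t)" "continuous_on S (K t)" for S t
    using F(2) K(2) by (auto intro!: continuous_at_imp_continuous_on has_vector_derivative_continuous)
  \<comment> \<open>Differentiation under the integral sign, justified by joint continuity of the
    \<open>t\<close>-derivative.\<close>
  have coeff_deriv: "((\<lambda>t. fourier_coeff l (f t)) has_vector_derivative fourier_coeff l (f' t)) (at t)"
    if der: "\<And>t y. ((\<lambda>t. f t y) has_vector_derivative f' t y) (at t)"
      and cont: "continuous_on UNIV (\<lambda>(t, y). f' t y)" "\<And>t S. continuous_on S (f t)"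
    for f f' :: "real \<Rightarrow> real \<Rightarrow> complex" and l t
    unfolding fourier_coeff_def box_real(2)[symmetric]
  proof (rule leibniz_rule_vector_derivative[where U = UNIV])
    show "((\<lambda>t. wave (- l) y * f t y) has_vector_derivative wave (- l) y * f' t y) (at t)" for t y
      by (intro has_vector_derivative_mult_right der)
    show "(\<lambda>y. wave (- l) y * f t y) integrable_on cbox 0 1" for t
      by (intro integrable_continuous continuous_intros cont)
    have "continuous_on (UNIV \<times> cbox 0 1) (\<lambda>x. wave (- l) (snd x) * (\<lambda>(t, y). f' t y) x)"
      by (intro continuous_intros continuous_on_subset[OF cont(1)] continuous_on_compose2[OF continuous_on_wave[of UNIV]]) auto
    then show "continuous_on (UNIV \<times> cbox 0 1) (\<lambda>(t, y). wave (- l) y * f' t y)"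
      by (simp add: case_prod_beta')
  qed auto
  \<comment> \<open>Completeness of the Fourier system selects a weight in which the spinor is
    visible.\<close>
  have "\<exists>l. fourier_coeff l (F t0) \<noteq> 0"
    using fourier_coeffs_zero_imp_zero[of "F t0" y0] cont_y per nz by blast
  then obtain l where l: "fourier_coeff l (F t0) \<noteq> 0" by blast
  define c where "c = - (2 * pi * l * s)"
  \<comment> \<open>Dividing by \<open>lam * \<rho> t\<close> and turning by \<open>- \<i>\<close>
    gives \<open>X\<close> the scale at which both first order equations carry the same coefficient
    \<open>lam * \<rho>\<close>.\<close>
  define Fl Kl X where "Fl t = fourier_coeff l (F t)" and "Kl t = fourier_coeff l (K t)"
    and "X t = - \<i> * Kl t / of_real (lam * \<rho> t)" for t
  define Ftl Ktl where "Ftl t = fourier_coeff l (Ft t)" and "Ktl t = fourier_coeff l (Kt t)" for t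
  have dFl: "(Fl has_vector_derivative Ftl t) (at t)" for t
    unfolding Fl_def[abs_def] Ftl_def by (intro coeff_deriv F cont_y)
  have dKl: "(Kl has_vector_derivative Ktl t) (at t)" for t
    unfolding Kl_def[abs_def] Ktl_def by (intro coeff_deriv K cont_y)
  have yF: "fourier_coeff l (Fy t) = 2 * of_real pi * \<i> * of_int l * Fl t" for t
    unfolding Fl_def using per(1)[of t 0] by (intro fourier_coeff_derivative F slice) auto
  have yK: "fourier_coeff l (Ky t) = 2 * of_real pi * \<i> * of_int l * Kl t" for t
    unfolding Kl_def using per(2)[of t 0] by (intro fourier_coeff_derivative K slice) auto
  have coeff_lin: "fourier_coeff l (\<lambda>y. a * f y + b * g y) = a * fourier_coeff l f + b * fourier_coeff l g"
    if "continuous_on {0..1} f" "continuous_on {0..1} g" for a b f g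
  proof -
    have "((\<lambda>y. a * (wave (- l) y * f y) + b * (wave (- l) y * g y)) has_integral
        a * fourier_coeff l f + b * fourier_coeff l g) {0..1}"
      unfolding fourier_coeff_def
      by (intro has_integral_add has_integral_mult_right integrable_integral
          integrable_continuous_interval continuous_intros that)
    moreover have "(\<lambda>y. a * (wave (- l) y * f y) + b * (wave (- l) y * g y)) =
        (\<lambda>y. wave (- l) y * (a * f y + b * g y))" by (auto simp: algebra_simps)
    ultimately show ?thesis by (simp add: fourier_coeff_def integral_unique)
  qed
  have Kl: "Kl t = \<i> * Ftl t + \<i> * of_real c * Fl t" for t
  proof -
    have "K t = (\<lambda>y. \<i> * Ft t y + (- of_real s) * Fy t y)" using eqK by auto
    then have "Kl t = \<i> * Ftl t + (- of_real s) * fourier_coeff l (Fy t)"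
      using coeff_lin[of "Ft t" "Fy t" \<i> "- of_real s"] F(3,4) slice by (simp add: Kl_def Ftl_def)
    then show ?thesis by (simp add: yF c_def algebra_simps)
  qed
  have Fl: "of_real (lam\<^sup>2 * \<rho> t) * Fl t =
      \<i> * (Ktl t / \<rho> t - Kl t * \<rho>' t / (\<rho> t)\<^sup>2) - \<i> * of_real c * Kl t / \<rho> t" for t
  proof -
    define a where "a y = (\<i> / \<rho> t) * Kt t y + (s / \<rho> t) * Ky t y" for y
    have contK: "continuous_on {0..1} (Kt t)" "continuous_on {0..1} (Ky t)"
      using K(3,4) by (auto intro: slice)
    then have "continuous_on {0..1} a" unfolding a_def by (intro continuous_intros)
    \<comment> \<open>The zero term only brings the left side into the two-term shape that
      \<open>coeff_lin\<close> expects.\<close>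
    have "(\<lambda>y. of_real (lam\<^sup>2 * \<rho> t) * F t y + 0 * F t y) =
      (\<lambda>y. 1 * a y + (- \<i> * \<rho>' t / (\<rho> t)\<^sup>2) * K t y)"
      unfolding a_def using eqF[of t] by (auto simp: algebra_simps)
    then have "fourier_coeff l (\<lambda>y. of_real (lam\<^sup>2 * \<rho> t) * F t y + 0 * F t y) =
      fourier_coeff l (\<lambda>y. 1 * a y + (- \<i> * \<rho>' t / (\<rho> t)\<^sup>2) * K t y)" by (rule arg_cong)
    then have "of_real (lam\<^sup>2 * \<rho> t) * Fl t + 0 * Fl t =
      1 * ((\<i> / \<rho> t) * Ktl t + (s / \<rho> t) * fourier_coeff l (Ky t)) + (- \<i> * \<rho>' t / (\<rho> t)\<^sup>2) * Kl t"
      unfolding Fl_def Kl_def Ktl_def coeff_lin[OF cont_y(1) cont_y(1)]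
        coeff_lin[OF \<open>continuous_on {0..1} a\<close> cont_y(2)] unfolding a_def coeff_lin[OF contK] .
    then show ?thesis by (simp add: yK c_def algebra_simps)
  qed
  have r0: "lam * \<rho> t \<noteq> 0" "\<rho> t \<noteq> 0" for t using \<rho>(1)[of t] lam by auto
  have F_X: "(Fl has_vector_derivative (lam * \<rho> t) *\<^sub>R X t - c *\<^sub>R Fl t) (at t)" for t
  proof -
    have "(lam * \<rho> t) *\<^sub>R X t = - \<i> * Kl t" using r0(1)[of t] by (simp add: X_def scaleR_conv_of_real)
    then have "Ftl t = (lam * \<rho> t) *\<^sub>R X t - c *\<^sub>R Fl t"
      by (simp add: Kl scaleR_conv_of_real algebra_simps)
    then show ?thesis using dFl[of t] by simp
  qed
  have X_F: "(X has_vector_derivative c *\<^sub>R X t - (lam * \<rho> t) *\<^sub>R Fl t) (at t)" for t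
  proof -
    have inv: "((\<lambda>t. inverse (lam * \<rho> t)) has_vector_derivative - (\<rho>' t / (lam * (\<rho> t)\<^sup>2))) (at t)"
      using r0[of t] lam by (auto intro!: derivative_eq_intros \<rho>
          simp: power2_eq_square field_simps simp flip: has_real_derivative_iff_has_vector_derivative)
    have "((\<lambda>t. inverse (lam * \<rho> t) *\<^sub>R (- \<i> * Kl t)) has_vector_derivative
        inverse (lam * \<rho> t) *\<^sub>R (- \<i> * Ktl t) + (- (\<rho>' t / (lam * (\<rho> t)\<^sup>2))) *\<^sub>R (- \<i> * Kl t)) (at t)"
      using inv
      by (intro has_vector_derivative_scaleR has_vector_derivative_mult_right dKl)
        (simp add: has_real_derivative_iff_has_vector_derivative)
    moreover have "(\<lambda>t. inverse (lam * \<rho> t) *\<^sub>R (- \<i> * Kl t)) = X"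
      by (auto simp: X_def scaleR_conv_of_real divide_inverse)
    moreover have "inverse (lam * \<rho> t) *\<^sub>R (- \<i> * Ktl t) + (- (\<rho>' t / (lam * (\<rho> t)\<^sup>2))) *\<^sub>R (- \<i> * Kl t)
        = c *\<^sub>R X t - (lam * \<rho> t) *\<^sub>R Fl t"
    proof -
      \<comment> \<open>The extra factor \<open>lam\<close> produces
        \<open>lam\<^sup>2 * \<rho> t\<close>, the form in which \<open>Fl\<close> supplies the
        second order equation; it is cancelled afterwards.\<close>
      have "of_real lam * ((lam * \<rho> t) *\<^sub>R Fl t) = of_real (lam\<^sup>2 * \<rho> t) * Fl t"
        by (simp add: scaleR_conv_of_real power2_eq_square)
      also have "\<dots> = of_real lam * (c *\<^sub>R X t - (inverse (lam * \<rho> t) *\<^sub>R (- \<i> * Ktl t) + (- (\<rho>' t / (lam * (\<rho> t)\<^sup>2))) *\<^sub>R (- \<i> * Kl t)))"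
        unfolding Fl using r0[of t] lam by (simp add: X_def scaleR_conv_of_real field_simps power2_eq_square)
      finally have "(lam * \<rho> t) *\<^sub>R Fl t = c *\<^sub>R X t - (inverse (lam * \<rho> t) *\<^sub>R (- \<i> * Ktl t) + (- (\<rho>' t / (lam * (\<rho> t)\<^sup>2))) *\<^sub>R (- \<i> * Kl t))"
        unfolding mult_cancel_left of_real_eq_0_iff using lam by blast
      then show ?thesis by (simp only: diff_diff_eq2 add_diff_cancel_left')
    qed
    ultimately show ?thesis by simp
  qed
  have "Fl (t + 1) = Fl t" "X (t + 1) = X t" for t
    using per \<rho>(3) by (simp_all add: Fl_def X_def Kl_def fourier_coeff_def)
  moreover have "Fl t0 \<noteq> 0 \<or> X t0 \<noteq> 0" using l by (simp add: Fl_def)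
  ultimately have "\<exists>p q t. spin_system \<bar>c\<bar> lam \<rho> p q \<and> (p t \<noteq> 0 \<or> q t \<noteq> 0)"
    using spin_system_of_complex[OF _ _ F_X X_F] by blast
  then show ?thesis by (auto simp: c_def)
qed

section \<open>Smooth functions\<close>

lemma smooth_on_frechet_derivative:
  assumes "smooth_on S f"
  shows "smooth_on S (\<lambda>x. frechet_derivative f (at x) v)"
  unfolding smooth_on_def
proof
  fix n
  have "Ck_on (Suc n) S f" using assms by (simp only: smooth_on_def)
  then show "Ck_on n S (\<lambda>x. frechet_derivative f (at x) v)" by simp
qed

lemma smooth_on_has_derivative:
  assumes "smooth_on S f" "x \<in> S"
  shows "(f has_derivative frechet_derivative f (at x)) (at x)"
proof -
  have "Ck_on (Suc 0) S f" using assms(1) by (simp only: smooth_on_def)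
  then show ?thesis using assms(2) by (simp add: frechet_derivative_works)
qed

lemma smooth_on_imp_continuous_on:
  assumes "smooth_on S f"
  shows "continuous_on S f"
proof -
  have "Ck_on 0 S f" using assms by (simp only: smooth_on_def)
  then show ?thesis by simp
qed

lemma smooth_on_has_real_derivative:
  fixes f :: "real \<Rightarrow> real"
  assumes "smooth_on S f" "x \<in> S"
  shows "(f has_real_derivative frechet_derivative f (at x) 1) (at x)"
proof -
  note D = smooth_on_has_derivative[OF assms]
  have "frechet_derivative f (at x) = (*) (frechet_derivative f (at x) 1)"
  proof
    fix v
    show "frechet_derivative f (at x) v = frechet_derivative f (at x) 1 * v"
      using linear_scale[OF has_derivative_linear[OF D], of v 1] by simp
  qed
  then show ?thesis using D by (simp add: has_field_derivative_def)
qed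

text \<open>For \<open>f = f1 - f2\<close> the existence of the limit together with
  \<open>f 0 = 0\<close> forces \<open>f' 0 = 0\<close>. A single application of l'Hopital then
  suffices, since the quotient \<open>f' E / (2 * E)\<close> converges to half the second derivative
  by the definition of the derivative of \<open>f'\<close> at 0.\<close>

lemma second_derivatives_quadratic_limit:
  fixes f1 f2 :: "real \<Rightarrow> real"
  assumes J: "open J" "0 \<in> J" and smooth: "smooth_on J f1" "smooth_on J f2" and "f1 0 = f2 0"
    and lim: "((\<lambda>E. (f1 E - f2 E) / E\<^sup>2) \<longlongrightarrow> L) (at 0)"
  shows "deriv (deriv f1) 0 = deriv (deriv f2) 0 + 2 * L"
proof -
  define D where "D f x = frechet_derivative f (at x) 1" for f :: "real \<Rightarrow> real" and x :: real
  have sD: "smooth_on J (D f)" if "smooth_on J f" for f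
    unfolding D_def by (rule smooth_on_frechet_derivative[OF that])
  have der: "(f has_real_derivative D f x) (at x)" if "smooth_on J f" "x \<in> J" for f x
    unfolding D_def by (rule smooth_on_has_real_derivative[OF that])
  have evJ: "eventually (\<lambda>x. x \<in> J) (nhds 0)" "eventually (\<lambda>x. x \<in> J) (at 0)"
    using eventually_nhds_in_open[OF J] eventually_at_in_open'[OF J] by simp_all
  have deriv2: "deriv (deriv f) 0 = D (D f) 0" if f: "smooth_on J f" for f
  proof -
    have "\<forall>\<^sub>F x in nhds 0. deriv f x = D f x"
      by (rule eventually_mono[OF evJ(1)]) (use DERIV_imp_deriv[OF der[OF f]] in auto)
    then have "deriv (deriv f) 0 = deriv (D f) 0" by (rule deriv_cong_ev) (rule refl)
    also have "\<dots> = D (D f) 0" by (rule DERIV_imp_deriv[OF der[OF sD[OF f] J(2)]])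
    finally show ?thesis .
  qed
  define g where "g x = D f1 x - D f2 x" for x
  define f where "f x = f1 x - f2 x" for x
  have f: "(f has_real_derivative g x) (at x)" if "x \<in> J" for x
    unfolding f_def[abs_def] g_def using that by (intro DERIV_diff der smooth)
  have g: "(g has_real_derivative D (D f1) 0 - D (D f2) 0) (at 0)"
    unfolding g_def[abs_def] using J(2) by (intro DERIV_diff der sD smooth)
  have "f 0 = 0" by (simp add: f_def assms)
  have "((\<lambda>E. E * (f E / E\<^sup>2)) \<longlongrightarrow> 0 * L) (at 0)"
    using lim unfolding f_def by (intro tendsto_mult tendsto_ident_at)
  moreover have "(\<lambda>E. E * (f E / E\<^sup>2)) = (\<lambda>E. f E / E)"
    by (auto simp: power2_eq_square)
  ultimately have "((\<lambda>E. f E / E) \<longlongrightarrow> 0) (at 0)" by simp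
  moreover have "((\<lambda>E. f E / E) \<longlongrightarrow> g 0) (at 0)"
    using f[OF J(2)] \<open>f 0 = 0\<close> by (simp add: has_field_derivative_iff)
  ultimately have "g 0 = 0" by (rule LIM_unique[symmetric])
  then have "((\<lambda>E. g E / E / 2) \<longlongrightarrow> (D (D f1) 0 - D (D f2) 0) / 2) (at 0)"
    using g by (intro tendsto_divide tendsto_const) (simp_all add: has_field_derivative_iff)
  then have "((\<lambda>E. g E / (2 * E)) \<longlongrightarrow> (D (D f1) 0 - D (D f2) 0) / 2) (at 0)"
    by (simp add: mult.commute)
  then have "((\<lambda>E. f E / E\<^sup>2) \<longlongrightarrow> (D (D f1) 0 - D (D f2) 0) / 2) (at 0)"
  proof (rule lhopital[rotated -1])
    have "isCont f 0" using f[OF J(2)] by (rule DERIV_isCont)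
    then show "(f \<longlongrightarrow> 0) (at 0)" using \<open>f 0 = 0\<close> by (simp add: isCont_def)
    show "((\<lambda>E. E\<^sup>2) \<longlongrightarrow> 0) (at (0::real))" by (auto intro!: tendsto_eq_intros)
    show "\<forall>\<^sub>F E in at (0::real). E\<^sup>2 \<noteq> 0" "\<forall>\<^sub>F E in at (0::real). 2 * E \<noteq> 0"
      by (auto simp: eventually_at_filter)
    show "\<forall>\<^sub>F E in at 0. (f has_real_derivative g E) (at E)"
      by (rule eventually_mono[OF evJ(2) f])
    show "\<forall>\<^sub>F E in at 0. ((\<lambda>E. E\<^sup>2) has_real_derivative 2 * E) (at E)"
      using DERIV_pow[of 2] by (intro always_eventually allI) simp
  qed
  with lim have "L = (D (D f1) 0 - D (D f2) 0) / 2" unfolding f_def by (rule LIM_unique)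
  then show ?thesis unfolding deriv2[OF smooth(1)] deriv2[OF smooth(2)] by simp
qed

lemma has_derivative_slices:
  fixes f :: "real \<times> real \<Rightarrow> 'b::real_normed_vector"
  assumes "(f has_derivative f') (at (E, t))"
  shows "((\<lambda>E. f (E, t)) has_vector_derivative f' (1, 0)) (at E)"
    "((\<lambda>t. f (E, t)) has_vector_derivative f' (0, 1)) (at t)"
proof -
  have lin: "bounded_linear f'" using assms by (rule has_derivative_bounded_linear)
  have "((\<lambda>E. f (E, t)) has_derivative (\<lambda>x. f' (x, 0))) (at E)"
    by (rule has_derivative_compose[OF has_derivative_Pair[OF has_derivative_ident has_derivative_const] assms])
  moreover have "(\<lambda>x. f' (x, 0)) = (\<lambda>x. x *\<^sub>R f' (1, 0))"
  proof
    fix x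
    show "f' (x, 0) = x *\<^sub>R f' (1, 0)"
      using linear_scale[OF bounded_linear.linear[OF lin], of x "(1, 0)"] by simp
  qed
  ultimately show "((\<lambda>E. f (E, t)) has_vector_derivative f' (1, 0)) (at E)"
    by (simp only: has_vector_derivative_def)
  have "((\<lambda>t. f (E, t)) has_derivative (\<lambda>x. f' (0, x))) (at t)"
    by (rule has_derivative_compose[OF has_derivative_Pair[OF has_derivative_const has_derivative_ident] assms])
  moreover have "(\<lambda>x. f' (0, x)) = (\<lambda>x. x *\<^sub>R f' (0, 1))"
  proof
    fix x
    show "f' (0, x) = x *\<^sub>R f' (0, 1)"
      using linear_scale[OF bounded_linear.linear[OF lin], of x "(0, 1)"] by simp
  qed
  ultimately show "((\<lambda>t. f (E, t)) has_vector_derivative f' (0, 1)) (at t)"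
    by (simp only: has_vector_derivative_def)
qed

section \<open>Stability of smoothness under algebraic operations and slicing\<close>

lemma Ck_on_Suc_imp_Ck_on: "Ck_on (Suc n) S f \<Longrightarrow> Ck_on n S f"
proof (induction n arbitrary: f)
  case 0
  then show ?case
    by (auto intro!: continuous_at_imp_continuous_on differentiable_imp_continuous_within)
next
  case (Suc n)
  show ?case
    using Suc.prems Suc.IH unfolding Ck_on.simps(2)[of n] Ck_on.simps(2)[of "Suc n"] by blast
qed

text \<open>Lets an explicit derivative stand in for \<open>frechet_derivative\<close>, so that
  inductions on the order can use the ordinary differentiation rules.\<close>

lemma Ck_on_UNIV_SucI:
  assumes "\<And>x. (f has_derivative f' x) (at x)" "\<And>v. Ck_on n UNIV (\<lambda>x. f' x v)"
  shows "Ck_on (Suc n) UNIV f"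
proof -
  have "frechet_derivative f (at x) = f' x" for x
    using frechet_derivative_at[OF assms(1)] by simp
  then show ?thesis using assms by (auto simp: differentiable_def)
qed

lemma Ck_on_UNIV_has_derivative:
  assumes "Ck_on (Suc n) UNIV f"
  shows "(f has_derivative frechet_derivative f (at x)) (at x)"
    "Ck_on n UNIV (\<lambda>x. frechet_derivative f (at x) v)" "Ck_on n UNIV f"
  using assms Ck_on_Suc_imp_Ck_on[OF assms] by (simp_all add: frechet_derivative_works)

lemma Ck_on_UNIV_add:
  "Ck_on n UNIV f \<Longrightarrow> Ck_on n UNIV g \<Longrightarrow> Ck_on n UNIV (\<lambda>x. f x + g x)"
proof (induction n arbitrary: f g)
  case (Suc n)
  note D = Ck_on_UNIV_has_derivative[OF Suc.prems(1)] Ck_on_UNIV_has_derivative[OF Suc.prems(2)]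
  show ?case
    by (rule Ck_on_UNIV_SucI[OF has_derivative_add[OF D(1,4)]]) (intro Suc.IH D)
qed (simp add: continuous_on_add)

text \<open>By the product rule the derivative is a sum of two expressions of the same bilinear
  shape, so the induction closes with both factors arbitrary. It serves scalar and complex
  multiplication alike.\<close>

lemma Ck_on_UNIV_bounded_bilinear:
  assumes "bounded_bilinear B"
  shows "Ck_on n UNIV f \<Longrightarrow> Ck_on n UNIV g \<Longrightarrow> Ck_on n UNIV (\<lambda>x. B (f x) (g x))"
proof (induction n arbitrary: f g)
  case (Suc n)
  note D = Ck_on_UNIV_has_derivative[OF Suc.prems(1)] Ck_on_UNIV_has_derivative[OF Suc.prems(2)]
  show ?case
    by (rule Ck_on_UNIV_SucI[OF bounded_bilinear.FDERIV[OF assms D(1,4)]])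
      (intro Ck_on_UNIV_add Suc.IH D)
qed (simp add: bounded_bilinear.continuous_on[OF assms])

lemma Ck_on_UNIV_bounded_linear:
  assumes "bounded_linear L"
  shows "Ck_on n UNIV f \<Longrightarrow> Ck_on n UNIV (\<lambda>x. L (f x))"
proof (induction n arbitrary: f)
  case (Suc n)
  note D = Ck_on_UNIV_has_derivative[OF Suc.prems]
  show ?case
    by (rule Ck_on_UNIV_SucI[OF bounded_linear.has_derivative[OF assms D(1)]]) (intro Suc.IH D)
qed (simp add: bounded_linear.continuous_on[OF assms])

lemma smooth_on_UNIV_bounded_bilinear:
  assumes "bounded_bilinear B" "smooth_on UNIV f" "smooth_on UNIV g"
  shows "smooth_on UNIV (\<lambda>x. B (f x) (g x))"
  using assms(2,3) unfolding smooth_on_def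
  by (intro allI Ck_on_UNIV_bounded_bilinear[OF assms(1)]) simp_all

lemma smooth_on_UNIV_bounded_linear:
  assumes "bounded_linear L" "smooth_on UNIV f"
  shows "smooth_on UNIV (\<lambda>x. L (f x))"
  using assms(2) unfolding smooth_on_def
  by (intro allI Ck_on_UNIV_bounded_linear[OF assms(1)]) simp_all

lemma smooth_on_UNIV_diff:
  assumes "smooth_on UNIV f" "smooth_on UNIV g"
  shows "smooth_on UNIV (\<lambda>x. f x - g x)"
proof -
  have "smooth_on UNIV (\<lambda>x. - g x)"
    using smooth_on_UNIV_bounded_linear[OF bounded_linear_minus[OF bounded_linear_ident] assms(2)] .
  then show ?thesis
    using assms Ck_on_UNIV_add[of _ f "\<lambda>x. - g x"] unfolding smooth_on_def by simp
qed

text \<open>The derivative of \<open>d j \<circ> L\<close> is \<open>d (Suc j) \<circ> L\<close>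
  scaled by the fixed linear map \<open>L\<close>. Keeping \<open>j\<close> arbitrary in the
  induction therefore replaces a general chain rule for higher derivatives.\<close>

lemma smooth_on_derivative_sequence:
  fixes d :: "nat \<Rightarrow> real \<Rightarrow> 'b::real_normed_vector"
  assumes L: "bounded_linear L" and d: "\<And>j t. (d j has_vector_derivative d (Suc j) t) (at t)"
  shows "smooth_on UNIV (\<lambda>x. d j (L x))"
proof -
  have deriv: "((\<lambda>x. d j (L x)) has_derivative (\<lambda>v. L v *\<^sub>R d (Suc j) (L x))) (at x)" for x j
    using has_derivative_compose[OF bounded_linear_imp_has_derivative[OF L] d[unfolded has_vector_derivative_def]]
    by simp
  have "Ck_on n UNIV (\<lambda>x. d j (L x))" for n
  proof (induction n arbitrary: j)
    case 0
    show ?case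
      using deriv by (auto intro!: continuous_at_imp_continuous_on has_derivative_continuous)
  next
    case (Suc n)
    show ?case
      by (rule Ck_on_UNIV_SucI[OF deriv])
        (rule Ck_on_UNIV_bounded_linear[OF bounded_linear_scaleR_right Suc.IH])
  qed
  then show ?thesis by (simp add: smooth_on_def)
qed

text \<open>The iterated partial derivatives of \<open>f\<close> in the second variable, frozen at
  \<open>E\<close>, form a sequence of successive derivatives as required by the previous
  lemma.\<close>

lemma smooth_on_slice:
  fixes f :: "real \<times> real \<Rightarrow> 'b::real_normed_vector"
  assumes "smooth_on (J \<times> UNIV) f" "E \<in> J" "bounded_linear L"
  shows "smooth_on UNIV (\<lambda>x. f (E, L x))"
proof -
  define d where "d j t = ((\<lambda>g p. frechet_derivative g (at p) (0, 1)) ^^ j) f (E, t)" for j t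
  have "smooth_on (J \<times> UNIV) (((\<lambda>g p. frechet_derivative g (at p) (0, 1)) ^^ j) f)" for j
    by (induction j) (use assms(1) in \<open>auto intro: smooth_on_frechet_derivative\<close>)
  from has_derivative_slices(2)[OF smooth_on_has_derivative[OF this]]
  have "(d j has_vector_derivative d (Suc j) t) (at t)" for j t
    using assms(2) by (simp add: d_def[abs_def])
  from smooth_on_derivative_sequence[of L d 0, OF assms(3) this] show ?thesis by (simp add: d_def)
qed

section \<open>Uniform limits in the deformation parameter\<close>

text \<open>Uniform continuity on a compact product of a small ball of parameters with one
  period.\<close>

lemma uniform_limit_slice:
  fixes f :: "real \<Rightarrow> real \<Rightarrow> 'b::metric_space"
  assumes "open J" "0 \<in> J" and cont: "continuous_on (J \<times> UNIV) (\<lambda>(E, t). f E t)"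
  shows "uniform_limit {0..1} f (f 0) (at 0)"
proof (rule uniform_limitI)
  fix e :: real assume "0 < e"
  obtain r where r: "0 < r" "cball 0 r \<subseteq> J" using assms(1,2) open_contains_cball by blast
  have "uniformly_continuous_on (cball 0 r \<times> {0..1}) (\<lambda>(E, t). f E t)"
    using r by (intro compact_uniformly_continuous continuous_on_subset[OF cont] compact_Times) auto
  then obtain d where d: "0 < d" and
    "\<And>x x'. x \<in> cball 0 r \<times> {0..1} \<Longrightarrow> x' \<in> cball 0 r \<times> {0..1} \<Longrightarrow> dist x' x < d \<Longrightarrow>
      dist ((\<lambda>(E, t). f E t) x') ((\<lambda>(E, t). f E t) x) < e"
    using \<open>0 < e\<close> unfolding uniformly_continuous_on_def by metis
  from this(2)[of "(0, t)" "(E, t)" for E t] r(1)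
  have "dist (f E t) (f 0 t) < e" if "\<bar>E\<bar> < min r d" "t \<in> {0..1}" for E t
    using that by (simp add: dist_Pair_Pair dist_real_def)
  moreover have "\<forall>\<^sub>F E in at (0::real). \<bar>E\<bar> < min r d"
    using r(1) d by (auto simp: eventually_at dist_real_def intro!: exI[of _ "min r d"])
  ultimately show "\<forall>\<^sub>F E in at 0. \<forall>t\<in>{0..1}. dist (f E t) (f 0 t) < e"
    by (auto elim: eventually_mono)
qed

text \<open>The mean value theorem writes the quotient as \<open>f' x t\<close> with
  \<open>x\<close> between 0 and \<open>E\<close> depending on \<open>t\<close>. Uniform closeness
  of \<open>f' x\<close> to \<open>f' 0\<close> over all small \<open>x\<close> makes this
  dependence harmless.\<close>

lemma uniform_limit_difference_quotient:
  fixes f :: "real \<Rightarrow> real \<Rightarrow> real"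
  assumes J: "open J" "0 \<in> J" and cont: "continuous_on (J \<times> UNIV) (\<lambda>(E, t). f' E t)"
    and der: "\<And>E t. E \<in> J \<Longrightarrow> ((\<lambda>E. f E t) has_real_derivative f' E t) (at E)"
  shows "uniform_limit {0..1} (\<lambda>E t. (f E t - f 0 t) / E) (f' 0) (at 0)"
proof (rule uniform_limitI)
  fix e :: real assume "0 < e"
  from uniform_limitD[OF uniform_limit_slice[OF J cont] this]
  have "\<forall>\<^sub>F E in at 0. \<forall>t\<in>{0..1}. \<bar>f' E t - f' 0 t\<bar> < e" by (simp add: dist_real_def)
  then obtain d where d: "0 < d" "\<And>E t. E \<noteq> 0 \<Longrightarrow> \<bar>E\<bar> < d \<Longrightarrow> t \<in> {0..1} \<Longrightarrow> \<bar>f' E t - f' 0 t\<bar> < e"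
    by (auto simp: eventually_at dist_real_def)
  obtain r where r: "0 < r" "ball 0 r \<subseteq> J" using J open_contains_ball by blast
  have "\<bar>(f E t - f 0 t) / E - f' 0 t\<bar> < e" if E: "E \<noteq> 0" "\<bar>E\<bar> < min d r" and t: "t \<in> {0..1}" for E t
  proof -
    have inJ: "x \<in> J" if "\<bar>x\<bar> \<le> \<bar>E\<bar>" for x using that E r(2) by (auto simp: subset_iff)
    have "\<exists>x. x \<noteq> 0 \<and> \<bar>x\<bar> < \<bar>E\<bar> \<and> f E t - f 0 t = E * f' x t"
    proof (cases "0 < E")
      case True
      then have "\<exists>x>0. x < E \<and> f E t - f 0 t = (E - 0) * f' x t"
        by (intro MVT2 der inJ) auto
      then obtain x where "0 < x" "x < E" "f E t - f 0 t = (E - 0) * f' x t" by blast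
      then show ?thesis by (intro exI[of _ x]) auto
    next
      case False
      then have "\<exists>x>E. x < 0 \<and> f 0 t - f E t = (0 - E) * f' x t"
        using E(1) by (intro MVT2 der inJ) auto
      then obtain x where "E < x" "x < 0" "f 0 t - f E t = (0 - E) * f' x t" by blast
      then show ?thesis by (intro exI[of _ x]) auto
    qed
    then obtain x where "x \<noteq> 0" "\<bar>x\<bar> < \<bar>E\<bar>" "f E t - f 0 t = E * f' x t" by blast
    then show ?thesis using d(2)[of x t] E t by simp
  qed
  moreover have "\<forall>\<^sub>F E in at (0::real). E \<noteq> 0 \<and> \<bar>E\<bar> < min d r"
    using r(1) d(1) by (auto simp: eventually_at dist_real_def intro!: exI[of _ "min d r"])
  ultimately show "\<forall>\<^sub>F E in at 0. \<forall>t\<in>{0..1}. dist ((f E t - f 0 t) / E) (f' 0 t) < e"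
    by (auto elim!: eventually_mono simp: dist_real_def)
qed

section \<open>Eigenvalues on the torus\<close>

lemma partial_eqI:
  assumes "(f has_derivative f') (at p)"
  shows "partial_t f p = f' (1, 0)" "partial_y f p = f' (0, 1)"
  using frechet_derivative_at[OF assms] by (simp_all add: partial_t_def partial_y_def)

lemma frechet_derivative_periodic:
  assumes "\<And>p. (f has_derivative frechet_derivative f (at p)) (at p)" "\<And>p. f (p + e) = f p"
  shows "frechet_derivative f (at (p + e)) = frechet_derivative f (at p)"
proof -
  have "((\<lambda>p. p + e) has_derivative (\<lambda>v. v)) (at p)"
    by (auto intro!: derivative_eq_intros)
  from has_derivative_compose[OF this assms(1)]
  have "(f has_derivative frechet_derivative f (at (p + e))) (at p)" by (simp add: assms(2))
  then show ?thesis by (rule frechet_derivative_at)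
qed

text \<open>Everything is phrased through the components of \<open>h\<close> times the spinor, since
  the conformal formula differentiates exactly this product; the rule is applied twice to compute
  the square.\<close>

lemma dirac_op_eq:
  assumes "\<And>q. h (fst q) *\<^sub>R \<psi> q = (u q, v q)"
    and "(u has_derivative u') (at p)" "(v has_derivative v') (at p)"
  shows "dirac_op h \<psi> p =
    (1 / h (fst p) ^ 3) *\<^sub>R (\<i> * v' (1, 0) + v' (0, 1), \<i> * u' (1, 0) - u' (0, 1))"
proof -
  have "((\<lambda>q. h (fst q) *\<^sub>R \<psi> q) has_derivative (\<lambda>w. (u' w, v' w))) (at p)"
    unfolding assms(1) by (intro has_derivative_Pair assms)
  from partial_eqI[OF this] show ?thesis
    by (simp add: dirac_op_def clifford_t_def clifford_y_def)
qed

text \<open>Each application of the Dirac operator exchanges the half-spinor components, so its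
  square preserves them. Hence a nonzero component alone satisfies a scalar second order equation,
  to which the reduction to Fourier modes applies with \<open>s = 1\<close> or
  \<open>s = -1\<close>.\<close>

lemma dirac_eigenvalue_spin_system:
  assumes smooth: "smooth_on UNIV (\<lambda>p :: real \<times> real. h (fst p))"
    and h: "\<And>t. 0 < h t" "\<And>t. h (t + 1) = h t" "\<And>t. (h has_real_derivative h' t) (at t)"
    and m: "0 < m" "torus_eigenvalue (\<lambda>\<psi>. dirac_op h (dirac_op h \<psi>)) m"
  shows "\<exists>(l::int) p q t. spin_system (2 * pi * \<bar>l\<bar>) (sqrt m) (\<lambda>t. (h t)\<^sup>2) p q \<and> (p t \<noteq> 0 \<or> q t \<noteq> 0)"
proof -
  obtain \<psi> where \<psi>: "smooth_on UNIV \<psi>" "doubly_periodic \<psi>" "\<exists>p. \<psi> p \<noteq> 0"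
    "\<And>p. dirac_op h (dirac_op h \<psi>) p = m *\<^sub>R \<psi> p"
    using m(2) unfolding torus_eigenvalue_def by blast
  define D where "D f w p = frechet_derivative f (at p) w" for f :: "real \<times> real \<Rightarrow> complex" and w p
  define K where "K s F p = \<i> * D F (1, 0) p - of_real s * D F (0, 1) p" for s :: real and F p
  define u v where "u p = fst (h (fst p) *\<^sub>R \<psi> p)" and "v p = snd (h (fst p) *\<^sub>R \<psi> p)" for p
  note smooth_\<psi> = smooth_on_UNIV_bounded_bilinear[OF bounded_bilinear_scaleR smooth \<psi>(1)]
  have smooth_u: "smooth_on UNIV u" "smooth_on UNIV v"
    unfolding u_def[abs_def] v_def[abs_def]
    by (intro smooth_on_UNIV_bounded_linear[OF bounded_linear_fst] smooth_on_UNIV_bounded_linear[OF bounded_linear_snd] smooth_\<psi>)+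
  have smooth_D: "smooth_on UNIV (D F w)" if "smooth_on UNIV F" for F w
    unfolding D_def[abs_def] by (rule smooth_on_frechet_derivative[OF that])
  have smooth_K: "smooth_on UNIV (K s F)" if "smooth_on UNIV F" for F s
    unfolding K_def[abs_def]
    by (intro smooth_on_UNIV_diff smooth_on_UNIV_bounded_linear[OF bounded_linear_mult_right] smooth_D that)
  have der: "(F has_derivative (\<lambda>w. D F w p)) (at p)" if "smooth_on UNIV F" for F p
    unfolding D_def using smooth_on_has_derivative[OF that] by simp
  have h0: "h t \<noteq> 0" for t using h(1)[of t] by simp
  have der_K: "((\<lambda>q. K s F q / of_real ((h (fst q))\<^sup>2)) has_derivative
      (\<lambda>w. D (K s F) w p / of_real ((h (fst p))\<^sup>2)
        - K s F p * of_real (2 * h (fst p) * h' (fst p) * fst w) / of_real (((h (fst p))\<^sup>2)\<^sup>2))) (at p)"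
    if "smooth_on UNIV F" for F s p
  proof -
    have "((\<lambda>q::real \<times> real. h (fst q)) has_derivative (\<lambda>w. h' (fst p) * fst w)) (at p)"
      by (rule has_derivative_compose[OF has_derivative_fst[OF has_derivative_ident] h(3)[unfolded has_field_derivative_def]])
    then have "((\<lambda>q::real \<times> real. of_real ((h (fst q))\<^sup>2)::complex) has_derivative
       (\<lambda>w. of_real (2 * h (fst p) * h' (fst p) * fst w))) (at p)"
      by (auto intro!: derivative_eq_intros simp: algebra_simps)
    moreover have "complex_of_real ((h (fst p))\<^sup>2) \<noteq> 0" using h0[of "fst p"] by simp
    ultimately show ?thesis
      by (rule has_derivative_eq_rhs[OF has_derivative_divide[OF der[OF smooth_K[OF that]]]])
        (simp add: fun_eq_iff divide_inverse power2_eq_square mult_ac)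
  qed
  have dirac1: "dirac_op h \<psi> p = (1 / h (fst p) ^ 3) *\<^sub>R (K (- 1) v p, K 1 u p)" for p
    by (subst dirac_op_eq[OF _ der[OF smooth_u(1)] der[OF smooth_u(2)]])
      (simp_all add: u_def v_def K_def prod_eq_iff)
  have rescale: "h (fst q) *\<^sub>R dirac_op h \<psi> q =
      (K (- 1) v q / of_real ((h (fst q))\<^sup>2), K 1 u q / of_real ((h (fst q))\<^sup>2))" for q
    using h0[of "fst q"] by (simp add: dirac1 scaleR_conv_of_real field_simps power2_eq_square power3_eq_cube)
  \<comment> \<open>The second application of the flat operator, acting on \<open>K s F\<close>
    divided by \<open>h\<^sup>2\<close>; this quotient is a component of \<open>h\<close> times the
    first image.\<close>
  define W where "W s F p = \<i> * (D (K s F) (1, 0) p / of_real ((h (fst p))\<^sup>2)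
        - K s F p * of_real (2 * h (fst p) * h' (fst p)) / of_real (((h (fst p))\<^sup>2)\<^sup>2))
        + of_real s * D (K s F) (0, 1) p / of_real ((h (fst p))\<^sup>2)" for s F p
  have "dirac_op h (dirac_op h \<psi>) p = (1 / h (fst p) ^ 3) *\<^sub>R (W 1 u p, W (- 1) v p)" for p
    by (subst dirac_op_eq[OF rescale der_K[OF smooth_u(2)] der_K[OF smooth_u(1)]]) (simp add: W_def)
  then have "(W 1 u p, W (- 1) v p) = (m * h (fst p) ^ 2) *\<^sub>R (u p, v p)" for p
  proof -
    have "(W 1 u p, W (- 1) v p) = h (fst p) ^ 3 *\<^sub>R dirac_op h (dirac_op h \<psi>) p"
      using h0[of "fst p"] \<open>\<And>p. dirac_op h (dirac_op h \<psi>) p = (1 / h (fst p) ^ 3) *\<^sub>R (W 1 u p, W (- 1) v p)\<close>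
      by simp
    also have "\<dots> = (m * h (fst p) ^ 2) *\<^sub>R (h (fst p) *\<^sub>R \<psi> p)"
      by (simp add: \<psi>(4) power3_eq_cube power2_eq_square mult_ac)
    also have "h (fst p) *\<^sub>R \<psi> p = (u p, v p)" by (simp add: u_def v_def prod_eq_iff)
    finally show ?thesis .
  qed
  then have W: "W 1 u p = (m * h (fst p) ^ 2) *\<^sub>R u p" "W (- 1) v p = (m * h (fst p) ^ 2) *\<^sub>R v p" for p
    by simp_all
  have mode: ?thesis
    if F: "smooth_on UNIV F" "\<And>p. F (p + (1, 0)) = F p" "\<And>p. F (p + (0, 1)) = F p" "F p0 \<noteq> 0"
      and WF: "\<And>p. W s F p = (m * h (fst p) ^ 2) *\<^sub>R F p" and s: "\<bar>s\<bar> = 1" for F s p0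
  proof -
    have K_per: "K s F (p + e) = K s F p" if "\<And>p. F (p + e) = F p" for p e
      using frechet_derivative_periodic[of F e p] smooth_on_has_derivative[OF F(1)] that
      by (simp add: K_def D_def)
    note slices = has_derivative_slices[OF der]
    have "\<exists>(l::int) p q t. spin_system \<bar>2 * pi * l * s\<bar> (sqrt m) (\<lambda>t. (h t)\<^sup>2) p q \<and> (p t \<noteq> 0 \<or> q t \<noteq> 0)"
    proof (rule dirac_mode_reduction[where F = "\<lambda>t y. F (t, y)" and K = "\<lambda>t y. K s F (t, y)"])
      show "F (t + 1, y) = F (t, y) \<and> F (t, y + 1) = F (t, y)" for t y
        using F(2,3)[of "(t, y)"] by simp
      show "K s F (t + 1, y) = K s F (t, y) \<and> K s F (t, y + 1) = K s F (t, y)" for t y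
        using K_per[OF F(2), of "(t, y)"] K_per[OF F(3), of "(t, y)"] by simp
      show "F (fst p0, snd p0) \<noteq> 0" using F(4) by simp
      show "((\<lambda>t. F (t, y)) has_vector_derivative D F (1, 0) (t, y)) (at t)"
        "((\<lambda>y. F (t, y)) has_vector_derivative D F (0, 1) (t, y)) (at y)"
        "((\<lambda>t. K s F (t, y)) has_vector_derivative D (K s F) (1, 0) (t, y)) (at t)"
        "((\<lambda>y. K s F (t, y)) has_vector_derivative D (K s F) (0, 1) (t, y)) (at y)" for t y
        by (intro slices F(1) smooth_K)+
      show "continuous_on UNIV (\<lambda>(t, y). D F (1, 0) (t, y))" "continuous_on UNIV (\<lambda>(t, y). D F (0, 1) (t, y))"
        "continuous_on UNIV (\<lambda>(t, y). D (K s F) (1, 0) (t, y))" "continuous_on UNIV (\<lambda>(t, y). D (K s F) (0, 1) (t, y))"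
        using F(1) by (simp_all add: smooth_on_imp_continuous_on smooth_D smooth_K case_prod_beta)
      show "((\<lambda>t. (h t)\<^sup>2) has_real_derivative 2 * h t * h' t) (at t)" for t
        by (auto intro!: derivative_eq_intros h)
      show "K s F (t, y) = \<i> * D F (1, 0) (t, y) - of_real s * D F (0, 1) (t, y)" for t y
        by (simp add: K_def)
      show "\<i> * (D (K s F) (1, 0) (t, y) / of_real ((h t)\<^sup>2) - K s F (t, y) * of_real (2 * h t * h' t) / (of_real ((h t)\<^sup>2))\<^sup>2)
        + of_real s * D (K s F) (0, 1) (t, y) / of_real ((h t)\<^sup>2) = of_real ((sqrt m)\<^sup>2 * (h t)\<^sup>2) * F (t, y)" for t y
        using WF[of "(t, y)"] m(1) by (simp add: W_def scaleR_conv_of_real)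
    qed (use h m h0 in simp_all)
    then show ?thesis using s by (simp add: abs_mult)
  qed
  have per: "u (p + (1, 0)) = u p" "u (p + (0, 1)) = u p" "v (p + (1, 0)) = v p" "v (p + (0, 1)) = v p" for p
    using \<psi>(2) h(2) by (cases p; simp add: u_def v_def doubly_periodic_def)+
  obtain p where "\<psi> p \<noteq> 0" using \<psi>(3) by blast
  then have "u p \<noteq> 0 \<or> v p \<noteq> 0" using h0[of "fst p"] by (simp add: u_def v_def prod_eq_iff)
  then show ?thesis
  proof
    assume "u p \<noteq> 0"
    then show ?thesis by (rule mode[OF smooth_u(1) per(1,2) _ W(1)]) simp
  next
    assume "v p \<noteq> 0"
    then show ?thesis by (rule mode[OF smooth_u(2) per(3,4) _ W(2)]) simp
  qed
qed

lemma partials_product: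
  assumes A: "\<And>t. (A has_vector_derivative A' t) (at t)" and B: "\<And>y. (B has_vector_derivative B' y) (at y)"
  shows "partial_t (\<lambda>p. A (fst p) * B (snd p) :: complex) = (\<lambda>p. A' (fst p) * B (snd p))"
    "partial_y (\<lambda>p. A (fst p) * B (snd p) :: complex) = (\<lambda>p. A (fst p) * B' (snd p))"
proof -
  have "((\<lambda>p. A (fst p) * B (snd p)) has_derivative
      (\<lambda>w. A (fst p) * (snd w *\<^sub>R B' (snd p)) + (fst w *\<^sub>R A' (fst p)) * B (snd p))) (at p)" for p
    by (intro has_derivative_mult
        has_derivative_compose[OF has_derivative_fst[OF has_derivative_ident] A[unfolded has_vector_derivative_def]]
        has_derivative_compose[OF has_derivative_snd[OF has_derivative_ident] B[unfolded has_vector_derivative_def]])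
  from partial_eqI[OF this]
  show "partial_t (\<lambda>p. A (fst p) * B (snd p)) = (\<lambda>p. A' (fst p) * B (snd p))"
    "partial_y (\<lambda>p. A (fst p) * B (snd p)) = (\<lambda>p. A (fst p) * B' (snd p))"
    by auto
qed

text \<open>Separation of variables with the wave of weight 1. It makes the branch value a
  competitor in the infimum defining the first Laplace eigenvalue.\<close>

lemma laplace_torus_eigenvalue:
  fixes A :: "real \<Rightarrow> complex"
  assumes smooth: "smooth_on UNIV (\<lambda>p :: real \<times> real. A (fst p))"
    and sol: "periodic_solution (laplace_potential h 1 m) A" and nz: "A t0 \<noteq> 0" and h: "\<And>t. 0 < h t"
  shows "torus_eigenvalue (laplace_op h) m"
proof -
  obtain A' where A: "\<And>t. (A has_vector_derivative A' t) (at t)"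
      "\<And>t. (A' has_vector_derivative - (laplace_potential h 1 m t *\<^sub>R A t)) (at t)"
    and per: "\<And>t. A (t + 1) = A t"
    using sol unfolding periodic_solution_def by blast
  have w: "((\<lambda>y. a * wave 1 y) has_vector_derivative (a * (2 * of_real pi * \<i>)) * wave 1 y) (at y)" for a y
    using has_vector_derivative_mult_right[OF wave_has_vector_derivative[of 1 y UNIV], of a]
    by (simp add: mult.assoc)
  have w1: "(wave 1 has_vector_derivative (2 * of_real pi * \<i>) * wave 1 y) (at y)" for y
    using w[of 1] by simp
  define f where "f p = A (fst p) * wave 1 (snd p)" for p :: "real \<times> real"
  have "((\<lambda>y. (2 * of_real pi * \<i>) ^ j * wave 1 y) has_vector_derivative
      (2 * of_real pi * \<i>) ^ Suc j * wave 1 y) (at y)" for j y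
    using w[of "(2 * of_real pi * \<i>) ^ j"] by (simp add: mult.commute)
  from smooth_on_derivative_sequence[of snd "\<lambda>j y. (2 * of_real pi * \<i>) ^ j * wave 1 y" 0, OF bounded_linear_snd this]
  have "smooth_on UNIV (\<lambda>p :: real \<times> real. wave 1 (snd p))" by simp
  then have "smooth_on UNIV f"
    unfolding f_def[abs_def] by (rule smooth_on_UNIV_bounded_bilinear[OF bounded_bilinear_mult smooth])
  moreover have "doubly_periodic f" using per by (simp add: f_def doubly_periodic_def)
  moreover have "f (t0, 0) \<noteq> 0"
    using nz wave_simps(3)[of 1 0] by (auto simp: f_def simp del: wave_simps)
  moreover have "laplace_op h f p = m *\<^sub>R f p" for p
  proof -
    note t = partials_product(1)[OF A(1) w1] partials_product(1)[OF A(2) w1]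
    note y = partials_product(2)[OF A(1) w1] partials_product(2)[OF A(1) w]
    have "laplace_op h f p = - (1 / h (fst p) ^ 4) *\<^sub>R (- (laplace_potential h 1 m (fst p) *\<^sub>R A (fst p)) * wave 1 (snd p)
       + A (fst p) * (((2 * of_real pi * \<i>) * (2 * of_real pi * \<i>)) * wave 1 (snd p)))"
      unfolding laplace_op_def f_def[abs_def] t y ..
    then show ?thesis using h[of "fst p"]
      by (simp add: f_def laplace_potential_def scaleR_conv_of_real field_simps power2_eq_square)
  qed
  ultimately show ?thesis unfolding torus_eigenvalue_def by blast
qed

text \<open>The spinor \<open>(A, 0)\<close> of weight 0 realises the eigenvalue. This shows that
  positive Dirac eigenvalues exist, so that a common lower bound for them passes to their
  infimum.\<close>

lemma dirac_torus_eigenvalue: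
  fixes A :: "real \<Rightarrow> complex"
  assumes smooth: "smooth_on UNIV (\<lambda>p :: real \<times> real. A (fst p))"
    and sol: "periodic_solution (dirac_potential h 0 m) A" and nz: "A t0 \<noteq> 0"
    and h: "\<And>t. 0 < h t" "\<And>t. (h has_real_derivative h' t) (at t)" "\<And>t. (h' has_real_derivative h'' t) (at t)"
  shows "torus_eigenvalue (\<lambda>\<psi>. dirac_op h (dirac_op h \<psi>)) m"
proof -
  obtain A' where A: "\<And>t. (A has_vector_derivative A' t) (at t)"
      "\<And>t. (A' has_vector_derivative - (dirac_potential h 0 m t *\<^sub>R A t)) (at t)"
    and per: "\<And>t. A (t + 1) = A t"
    using sol unfolding periodic_solution_def by blast
  have derivs: "deriv h = h'" "deriv h' = h''" using h(2,3) by (auto intro!: DERIV_imp_deriv)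
  have h0: "h t \<noteq> 0" for t using h(1)[of t] by simp
  have of_fst: "((\<lambda>q :: real \<times> real. U (fst q)) has_derivative (\<lambda>w. fst w *\<^sub>R U')) (at p)"
    if "(U has_vector_derivative U') (at (fst p))" for U :: "real \<Rightarrow> complex" and U' p
    using has_derivative_compose[OF has_derivative_fst[OF has_derivative_ident] that[unfolded has_vector_derivative_def]] .
  define \<psi> :: "real \<times> real \<Rightarrow> complex \<times> complex" where "\<psi> p = (A (fst p), 0)" for p
  define B where "B t = h t *\<^sub>R A' t + h' t *\<^sub>R A t" for t
  \<comment> \<open>The second component of \<open>h\<close> times the Dirac image of
    \<open>\<psi>\<close>, the first one being zero.\<close>
  define C where "C t = inverse ((h t)\<^sup>2) *\<^sub>R (\<i> * B t)" for t
  have dhA: "((\<lambda>t. h t *\<^sub>R A t) has_vector_derivative B t) (at t)" for t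
    unfolding B_def by (intro has_vector_derivative_scaleR A h)
  have dB: "(B has_vector_derivative h t *\<^sub>R (- (dirac_potential h 0 m t *\<^sub>R A t)) + h' t *\<^sub>R A' t
      + (h' t *\<^sub>R A' t + h'' t *\<^sub>R A t)) (at t)" for t
    unfolding B_def[abs_def] by (intro has_vector_derivative_scaleR has_vector_derivative_add A h)
  have dC: "(C has_vector_derivative inverse ((h t)\<^sup>2) *\<^sub>R (\<i> * (h t *\<^sub>R (- (dirac_potential h 0 m t *\<^sub>R A t)) + h' t *\<^sub>R A' t
      + (h' t *\<^sub>R A' t + h'' t *\<^sub>R A t))) + (- (2 * h' t / h t ^ 3)) *\<^sub>R (\<i> * B t)) (at t)" for t
    unfolding C_def[abs_def] using h0[of t]
    by (intro has_vector_derivative_scaleR has_vector_derivative_mult_right dB)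
      (auto intro!: derivative_eq_intros h simp: field_simps power2_eq_square power3_eq_cube)
  have "smooth_on UNIV \<psi>"
    unfolding \<psi>_def[abs_def]
    by (rule smooth_on_UNIV_bounded_linear[OF bounded_linear_Pair[OF bounded_linear_ident bounded_linear_zero] smooth])
  moreover have "doubly_periodic \<psi>" using per by (simp add: \<psi>_def doubly_periodic_def)
  moreover have "\<psi> (t0, 0) \<noteq> 0" using nz by (simp add: \<psi>_def zero_prod_def)
  moreover have "dirac_op h (dirac_op h \<psi>) p = m *\<^sub>R \<psi> p" for p
  proof -
    have 1: "dirac_op h \<psi> p = (1 / h (fst p) ^ 3) *\<^sub>R (0, \<i> * B (fst p))" for p
      by (subst dirac_op_eq[OF _ of_fst[OF dhA] has_derivative_const[of 0]]) (simp_all add: \<psi>_def)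
    have 2: "h (fst q) *\<^sub>R dirac_op h \<psi> q = (0, C (fst q))" for q
      unfolding 1 C_def using h0[of "fst q"] by (simp add: power2_eq_square power3_eq_cube divide_inverse)
    show ?thesis
      using h0[of "fst p"]
      by (subst dirac_op_eq[OF 2 has_derivative_const of_fst[OF dC]])
        (simp add: \<psi>_def B_def dirac_potential_def derivs scaleR_conv_of_real field_simps power2_eq_square
          power3_eq_cube power4_eq_xxxx)
  qed
  ultimately show ?thesis unfolding torus_eigenvalue_def by blast
qed

text \<open>The reduced second order equation factorises. With \<open>F = h A\<close>, let
  \<open>X\<close> be \<open>F' + c F\<close> divided by \<open>lam * h\<^sup>2\<close>; the terms
  of the potential containing derivatives of \<open>h\<close> are exactly those created by the
  conjugation with \<open>h\<close> and by differentiating this divisor.\<close>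

lemma dirac_periodic_solution_spin_system:
  assumes sol: "periodic_solution (dirac_potential h l m) A" and nz: "A t0 \<noteq> 0" and m: "0 < m"
    and h: "\<And>t. 0 < h t" "\<And>t. h (t + 1) = h t"
      "\<And>t. (h has_real_derivative h' t) (at t)" "\<And>t. (h' has_real_derivative h'' t) (at t)"
  shows "\<exists>p q t. spin_system \<bar>2 * pi * l\<bar> (sqrt m) (\<lambda>t. (h t)\<^sup>2) p q \<and> (p t \<noteq> 0 \<or> q t \<noteq> 0)"
proof -
  obtain A' where A: "\<And>t. (A has_vector_derivative A' t) (at t)"
      "\<And>t. (A' has_vector_derivative - (dirac_potential h l m t *\<^sub>R A t)) (at t)"
    and per: "\<And>t. A (t + 1) = A t"
    using sol unfolding periodic_solution_def by blast
  have derivs: "deriv h = h'" "deriv h' = h''" using h(3,4) by (auto intro!: DERIV_imp_deriv)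
  have h0: "h t \<noteq> 0" for t using h(1)[of t] by simp
  \<comment> \<open>\<open>periodic_solution\<close> asserts periodicity only of the function
    itself, so that of derivatives is recovered by uniqueness.\<close>
  have shift: "g' (t + 1) = g' t"
    if "\<And>t. (g has_vector_derivative g' t) (at t)" "\<And>t. g (t + 1) = g t"
    for g :: "real \<Rightarrow> 'c::real_normed_vector" and g' t
  proof -
    have "((\<lambda>s. g (s + 1)) has_vector_derivative g' (t + 1)) (at t)"
    proof -
      have "((\<lambda>s. s + 1) has_vector_derivative 1) (at t)" by (auto intro!: derivative_eq_intros)
      from vector_diff_chain_at[OF this that(1)] show ?thesis by (simp add: o_def)
    qed
    then show ?thesis using that vector_derivative_unique_at[of g "g' (t + 1)" t "g' t"] by simp
  qed
  have per': "A' (t + 1) = A' t" "h' (t + 1) = h' t" for t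
    using shift[of A A', OF A(1) per] shift[of h h'] h(2,3)
    by (simp_all add: has_real_derivative_iff_has_vector_derivative)
  define lam c where "lam = sqrt m" and "c = - (2 * pi * l)"
  have lam: "0 < lam" "m = lam\<^sup>2" using m by (simp_all add: lam_def)
  define F where "F t = h t *\<^sub>R A t" for t
  define B where "B t = h t *\<^sub>R A' t + h' t *\<^sub>R A t" for t
  define X where "X t = inverse (lam * (h t)\<^sup>2) *\<^sub>R (B t + c *\<^sub>R F t)" for t
  have dF: "(F has_vector_derivative B t) (at t)" for t
    unfolding B_def F_def[abs_def] by (intro has_vector_derivative_scaleR A h)
  have dB: "(B has_vector_derivative h t *\<^sub>R (- (dirac_potential h l m t *\<^sub>R A t)) + h' t *\<^sub>R A' t
      + (h' t *\<^sub>R A' t + h'' t *\<^sub>R A t)) (at t)" for t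
    unfolding B_def[abs_def] by (intro has_vector_derivative_scaleR has_vector_derivative_add A h)
  have inv: "((\<lambda>t. inverse (lam * (h t)\<^sup>2)) has_real_derivative - (2 * h' t / (lam * h t ^ 3))) (at t)" for t
    using h0[of t] lam(1)
    by (auto intro!: derivative_eq_intros h simp: field_simps power2_eq_square power3_eq_cube)
  have 1: "(F has_vector_derivative (lam * (h t)\<^sup>2) *\<^sub>R X t - c *\<^sub>R F t) (at t)" for t
  proof -
    have "(lam * (h t)\<^sup>2) *\<^sub>R X t = B t + c *\<^sub>R F t"
      using h0[of t] lam(1) by (simp add: X_def del: inverse_mult_distrib)
    then show ?thesis using dF[of t] by simp
  qed
  have 2: "(X has_vector_derivative c *\<^sub>R X t - (lam * (h t)\<^sup>2) *\<^sub>R F t) (at t)" for t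
  proof -
    have "(X has_vector_derivative inverse (lam * (h t)\<^sup>2) *\<^sub>R ((h t *\<^sub>R (- (dirac_potential h l m t *\<^sub>R A t)) + h' t *\<^sub>R A' t
      + (h' t *\<^sub>R A' t + h'' t *\<^sub>R A t)) + c *\<^sub>R B t) + (- (2 * h' t / (lam * h t ^ 3))) *\<^sub>R (B t + c *\<^sub>R F t)) (at t)"
      unfolding X_def[abs_def]
      by (intro has_vector_derivative_scaleR has_vector_derivative_add
           bounded_linear.has_vector_derivative[OF bounded_linear_scaleR_right] dB dF inv)
    moreover have "inverse (lam * (h t)\<^sup>2) *\<^sub>R ((h t *\<^sub>R (- (dirac_potential h l m t *\<^sub>R A t)) + h' t *\<^sub>R A' t
      + (h' t *\<^sub>R A' t + h'' t *\<^sub>R A t)) + c *\<^sub>R B t) + (- (2 * h' t / (lam * h t ^ 3))) *\<^sub>R (B t + c *\<^sub>R F t)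
      = c *\<^sub>R X t - (lam * (h t)\<^sup>2) *\<^sub>R F t"
    proof -
      have potential: "dirac_potential h l m t = lam\<^sup>2 * h t ^ 4 + (h t * h'' t - 2 * (h' t)\<^sup>2) / (h t)\<^sup>2 - c\<^sup>2 - 2 * c * h' t / h t"
        by (simp add: dirac_potential_def derivs lam(2) c_def power_mult_distrib)
      show ?thesis
        unfolding potential using h0[of t] lam(1)
        by (simp add: X_def B_def F_def scaleR_conv_of_real field_simps power2_eq_square
          power3_eq_cube power4_eq_xxxx)
    qed
    ultimately show ?thesis by simp
  qed
  have "\<exists>p q t. spin_system \<bar>c\<bar> lam (\<lambda>t. (h t)\<^sup>2) p q \<and> (p t \<noteq> 0 \<or> q t \<noteq> 0)"
  proof (rule spin_system_of_complex[OF _ _ 1 2])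
    show "F t0 \<noteq> 0 \<or> X t0 \<noteq> 0" using nz h0[of t0] by (simp add: F_def)
  qed (simp_all add: F_def X_def B_def per per' h)
  then show ?thesis by (simp add: lam_def c_def)
qed

section \<open>The gap near the flat metric\<close>

lemma uniform_limit_mult_continuous:
  fixes f g :: "'a \<Rightarrow> real \<Rightarrow> real"
  assumes "uniform_limit {0..1} f l F" "uniform_limit {0..1} g m F"
    and "continuous_on {0..1} l" "continuous_on {0..1} m"
  shows "uniform_limit {0..1} (\<lambda>n t. f n t * g n t) (\<lambda>t. l t * m t) F"
  by (intro uniform_lim_mult assms compact_imp_bounded compact_continuous_image) simp_all

lemma uniform_limit_bounded_mult_zero:
  fixes f g :: "'a \<Rightarrow> 'b \<Rightarrow> real"
  assumes f: "uniform_limit S f (\<lambda>_. 0) F" and g: "\<forall>\<^sub>F n in F. \<forall>t\<in>S. \<bar>g n t\<bar> \<le> C"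
  shows "uniform_limit S (\<lambda>n t. f n t * g n t) (\<lambda>_. 0) F"
proof (rule uniform_limitI)
  fix e :: real assume "0 < e"
  then have "0 < e / (1 + \<bar>C\<bar>)" by simp
  from uniform_limitD[OF f this] g
  show "\<forall>\<^sub>F n in F. \<forall>t\<in>S. dist (f n t * g n t) 0 < e"
  proof eventually_elim
    case (elim n)
    show ?case
    proof
      fix t assume "t \<in> S"
      then have "\<bar>f n t\<bar> < e / (1 + \<bar>C\<bar>)" "\<bar>g n t\<bar> \<le> 1 + \<bar>C\<bar>"
        using elim by (force simp: dist_real_def)+
      then have "\<bar>f n t\<bar> * \<bar>g n t\<bar> \<le> \<bar>f n t\<bar> * (1 + \<bar>C\<bar>)" "\<bar>f n t\<bar> * (1 + \<bar>C\<bar>) < e"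
        by (simp_all add: mult_left_mono pos_less_divide_eq)
      then show "dist (f n t * g n t) 0 < e" by (simp add: abs_mult)
    qed
  qed
qed

lemma uniform_limit_has_integral_tendsto:
  fixes f :: "'a \<Rightarrow> real \<Rightarrow> real"
  assumes lim: "uniform_limit {0..1} f g F" and g: "(g has_integral J) {0..1}"
    and f: "\<forall>\<^sub>F n in F. (f n has_integral I n) {0..1}"
  shows "(I \<longlongrightarrow> J) F"
proof (rule tendstoI)
  fix e :: real assume e: "0 < e"
  then have "0 < e / 2" by simp
  from uniform_limitD[OF lim this] f
  show "\<forall>\<^sub>F n in F. dist (I n) J < e"
  proof eventually_elim
    case (elim n)
    have "norm (I n - J) \<le> e / 2 * measure lborel (cbox 0 (1::real))"
    proof (rule has_integral_bound)
      show "((\<lambda>t. f n t - g t) has_integral I n - J) (cbox 0 1)"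
        unfolding box_real by (intro has_integral_diff elim g)
      show "norm (f n t - g t) \<le> e / 2" if "t \<in> cbox 0 1" for t
        using elim(1) that unfolding box_real by (force simp: dist_real_def)
    qed (use e in simp)
    then show ?case using e by (simp add: dist_real_def)
  qed
qed

lemma uniform_limit_constant_in_space:
  fixes f :: "'a \<Rightarrow> real"
  assumes "(f \<longlongrightarrow> l) F"
  shows "uniform_limit S (\<lambda>n t. f n) (\<lambda>t. l) F"
  using assms by (auto simp: uniform_limit_iff tendsto_iff elim: eventually_mono)

text \<open>If \<open>h\<^sup>2\<close> were constant, the equation would have a constant
  coefficient \<open>k > 0\<close>, and the derivative of a periodic solution would again be one.
  Simplicity makes it a multiple \<open>r\<close> of the solution, so
  \<open>r\<^sup>2 = - k\<close>, which is impossible for real \<open>r\<close>.\<close>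

lemma simple_eigenvalue_nonconstant:
  assumes mult: "multiplicity_is (laplace_potential h 0 m) 1"
    and sol: "periodic_solution (laplace_potential h 0 m) A" "A t0 \<noteq> 0" and m: "0 < m"
    and h: "\<And>t. 0 < h t" "\<And>t. h (t + 1) = h t"
  shows "\<exists>s\<in>{0..1}. \<exists>t\<in>{0..1}. (h s)\<^sup>2 \<noteq> (h t)\<^sup>2"
proof (rule ccontr)
  assume "\<not> ?thesis"
  moreover have "0 \<in> {0..1::real}" by simp
  ultimately have const01: "(h s)\<^sup>2 = (h 0)\<^sup>2" if "s \<in> {0..1}" for s using that by blast
  have const: "(h t)\<^sup>2 = (h 0)\<^sup>2" for t
  proof -
    obtain s where "s \<in> {0..1}" "h t = h s" using periodic_reduce_unit_interval[of h t] h(2) by blast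
    then show ?thesis using const01[of s] by simp
  qed
  define k where "k = m * h 0 ^ 4"
  have k: "0 < k" using m h(1)[of 0] by (simp add: k_def)
  have q: "laplace_potential h 0 m t = k" for t
  proof -
    have "h t ^ 4 = ((h t)\<^sup>2)\<^sup>2" by simp
    then have "h t ^ 4 = h 0 ^ 4" unfolding const[of t] by simp
    then show ?thesis by (simp add: laplace_potential_def k_def)
  qed
  have qk: "laplace_potential h 0 m = (\<lambda>t. k)" using q by auto
  obtain A' where A: "\<And>t. (A has_vector_derivative A' t) (at t)"
      "\<And>t. (A' has_vector_derivative - (k *\<^sub>R A t)) (at t)"
    and per: "\<And>t. A (t + 1) = A t"
    using sol(1) unfolding periodic_solution_def qk by blast
  \<comment> \<open>A real solution is needed here, since a complex exponential is proportional to
    its derivative without contradiction.\<close>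
  have "\<exists>L::complex \<Rightarrow> real. bounded_linear L \<and> L (A t0) \<noteq> 0"
  proof (cases "Re (A t0) = 0")
    case True
    then show ?thesis using sol(2) by (intro exI[of _ Im]) (simp add: bounded_linear_Im complex_eq_iff)
  next
    case False
    then show ?thesis by (intro exI[of _ Re]) (simp add: bounded_linear_Re)
  qed
  then obtain L :: "complex \<Rightarrow> real" where L: "bounded_linear L" "L (A t0) \<noteq> 0" by blast
  define R R' where "R t = L (A t)" and "R' t = L (A' t)" for t
  have R: "(R has_real_derivative R' t) (at t)" "(R' has_real_derivative - (k * R t)) (at t)" for t
    using bounded_linear.has_vector_derivative[OF L(1) A(1)] bounded_linear.has_vector_derivative[OF L(1) A(2)]
      bounded_linear.linear[OF L(1)]
    by (simp_all add: R_def[abs_def] R'_def[abs_def] has_real_derivative_iff_has_vector_derivative linear_neg linear_scale)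
  have R_per: "R (t + 1) = R t" for t by (simp add: R_def per)
  have R'_per: "R' (t + 1) = R' t" for t
  proof -
    have "((\<lambda>s. R (s + 1)) has_real_derivative R' (t + 1)) (at t)"
      by (rule DERIV_shift[THEN iffD1, OF R(1)])
    then have "(R has_real_derivative R' (t + 1)) (at t)" by (simp only: R_per)
    then show ?thesis using R(1) by (rule DERIV_unique)
  qed
  have cR: "((\<lambda>t. of_real (R t) :: complex) has_vector_derivative of_real (R' t)) (at t)"
    "((\<lambda>t. of_real (R' t) :: complex) has_vector_derivative - (k *\<^sub>R of_real (R t))) (at t)" for t
    using bounded_linear.has_vector_derivative[OF bounded_linear_of_real R(1)[unfolded has_real_derivative_iff_has_vector_derivative], of t]
      bounded_linear.has_vector_derivative[OF bounded_linear_of_real R(2)[unfolded has_real_derivative_iff_has_vector_derivative], of t]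
    by (simp_all add: scaleR_conv_of_real)
  have "((\<lambda>t. - (k *\<^sub>R of_real (R t)) :: complex) has_vector_derivative - (k *\<^sub>R of_real (R' t))) (at t)" for t
    by (intro has_vector_derivative_minus bounded_linear.has_vector_derivative[OF bounded_linear_scaleR_right] cR)
  note cR' = this
  have sols: "periodic_solution (laplace_potential h 0 m) (\<lambda>t. of_real (R t))"
    "periodic_solution (laplace_potential h 0 m) (\<lambda>t. of_real (R' t))"
    unfolding periodic_solution_def qk
    by (intro conjI exI[of _ "\<lambda>t. of_real (R' t)"], use cR R_per in simp_all)
      (intro conjI exI[of _ "\<lambda>t. - (k *\<^sub>R of_real (R t))"], use cR cR' R'_per in simp_all)
  obtain B :: "nat \<Rightarrow> real \<Rightarrow> complex" where
    B: "\<And>A. periodic_solution (laplace_potential h 0 m) A \<Longrightarrow> \<exists>c. \<forall>t. A t = c * B 0 t"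
  proof -
    obtain B :: "nat \<Rightarrow> real \<Rightarrow> complex" where "\<And>A. periodic_solution (laplace_potential h 0 m) A \<Longrightarrow>
      \<exists>!c. c \<in> extensional {..<1} \<and> (\<forall>t. A t = (\<Sum>i<1. c i * B i t))"
      using mult unfolding multiplicity_is_def by blast
    then have "\<exists>c. \<forall>t. A t = (\<Sum>i<1. c i * B i t)" if "periodic_solution (laplace_potential h 0 m) A" for A
      using that by blast
    then have "\<exists>c. \<forall>t. A t = c * B 0 t" if "periodic_solution (laplace_potential h 0 m) A" for A
      using that by (simp add: lessThan_Suc) blast
    then show ?thesis by (rule that)
  qed
  obtain c where c: "\<And>t. of_real (R t) = c * B 0 t" using B[OF sols(1)] by blast
  obtain d where d: "\<And>t. of_real (R' t) = d * B 0 t" using B[OF sols(2)] by blast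
  have R0: "R t0 \<noteq> 0" using L by (simp add: R_def)
  define r where "r = R' t0 / R t0"
  have "complex_of_real (R' t * R t0) = of_real (R' t0 * R t)" for t
    unfolding of_real_mult c d by simp
  then have "R' t * R t0 = R' t0 * R t" for t by (simp only: of_real_eq_iff)
  then have R'_eq: "R' t = r * R t" for t using R0 by (simp add: r_def field_simps)
  have "(R' has_real_derivative r * R' t0) (at t0)"
    unfolding R'_eq[abs_def] by (rule DERIV_cmult[OF R(1)[unfolded R'_eq]])
  then have "r * R' t0 = - (k * R t0)" using R(2) by (rule DERIV_unique)
  then have "(r\<^sup>2 + k) * R t0 = 0" by (simp add: R'_eq power2_eq_square algebra_simps)
  then have "r\<^sup>2 + k = 0" using R0 by simp
  then show False using k zero_le_power2[of r] by linarith
qed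

text \<open>The tolerance \<open>1 / 4000\<close> only has to make \<open>\<lambda>\<rho> - 2\<pi>\<close> smaller than \<open>1 / 200\<close>.\<close>

lemma spin_laplace_gap_near_flat:
  assumes sys: "spin_system (2 * pi) lam \<rho> p q" and nz: "p t0 \<noteq> 0 \<or> q t0 \<noteq> 0"
    and lam: "0 < lam" "lam \<le> 2 * pi * (1 + 1 / 4000)"
    and cont: "continuous_on UNIV \<rho>" and \<rho>: "\<And>t. \<bar>\<rho> t - 1\<bar> \<le> 1 / 4000"
    and A: "\<And>t. (A has_real_derivative A' t) (at t)"
      "\<And>t. (A' has_real_derivative - ((mu * (\<rho> t)\<^sup>2 - (2 * pi)\<^sup>2) * A t)) (at t)"
    and per: "A 1 = A 0" "A' 1 = A' 0"
    and A_bounds: "\<And>t. t \<in> {0..1} \<Longrightarrow> 1 / 2 \<le> A t \<and> A t \<le> 2 \<and> \<bar>A' t\<bar> \<le> 1 / 32"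
  shows "mu + (integral {0..1} (\<lambda>t. (\<rho> t)\<^sup>2) - (integral {0..1} \<rho>)\<^sup>2) / 100 \<le> lam\<^sup>2"
proof -
  define \<eta> :: real where "\<eta> = 1 / 4000"
  have \<rho>': "1 - \<eta> \<le> \<rho> t" "\<rho> t \<le> 1 + \<eta>" for t
    using \<rho>[of t] unfolding \<eta>_def abs_le_iff by linarith+
  have cont01: "continuous_on {0..1} \<rho>" by (rule continuous_on_subset[OF cont]) simp
  have pos: "0 < \<rho> t" for t using \<rho>'(1)[of t] by (simp add: \<eta>_def)
  \<comment> \<open>This complements the assumed upper bound on \<open>lam\<close> and confines
    \<open>lam\<close> to a narrow interval around \<open>2 * pi\<close>.\<close>
  have lower: "2 * pi \<le> lam * (1 + \<eta>)"
    by (rule spin_system_lower_bound[OF sys nz _ lam(1) cont01 pos \<rho>'(2)]) simp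
  have pi_le: "pi \<le> 16 / 5" using pi_approx(2) by simp
  have pi_ge: "31 / 10 \<le> pi" using pi_approx(1) by simp
  have lam': "lam \<le> 2 * pi * (1 + \<eta>)" "lam \<le> 7" "6 \<le> lam"
    using lam(2) lower pi_ge pi_le by (simp_all add: \<eta>_def)
  have near: "\<bar>lam * \<rho> t - 2 * pi\<bar> \<le> 1 / 200" for t
  proof -
    have "lam * \<rho> t \<le> (2 * pi * (1 + \<eta>)) * (1 + \<eta>)"
      using lam' \<rho>'(2)[of t] pos[of t] by (intro mult_mono) (auto simp: \<eta>_def)
    moreover have "lam * (1 - \<eta>) \<le> lam * \<rho> t"
      using \<rho>'(1)[of t] lam(1) by (intro mult_left_mono) auto
    ultimately have "lam * \<rho> t - 2 * pi \<le> 1 / 200" "- (lam * \<rho> t - 2 * pi) \<le> 1 / 200"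
      using lower lam' pi_le unfolding \<eta>_def by argo+
    then show ?thesis by (simp only: abs_le_iff)
  qed
  obtain p q where pq: "spin_system (2 * pi) lam \<rho> p q"
    "\<And>t. t \<in> {0..1} \<Longrightarrow> \<bar>p t - 1\<bar> \<le> 26 * (1 / 200)"
    "\<And>t. t \<in> {0..1} \<Longrightarrow> \<bar>q t\<bar> \<le> 2 * integral {0..1} (\<lambda>t. \<bar>lam * \<rho> t - 2 * pi\<bar>)"
    using near_resonant_spin_system[OF sys nz cont near] by auto
  show ?thesis
  proof (rule spin_laplace_gap[OF pq(1) _ pq(3) A per A_bounds cont01])
    show "\<bar>p t - 1\<bar> \<le> 1 / 4" if "t \<in> {0..1}" for t using pq(2)[OF that] by simp
    show "0 < \<rho> t \<and> \<rho> t \<le> 2" for t using pos[of t] \<rho>'(2)[of t] by (simp add: \<eta>_def)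
  qed (use lam' in auto)
qed

text \<open>A strict inequality between infima needs a uniform margin: every positive Dirac
  eigenvalue is shown to be at least \<open>mu + \<delta>\<close> with one fixed
  \<open>\<delta> > 0\<close>, while \<open>mu\<close> bounds the first Laplace eigenvalue from
  above.\<close>

lemma laplace_less_dirac_near_flat:
  assumes smooth: "smooth_on UNIV (\<lambda>p :: real \<times> real. h (fst p))"
    and h: "\<And>t. 0 < h t" "\<And>t. h (t + 1) = h t" "\<And>t. (h has_real_derivative h' t) (at t)"
    and near: "\<And>t. \<bar>(h t)\<^sup>2 - 1\<bar> \<le> 1 / 4000"
    and nonconst: "\<exists>s\<in>{0..1}. \<exists>t\<in>{0..1}. (h s)\<^sup>2 \<noteq> (h t)\<^sup>2"
    and mu: "0 < mu" "mu \<le> (2 * pi)\<^sup>2 * (1 + 1 / 4000)" "torus_eigenvalue (laplace_op h) mu"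
    and A: "\<And>t. (A has_real_derivative A' t) (at t)"
      "\<And>t. (A' has_real_derivative - ((mu * ((h t)\<^sup>2)\<^sup>2 - (2 * pi)\<^sup>2) * A t)) (at t)"
    and per: "A 1 = A 0" "A' 1 = A' 0"
    and A_bounds: "\<And>t. t \<in> {0..1} \<Longrightarrow> 1 / 2 \<le> A t \<and> A t \<le> 2 \<and> \<bar>A' t\<bar> \<le> 1 / 32"
    and dirac: "0 < m0" "torus_eigenvalue (\<lambda>\<psi>. dirac_op h (dirac_op h \<psi>)) m0"
  shows "laplace_first_eigenvalue h < dirac_sq_first_eigenvalue h"
proof -
  define \<rho> where "\<rho> t = (h t)\<^sup>2" for t
  define I1 I2 where "I1 = integral {0..1} \<rho>" and "I2 = integral {0..1} (\<lambda>t. (\<rho> t)\<^sup>2)"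
  have cont: "continuous_on S \<rho>" for S
    unfolding \<rho>_def using h(3)
    by (intro continuous_intros continuous_at_imp_continuous_on ballI DERIV_isCont)
  have pos: "0 < \<rho> t" for t using h(1)[of t] by (simp add: \<rho>_def)
  have \<rho>_le: "\<rho> t \<le> 1 + 1 / 4000" "1 / 2 \<le> \<rho> t" for t
    using near[of t] unfolding \<rho>_def abs_le_iff by linarith+
  obtain s t where "s \<in> {0..1}" "t \<in> {0..1}" "\<rho> s \<noteq> \<rho> t" using nonconst by (auto simp: \<rho>_def)
  then have gap: "I1\<^sup>2 < I2" unfolding I1_def I2_def by (rule square_integral_le(2)[OF cont])
  have "1 / 2 * (1 - 0) \<le> I1"
  proof (rule has_integral_le)
    show "((\<lambda>t. 1 / 2 :: real) has_integral 1 / 2 * (1 - 0)) {0..1::real}"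
      using has_integral_const_real[of "1 / 2 :: real" 0 1] by simp
    show "(\<rho> has_integral I1) {0..1}"
      unfolding I1_def by (intro integrable_integral integrable_continuous_interval cont)
  qed (use \<rho>_le in auto)
  then have I1: "0 < I1" by simp
  then have I12: "0 < I1\<^sup>2" "0 < I2" using gap by (simp_all add: order.strict_trans[OF _ gap])
  have ground: "mu * I2 \<le> (2 * pi)\<^sup>2"
    unfolding I2_def
  proof (rule laplace_ground_state_bound[OF A(1)])
    show "(A' has_real_derivative - ((mu * (\<rho> t)\<^sup>2 - (2 * pi)\<^sup>2) * A t)) (at t)" for t
      using A(2) by (simp only: \<rho>_def)
    show "0 < A t" if "t \<in> {0..1}" for t using A_bounds[OF that] by linarith
  qed (use per cont in auto)
  \<comment> \<open>One margin for each surviving case, in this order: weight of modulus 1, weight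
    0, and eigenvalues too large to be near resonance.\<close>
  define \<delta> where "\<delta> = min ((I2 - I1\<^sup>2) / 100)
    (min ((2 * pi)\<^sup>2 / I1\<^sup>2 - (2 * pi)\<^sup>2 / I2) ((2 * pi)\<^sup>2 / 4000))"
  have "(2 * pi)\<^sup>2 / I2 < (2 * pi)\<^sup>2 / I1\<^sup>2" using gap I12 by (intro divide_strict_left_mono) auto
  then have \<delta>: "0 < \<delta>" using gap by (simp add: \<delta>_def)
  have lower: "mu + \<delta> \<le> m" if m: "0 < m" "torus_eigenvalue (\<lambda>\<psi>. dirac_op h (dirac_op h \<psi>)) m" for m
  proof -
    obtain l :: int and p q t0 where "spin_system (2 * pi * \<bar>real_of_int l\<bar>) (sqrt m) \<rho> p q"
      and nz: "p t0 \<noteq> 0 \<or> q t0 \<noteq> 0"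
      using dirac_eigenvalue_spin_system[OF smooth h m] unfolding \<rho>_def[abs_def] by blast
    then have sys: "spin_system (2 * pi * real_of_int \<bar>l\<bar>) (sqrt m) \<rho> p q" by simp
    have sq: "0 < sqrt m" "(sqrt m)\<^sup>2 = m" using m by simp_all
    consider "l = 0" | "2 * pi * (1 + 1 / 4000) < sqrt m" | "\<bar>l\<bar> = 1" "sqrt m \<le> 2 * pi * (1 + 1 / 4000)"
      | "2 \<le> \<bar>l\<bar>" "sqrt m \<le> 2 * pi * (1 + 1 / 4000)" by linarith
    then show ?thesis
    proof cases
      case 1
      then have "2 * pi \<le> sqrt m * I1"
        using spin_system_zero_weight[of "sqrt m" \<rho> p q t0] sys nz sq cont pos by (simp add: I1_def)
      then have "(2 * pi)\<^sup>2 \<le> (sqrt m * I1)\<^sup>2" by (intro power_mono) auto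
      then have "(2 * pi)\<^sup>2 / I1\<^sup>2 \<le> m"
        using I12 sq by (simp add: power_mult_distrib pos_divide_le_eq)
      moreover have "mu \<le> (2 * pi)\<^sup>2 / I2" using ground I12 by (simp add: pos_le_divide_eq)
      moreover have "\<delta> \<le> (2 * pi)\<^sup>2 / I1\<^sup>2 - (2 * pi)\<^sup>2 / I2" unfolding \<delta>_def by linarith
      ultimately show ?thesis by linarith
    next
      case 2
      then have "(2 * pi * (1 + 1 / 4000))\<^sup>2 \<le> (sqrt m)\<^sup>2" by (intro power_mono) auto
      \<comment> \<open>Bernoulli: \<open>(1 + x)\<^sup>2\<close> is at least
        \<open>1 + 2 * x\<close>; one \<open>x\<close> pays for \<open>mu\<close> and the other for
        \<open>\<delta>\<close>.\<close>
      moreover have "(2 * pi)\<^sup>2 * (1 + 1 / 4000) + (2 * pi)\<^sup>2 / 4000 \<le> (2 * pi * (1 + 1 / 4000))\<^sup>2"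
        by (simp add: power2_eq_square algebra_simps)
      moreover have "\<delta> \<le> (2 * pi)\<^sup>2 / 4000" unfolding \<delta>_def by linarith
      ultimately show ?thesis using mu(2) sq by linarith
    next
      case 3
      have "mu + (I2 - I1\<^sup>2) / 100 \<le> (sqrt m)\<^sup>2"
        unfolding I1_def I2_def
      proof (rule spin_laplace_gap_near_flat[where A = A and A' = A' and p = p and q = q, OF _ nz sq(1) 3(2) cont _ A(1) _ per A_bounds])
        show "spin_system (2 * pi) (sqrt m) \<rho> p q" using sys unfolding 3(1) by simp
        show "\<bar>\<rho> t - 1\<bar> \<le> 1 / 4000" for t using near by (simp only: \<rho>_def)
        show "(A' has_real_derivative - ((mu * (\<rho> t)\<^sup>2 - (2 * pi)\<^sup>2) * A t)) (at t)" for t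
          using A(2) by (simp only: \<rho>_def)
      qed
      moreover have "\<delta> \<le> (I2 - I1\<^sup>2) / 100" unfolding \<delta>_def by linarith
      ultimately show ?thesis using sq by linarith
    next
      case 4
      \<comment> \<open>Weights of modulus at least 2 cannot occur for such small
        \<open>sqrt m\<close>: the general bound would give
        \<open>4 * pi \<le> 2 * pi * (1 + 1 / 4000)\<^sup>2\<close>.\<close>
      have l: "2 \<le> real_of_int \<bar>l\<bar>" using 4(1) by linarith
      then have "2 * pi * 2 \<le> 2 * pi * real_of_int \<bar>l\<bar>" by (intro mult_left_mono) simp_all
      also have "\<dots> \<le> sqrt m * (1 + 1 / 4000)"
        using l by (intro spin_system_lower_bound[OF sys nz _ sq(1) cont pos \<rho>_le(1)]) simp
      also have "\<dots> \<le> (2 * pi * (1 + 1 / 4000)) * (1 + 1 / 4000)"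
        using 4(2) by (intro mult_right_mono) auto
      finally have False using pi_gt_zero by (simp add: algebra_simps)
      then show ?thesis ..
    qed
  qed
  have "mu + \<delta> \<le> dirac_sq_first_eigenvalue h"
    unfolding dirac_sq_first_eigenvalue_def first_positive_eigenvalue_def
    using dirac lower by (intro cInf_greatest) auto
  moreover have "laplace_first_eigenvalue h \<le> mu"
    unfolding laplace_first_eigenvalue_def first_positive_eigenvalue_def
    using mu by (intro cInf_lower bdd_belowI[of _ 0]) auto
  ultimately show ?thesis using \<delta> by linarith
qed

section \<open>Eigenfunction families along the branches and first variations\<close>

text \<open>\<open>periodic_solution\<close> provides a derivative separately for each parameter. By
  uniqueness it is the partial derivative of the joint family, hence smooth in both
  variables.\<close>

lemma spectral_branch_derivative:
  assumes "spectral_branch J Q A0 m"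
  obtains A A' where "smooth_on J m" "m 0 = 4 * pi\<^sup>2" "\<And>E. E \<in> J \<Longrightarrow> \<exists>t. A E t \<noteq> 0"
    "smooth_on (J \<times> UNIV) (\<lambda>(E, t). A E t)"
    "smooth_on (J \<times> UNIV) (\<lambda>(E, t). A' E t)" "A 0 = A0"
    "\<And>E. E \<in> J \<Longrightarrow> periodic_solution (Q E (m E)) (A E)"
    "\<And>E t. E \<in> J \<Longrightarrow> (A E has_vector_derivative A' E t) (at t)"
    "\<And>E t. E \<in> J \<Longrightarrow> (A' E has_vector_derivative - (Q E (m E) t *\<^sub>R A E t)) (at t)"
proof -
  obtain A where A: "smooth_on J m" "m 0 = 4 * pi\<^sup>2" "smooth_on (J \<times> UNIV) (\<lambda>(E, t). A E t)" "A 0 = A0"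
    "\<And>E. E \<in> J \<Longrightarrow> periodic_solution (Q E (m E)) (A E)" "\<And>E. E \<in> J \<Longrightarrow> \<exists>t. A E t \<noteq> 0"
    using assms unfolding spectral_branch_def by blast
  define A' where "A' E t = frechet_derivative (\<lambda>(E, t). A E t) (at (E, t)) (0, 1)" for E t
  have smooth': "smooth_on (J \<times> UNIV) (\<lambda>(E, t). A' E t)"
    using smooth_on_frechet_derivative[OF A(3), of "(0, 1)"] by (simp add: A'_def case_prod_beta')
  have der: "(A E has_vector_derivative A' E t) (at t)" if "E \<in> J" for E t
    using has_derivative_slices(2)[OF smooth_on_has_derivative[OF A(3), of "(E, t)"]] that
    by (simp add: A'_def)
  have der': "(A' E has_vector_derivative - (Q E (m E) t *\<^sub>R A E t)) (at t)" if E: "E \<in> J" for E t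
  proof -
    obtain B where B: "\<And>t. (A E has_vector_derivative B t) (at t)"
      "\<And>t. (B has_vector_derivative - (Q E (m E) t *\<^sub>R A E t)) (at t)"
      using A(5)[OF E] unfolding periodic_solution_def by blast
    have "B = A' E" using vector_derivative_unique_at[OF B(1) der[OF E]] by auto
    then show ?thesis using B(2) by simp
  qed
  show ?thesis by (rule that[OF A(1,2,6,3) smooth' A(4,5) der der'])
qed

section \<open>Branches and second derivatives\<close>

lemma uniform_limit_squeeze:
  fixes f :: "'a \<Rightarrow> 'b \<Rightarrow> real"
  assumes f: "\<forall>\<^sub>F n in F. \<forall>t\<in>S. \<bar>f n t - l t\<bar> \<le> b n" and b: "(b \<longlongrightarrow> 0) F"
  shows "uniform_limit S f l F"
proof (rule uniform_limitI)
  fix e :: real assume "0 < e"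
  from order_tendstoD(2)[OF b this] f
  show "\<forall>\<^sub>F n in F. \<forall>t\<in>S. dist (f n t) (l t) < e"
    by eventually_elim (force simp: dist_real_def)
qed

text \<open>Real parts solve the same equation because its coefficients are real. They deform the
  constant 1, so near \<open>E = 0\<close> they are positive with small derivative, as the ground
  state and gap estimates require.\<close>

lemma laplace_branch_near_constant:
  assumes J: "open J" "0 \<in> J"
    and branch: "spectral_branch J (\<lambda>E. laplace_potential (h E) 1) (\<lambda>t. 1) mu"
  obtains a a' where
    "\<And>E t. E \<in> J \<Longrightarrow> (a E has_real_derivative a' E t) (at t)"
    "\<And>E t. E \<in> J \<Longrightarrow> (a' E has_real_derivative - ((mu E * ((h E t)\<^sup>2)\<^sup>2 - (2 * pi)\<^sup>2) * a E t)) (at t)"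
    "\<And>E. E \<in> J \<Longrightarrow> a E 1 = a E 0" "\<And>E. E \<in> J \<Longrightarrow> a' E 1 = a' E 0"
    "uniform_limit {0..1} a (\<lambda>_. 1) (at 0)" "uniform_limit {0..1} a' (\<lambda>_. 0) (at 0)"
proof -
  obtain A A' where "smooth_on J mu" "mu 0 = 4 * pi\<^sup>2" "\<And>E. E \<in> J \<Longrightarrow> \<exists>t. A E t \<noteq> 0"
    and A: "smooth_on (J \<times> UNIV) (\<lambda>(E, t). A E t)" "smooth_on (J \<times> UNIV) (\<lambda>(E, t). A' E t)"
    "A 0 = (\<lambda>t. 1)" "\<And>E. E \<in> J \<Longrightarrow> periodic_solution (laplace_potential (h E) 1 (mu E)) (A E)"
    "\<And>E t. E \<in> J \<Longrightarrow> (A E has_vector_derivative A' E t) (at t)"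
    "\<And>E t. E \<in> J \<Longrightarrow> (A' E has_vector_derivative - (laplace_potential (h E) 1 (mu E) t *\<^sub>R A E t)) (at t)"
    using branch by (rule spectral_branch_derivative) (rule that)
  define a a' where "a E t = Re (A E t)" and "a' E t = Re (A' E t)" for E t
  have a: "(a E has_real_derivative a' E t) (at t)" if "E \<in> J" for E t
    using bounded_linear.has_vector_derivative[OF bounded_linear_Re A(5)[OF that]]
    by (simp add: a_def[abs_def] a'_def has_real_derivative_iff_has_vector_derivative)
  have a': "(a' E has_real_derivative - ((mu E * ((h E t)\<^sup>2)\<^sup>2 - (2 * pi)\<^sup>2) * a E t)) (at t)" if "E \<in> J" for E t
    using bounded_linear.has_vector_derivative[OF bounded_linear_Re A(6)[OF that], of t]
    by (simp add: a_def a'_def[abs_def] has_real_derivative_iff_has_vector_derivative laplace_potential_def power_mult_distrib)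
  have per: "a E (t + 1) = a E t" if "E \<in> J" for E t
    using A(4)[OF that] by (simp add: periodic_solution_def a_def)
  have per': "a' E 1 = a' E 0" if "E \<in> J" for E
  proof -
    have "((\<lambda>s. a E (s + 1)) has_real_derivative a' E (0 + 1)) (at 0)"
      by (rule DERIV_shift[THEN iffD1, OF a[OF that]])
    then have "(a E has_real_derivative a' E (0 + 1)) (at 0)" by (simp only: per[OF that])
    then have "a' E (0 + 1) = a' E 0" using a[OF that] by (rule DERIV_unique)
    then show ?thesis by simp
  qed
  have "uniform_limit {0..1} A (A 0) (at 0)" "uniform_limit {0..1} A' (A' 0) (at 0)"
    by (intro uniform_limit_slice[OF J] smooth_on_imp_continuous_on A)+
  then have "uniform_limit {0..1} a (a 0) (at 0)" "uniform_limit {0..1} a' (a' 0) (at 0)"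
    unfolding a_def[abs_def] a'_def[abs_def] by (auto intro: bounded_linear.uniform_limit[OF bounded_linear_Re])
  moreover have "a 0 = (\<lambda>_. 1)" by (simp add: a_def[abs_def] A(3))
  moreover have "a' 0 = (\<lambda>_. 0)"
  proof
    fix t
    have "(a 0 has_real_derivative 0) (at t)" unfolding \<open>a 0 = (\<lambda>_. 1)\<close> by (rule DERIV_const)
    from DERIV_unique[OF a[OF J(2)] this] show "a' 0 t = 0" .
  qed
  ultimately show ?thesis using that[OF a a' _ per'] per[of _ 0] by simp
qed

text \<open>Here \<open>d\<close> is the first variation of \<open>h\<close>. Joint smoothness makes
  the difference quotients converge uniformly in \<open>t\<close>, which a pointwise expansion in
  \<open>E\<close> would not give.\<close>

lemma flat_deformation_derivatives:
  assumes "flat_deformation J h"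
  obtains d ht htt where
    "open J" "0 \<in> J" "\<And>E t. E \<in> J \<Longrightarrow> 0 < h E t" "\<And>E t. E \<in> J \<Longrightarrow> h E (t + 1) = h E t" "\<And>t. h 0 t = 1"
    "\<And>E. E \<in> J \<Longrightarrow> smooth_on UNIV (\<lambda>p :: real \<times> real. h E (fst p))"
    "\<And>t. ((\<lambda>E. h E t) has_real_derivative d t) (at 0)"
    "\<And>E t. E \<in> J \<Longrightarrow> (h E has_real_derivative ht E t) (at t)"
    "\<And>E t. E \<in> J \<Longrightarrow> (ht E has_real_derivative htt E t) (at t)"
    "continuous_on UNIV d"
    "uniform_limit {0..1} h (\<lambda>_. 1) (at 0)" "uniform_limit {0..1} (\<lambda>E t. (h E t - 1) / E) d (at 0)"
proof -
  have J: "open J" "0 \<in> J" and h: "\<And>E t. E \<in> J \<Longrightarrow> 0 < h E t" "\<And>E t. E \<in> J \<Longrightarrow> h E (t + 1) = h E t" "\<And>t. h 0 t = 1"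
    and smooth: "smooth_on (J \<times> UNIV) (\<lambda>(E, t). h E t)"
    using assms unfolding flat_deformation_def by auto
  define D where "D v E t = frechet_derivative (\<lambda>(E, t). h E t) (at (E, t)) v" for v E t
  define D2 where "D2 E t = frechet_derivative (\<lambda>(E, t). D (0, 1) E t) (at (E, t)) (0, 1)" for E t
  have smooth_D: "smooth_on (J \<times> UNIV) (\<lambda>(E, t). D v E t)" for v
    using smooth_on_frechet_derivative[OF smooth] by (simp add: D_def case_prod_beta')
  have dE: "((\<lambda>E. h E t) has_real_derivative D (1, 0) E t) (at E)"
    and dt: "(h E has_real_derivative D (0, 1) E t) (at t)" if "E \<in> J" for E t
    using has_derivative_slices[OF smooth_on_has_derivative[OF smooth, of "(E, t)"]] that
    by (simp_all add: D_def has_real_derivative_iff_has_vector_derivative)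
  have dtt: "(D (0, 1) E has_real_derivative D2 E t) (at t)" if "E \<in> J" for E t
    using has_derivative_slices(2)[OF smooth_on_has_derivative[OF smooth_D, of "(E, t)"]] that
    by (simp add: D2_def has_real_derivative_iff_has_vector_derivative)
  have slice: "smooth_on UNIV (\<lambda>p :: real \<times> real. h E (fst p))" if "E \<in> J" for E
    using smooth_on_slice[OF smooth that bounded_linear_fst] by simp
  have "continuous_on UNIV ((\<lambda>(E, t). D (1, 0) E t) \<circ> (\<lambda>t. (0, t)))"
    by (intro continuous_on_compose continuous_intros continuous_on_subset[OF smooth_on_imp_continuous_on[OF smooth_D]])
      (use J in auto)
  then have cont: "continuous_on UNIV (D (1, 0) 0)" by (simp add: o_def)
  have h0: "h 0 = (\<lambda>_. 1)" using h(3) by auto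
  have "uniform_limit {0..1} h (h 0) (at 0)"
    by (intro uniform_limit_slice[OF J] smooth_on_imp_continuous_on smooth)
  moreover have "uniform_limit {0..1} (\<lambda>E t. (h E t - h 0 t) / E) (D (1, 0) 0) (at 0)"
    by (rule uniform_limit_difference_quotient[OF J smooth_on_imp_continuous_on[OF smooth_D] dE])
  ultimately show ?thesis
    using that[OF J h slice dE[OF J(2)] dt dtt cont] by (simp add: h0)
qed

text \<open>The expansion is used only for fixed \<open>t\<close>, to identify its linear
  coefficient with the derivative of \<open>h ^ 4\<close> at 0. Continuity of that coefficient in
  \<open>t\<close> is then inherited from the first variation of \<open>h\<close>.\<close>

lemma first_variation_unique:
  assumes der: "((\<lambda>E. h E) has_real_derivative d) (at 0)" and "h 0 = 1"
    and expansion: "(\<lambda>E. h E ^ 4 - (1 + E * H + E\<^sup>2 * G)) \<in> O[at 0](\<lambda>E. E ^ 3)"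
  shows "H = 4 * (d :: real)"
proof -
  have "((\<lambda>E. h E ^ 4) has_real_derivative 4 * d) (at 0)"
    using assms(2) by (auto intro!: derivative_eq_intros der)
  then have 1: "((\<lambda>E. (h E ^ 4 - 1) / E) \<longlongrightarrow> 4 * d) (at 0)"
    using assms(2) by (simp add: has_field_derivative_iff)
  obtain c where c: "\<forall>\<^sub>F E in at 0. norm (h E ^ 4 - (1 + E * H + E\<^sup>2 * G)) \<le> c * norm (E ^ 3)"
    using expansion by (elim landau_o.bigE)
  have ne: "\<forall>\<^sub>F E in at (0::real). E \<noteq> 0" by (simp add: eventually_at_filter)
  have "((\<lambda>E. (h E ^ 4 - 1) / E - H - E * G) \<longlongrightarrow> 0) (at 0)"
  proof (rule Lim_null_comparison)
    show "((\<lambda>E. c * (\<bar>E\<bar> * \<bar>E\<bar>)) \<longlongrightarrow> 0) (at 0)" by (auto intro!: tendsto_eq_intros)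
    show "\<forall>\<^sub>F E in at 0. norm ((h E ^ 4 - 1) / E - H - E * G) \<le> c * (\<bar>E\<bar> * \<bar>E\<bar>)"
      using c ne
    proof eventually_elim
      case (elim E)
      have "(h E ^ 4 - 1) / E - H - E * G = (h E ^ 4 - (1 + E * H + E\<^sup>2 * G)) / E"
        using elim(2) by (simp add: field_simps power2_eq_square)
      then have "norm ((h E ^ 4 - 1) / E - H - E * G) = norm (h E ^ 4 - (1 + E * H + E\<^sup>2 * G)) / \<bar>E\<bar>"
        by (simp add: norm_divide)
      also have "\<dots> \<le> c * norm (E ^ 3) / \<bar>E\<bar>" by (intro divide_right_mono elim) simp
      also have "\<dots> = c * (\<bar>E\<bar> * \<bar>E\<bar>)"
        using elim(2) by (simp add: power3_eq_cube abs_mult)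
      finally show ?case .
    qed
  qed
  then have "((\<lambda>E. ((h E ^ 4 - 1) / E - H - E * G) + H + E * G) \<longlongrightarrow> 0 + H + 0 * G) (at 0)"
    by (intro tendsto_intros)
  then have "((\<lambda>E. (h E ^ 4 - 1) / E) \<longlongrightarrow> H) (at 0)" by simp
  from LIM_unique[OF this 1] show ?thesis .
qed

section \<open>Second order behaviour of the gap\<close>

text \<open>After division by \<open>E\<^sup>2\<close> the pairing identity reads
  \<open>Y E / X E\<close>. Here \<open>X E\<close> tends to 1, the cross term in \<open>Y E\<close>
  disappears, and the square term tends to the integral of \<open>(2 * pi * r)\<^sup>2\<close> once
  the first variation \<open>\<kappa>\<close> of \<open>lam\<close> is known to vanish.\<close>

lemma spectral_gap_limit:
  fixes \<rho> a a' :: "real \<Rightarrow> real \<Rightarrow> real" and r lam mu :: "real \<Rightarrow> real"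
  assumes \<rho>: "uniform_limit {0..1} \<rho> (\<lambda>_. 1) (at 0)"
      "uniform_limit {0..1} (\<lambda>E t. (\<rho> E t - 1) / E) r (at 0)"
    and r: "continuous_on {0..1} r" "(r has_integral 0) {0..1}"
    and lam: "((\<lambda>E. (lam E - 2 * pi) / E) \<longlongrightarrow> \<kappa>) (at 0)"
    and sys: "\<forall>\<^sub>F E in at 0. continuous_on UNIV (\<rho> E) \<and> (\<forall>t. \<rho> E (t + 1) = \<rho> E t) \<and>
      (\<exists>p q t. spin_system (2 * pi) (lam E) (\<rho> E) p q \<and> (p t \<noteq> 0 \<or> q t \<noteq> 0))"
    and a: "uniform_limit {0..1} a (\<lambda>_. 1) (at 0)" "uniform_limit {0..1} a' (\<lambda>_. 0) (at 0)"
    and ode: "\<forall>\<^sub>F E in at 0. (\<forall>t. (a E has_real_derivative a' E t) (at t)) \<and>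
      (\<forall>t. (a' E has_real_derivative - ((mu E * (\<rho> E t)\<^sup>2 - (2 * pi)\<^sup>2) * a E t)) (at t)) \<and>
      a E 1 = a E 0 \<and> a' E 1 = a' E 0"
  shows "((\<lambda>E. ((lam E)\<^sup>2 - mu E) / E\<^sup>2) \<longlongrightarrow> 4 * pi\<^sup>2 * integral {0..1} (\<lambda>t. (r t)\<^sup>2)) (at 0)"
proof -
  define d where "d E t = (lam E * \<rho> E t - 2 * pi) / E" for E t
  define D where "D t = \<kappa> + 2 * pi * r t" for t
  have contD: "continuous_on {0..1} D" unfolding D_def by (intro continuous_intros r)
  have ne: "\<forall>\<^sub>F E in at (0::real). E \<noteq> 0" by (simp add: eventually_at_filter)
  have dD: "uniform_limit {0..1} d D (at 0)"
  proof -
    have "uniform_limit {0..1} (\<lambda>E t. (lam E - 2 * pi) / E * \<rho> E t + 2 * pi * ((\<rho> E t - 1) / E))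
        (\<lambda>t. \<kappa> * 1 + 2 * pi * r t) (at 0)"
      by (intro uniform_limit_add uniform_limit_mult_continuous uniform_limit_constant_in_space lam \<rho>
          uniform_limit_const continuous_intros r)
    moreover have "(\<lambda>E t. (lam E - 2 * pi) / E * \<rho> E t + 2 * pi * ((\<rho> E t - 1) / E)) = d"
      by (auto simp: d_def fun_eq_iff algebra_simps add_divide_distrib diff_divide_distrib)
    ultimately show ?thesis by (simp add: D_def[abs_def])
  qed
  have "\<exists>x\<in>{0..1}. \<forall>t\<in>{0..1}. \<bar>D t\<bar> \<le> \<bar>D x\<bar>"
    by (rule continuous_attains_sup) (auto intro!: continuous_intros contD)
  then obtain C0 where C0: "\<And>t. t \<in> {0..1} \<Longrightarrow> \<bar>D t\<bar> \<le> C0" by blast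
  define C where "C = C0 + 1"
  have C: "0 < C" using C0[of 0] by (simp add: C_def)
  have d_bound: "\<forall>\<^sub>F E in at 0. \<forall>t\<in>{0..1}. \<bar>d E t\<bar> \<le> C"
    using uniform_limitD[OF dD zero_less_one]
  proof eventually_elim
    case (elim E)
    show ?case
    proof
      fix t :: real assume t: "t \<in> {0..1}"
      then have "\<bar>d E t - D t\<bar> < 1" using elim by (simp add: dist_real_def)
      then show "\<bar>d E t\<bar> \<le> C" using C0[OF t] unfolding C_def by linarith
    qed
  qed
  have small: "\<forall>\<^sub>F E in at 0. C * \<bar>E\<bar> \<le> 1 / 100"
  proof -
    have "((\<lambda>E. C * \<bar>E\<bar>) \<longlongrightarrow> 0) (at 0)" by (auto intro!: tendsto_eq_intros)
    from order_tendstoD(2)[OF this, of "1 / 100"] show ?thesis by (auto elim: eventually_mono)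
  qed
  have "\<forall>\<^sub>F E in at 0. \<exists>p q. spin_system (2 * pi) (lam E) (\<rho> E) p q \<and>
    (\<forall>t. \<bar>lam E * \<rho> E t - 2 * pi\<bar> \<le> C * \<bar>E\<bar>) \<and>
    (\<forall>t\<in>{0..1}. \<bar>p t - 1\<bar> \<le> 26 * (C * \<bar>E\<bar>) \<and> \<bar>q t\<bar> \<le> 2 * (C * \<bar>E\<bar>))"
    using ne d_bound small sys
  proof eventually_elim
    case (elim E)
    obtain p q t0 where pq: "spin_system (2 * pi) (lam E) (\<rho> E) p q" "p t0 \<noteq> 0 \<or> q t0 \<noteq> 0"
      using elim(4) by blast
    have bound01: "\<bar>lam E * \<rho> E t - 2 * pi\<bar> \<le> C * \<bar>E\<bar>" if "t \<in> {0..1}" for t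
    proof -
      have "\<bar>lam E * \<rho> E t - 2 * pi\<bar> / \<bar>E\<bar> \<le> C" using elim(2) that by (simp add: d_def)
      then show ?thesis using elim(1) by (simp add: pos_divide_le_eq)
    qed
    have bound: "\<bar>lam E * \<rho> E t - 2 * pi\<bar> \<le> C * \<bar>E\<bar>" for t
    proof -
      obtain s where "s \<in> {0..1}" "\<rho> E t = \<rho> E s"
        using periodic_reduce_unit_interval[of "\<rho> E" t] elim(4) by blast
      then show ?thesis using bound01[of s] by simp
    qed
    have cont: "continuous_on UNIV (\<rho> E)" using elim(4) by blast
    have "integral {0..1} (\<lambda>t. \<bar>lam E * \<rho> E t - 2 * pi\<bar>) \<le> integral {0..1::real} (\<lambda>t. C * \<bar>E\<bar>)"
      using bound by (intro integral_le integrable_continuous_interval continuous_intros continuous_on_subset[OF cont]) auto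
    then have N: "2 * integral {0..1} (\<lambda>t. \<bar>lam E * \<rho> E t - 2 * pi\<bar>) \<le> 2 * (C * \<bar>E\<bar>)" by simp
    from near_resonant_spin_system[OF pq cont bound elim(3)]
    obtain p q where "spin_system (2 * pi) (lam E) (\<rho> E) p q"
      "\<forall>t\<in>{0..1}. \<bar>p t - 1\<bar> \<le> 26 * (C * \<bar>E\<bar>) \<and>
        \<bar>q t\<bar> \<le> 2 * integral {0..1} (\<lambda>t. \<bar>lam E * \<rho> E t - 2 * pi\<bar>)" by blast
    with bound N show ?case by (meson order_trans)
  qed
  \<comment> \<open>One choice of normalised solutions for all small parameters at once, so that
    uniform limits in \<open>E\<close> make sense.\<close>
  then obtain P Q where PQ: "\<forall>\<^sub>F E in at 0. spin_system (2 * pi) (lam E) (\<rho> E) (P E) (Q E) \<and>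
    (\<forall>t. \<bar>lam E * \<rho> E t - 2 * pi\<bar> \<le> C * \<bar>E\<bar>) \<and>
    (\<forall>t\<in>{0..1}. \<bar>P E t - 1\<bar> \<le> 26 * (C * \<bar>E\<bar>) \<and> \<bar>Q E t\<bar> \<le> 2 * (C * \<bar>E\<bar>))"
    unfolding eventually_ex by blast
  define R where "R E t = Q E t / E" for E t
  have P1: "uniform_limit {0..1} P (\<lambda>_. 1) (at 0)"
  proof (rule uniform_limit_squeeze)
    show "\<forall>\<^sub>F E in at 0. \<forall>t\<in>{0..1}. \<bar>P E t - 1\<bar> \<le> 26 * (C * \<bar>E\<bar>)"
      using PQ by eventually_elim blast
  qed (auto intro!: tendsto_eq_intros)
  have Q0: "uniform_limit {0..1} Q (\<lambda>_. 0) (at 0)"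
  proof (rule uniform_limit_squeeze)
    show "\<forall>\<^sub>F E in at 0. \<forall>t\<in>{0..1}. \<bar>Q E t - 0\<bar> \<le> 2 * (C * \<bar>E\<bar>)"
      using PQ by eventually_elim simp
  qed (auto intro!: tendsto_eq_intros)
  have R_bound: "\<forall>\<^sub>F E in at 0. \<forall>t\<in>{0..1}. \<bar>R E t\<bar> \<le> 2 * C"
    using PQ ne by eventually_elim (simp add: R_def pos_divide_le_eq mult.assoc)
  \<comment> \<open>A solvability condition: the integral of the derivative of
    \<open>P * Q / E\<close> over a period is 0, and in the limit it equals the integral of
    \<open>D\<close>, which is \<open>\<kappa>\<close> because \<open>r\<close> has mean
    zero.\<close>
  have "\<kappa> = 0"
  proof -
    have "uniform_limit {0..1} (\<lambda>E t. Q E t * ((lam E * \<rho> E t + 2 * pi) * R E t)) (\<lambda>_. 0) (at 0)"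
    proof (rule uniform_limit_bounded_mult_zero[OF Q0])
      show "\<forall>\<^sub>F E in at 0. \<forall>t\<in>{0..1}. \<bar>(lam E * \<rho> E t + 2 * pi) * R E t\<bar> \<le> 17 * (2 * C)"
        using PQ small R_bound
      proof eventually_elim
        case (elim E)
        \<comment> \<open>A crude bound for \<open>4 * pi + 1 / 100\<close>, using only
          \<open>pi < 4\<close>.\<close>
        have "\<bar>lam E * \<rho> E t + 2 * pi\<bar> \<le> 17" for t
        proof -
          have "\<bar>lam E * \<rho> E t - 2 * pi\<bar> \<le> 1 / 100" using elim order_trans by blast
          then show ?thesis using pi_less_4 pi_gt_zero by linarith
        qed
        then show ?case using elim(3) C unfolding abs_mult by (intro ballI mult_mono) auto
      qed
    qed
    then have lim: "uniform_limit {0..1} (\<lambda>E t. d E t * (P E t * P E t) - Q E t * ((lam E * \<rho> E t + 2 * pi) * R E t))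
      (\<lambda>t. D t * (1 * 1) - 0) (at 0)"
      by (intro uniform_limit_minus uniform_limit_mult_continuous dD P1 contD continuous_intros)
    have int: "((\<lambda>t. D t * (1 * 1) - 0) has_integral \<kappa>) {0..1}"
      using has_integral_add[OF has_integral_const_real[of \<kappa> 0 1] has_integral_mult_right[OF r(2), of "2 * pi"]]
      by (simp add: D_def)
    have "\<forall>\<^sub>F E in at 0. ((\<lambda>t. d E t * (P E t * P E t) - Q E t * ((lam E * \<rho> E t + 2 * pi) * R E t)) has_integral 0) {0..1}"
      using PQ ne
    proof eventually_elim
      case (elim E)
      note S = spin_systemD[of "2 * pi" "lam E" "\<rho> E" "P E" "Q E"]
      show ?case
      proof (rule integral_periodic_derivative)
        show "((\<lambda>t. P E t * Q E t / E) has_real_derivative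
          d E t * (P E t * P E t) - Q E t * ((lam E * \<rho> E t + 2 * pi) * R E t)) (at t)" for t
          using elim by (auto intro!: derivative_eq_intros S(3,4) simp: d_def R_def field_simps)
        show "P E 1 * Q E 1 / E = P E 0 * Q E 0 / E" using S(1,2)[of 0] elim by simp
      qed
    qed
    from uniform_limit_has_integral_tendsto[OF lim int this] show ?thesis
      using LIM_const_eq by metis
  qed
  then have D: "D = (\<lambda>t. 2 * pi * r t)" by (simp add: D_def[abs_def])
  define X where "X E = integral {0..1} (\<lambda>t. \<rho> E t * \<rho> E t * (P E t * a E t))" for E
  define Y where "Y E = integral {0..1} (\<lambda>t. d E t * d E t * (P E t * a E t) + a' E t * (R E t * d E t))" for E
  have conts: "\<forall>\<^sub>F E in at 0. continuous_on {0..1} (\<rho> E) \<and> continuous_on {0..1} (P E) \<and> continuous_on {0..1} (Q E)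
      \<and> continuous_on {0..1} (a E) \<and> continuous_on {0..1} (a' E)"
    using PQ sys ode
  proof eventually_elim
    case (elim E)
    then have "continuous_on {0..1} (\<rho> E)" using continuous_on_subset by blast
    moreover have "continuous_on {0..1} (P E)" "continuous_on {0..1} (Q E)"
      using elim spin_systemD(5,6) by blast+
    moreover have "continuous_on {0..1} (a E)" "continuous_on {0..1} (a' E)"
      using elim(3) by (auto intro!: continuous_at_imp_continuous_on DERIV_isCont)
    ultimately show ?case by simp
  qed
  have X: "(X \<longlongrightarrow> 1) (at 0)"
  proof (rule uniform_limit_has_integral_tendsto)
    show "uniform_limit {0..1} (\<lambda>E t. \<rho> E t * \<rho> E t * (P E t * a E t)) (\<lambda>t. 1 * 1 * (1 * 1)) (at 0)"
      by (intro uniform_limit_mult_continuous \<rho> P1 a continuous_intros)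
    show "((\<lambda>t. 1 * 1 * (1 * 1) :: real) has_integral 1) {0..1::real}"
      using has_integral_const_real[of "1::real" 0 1] by simp
    show "\<forall>\<^sub>F E in at 0. ((\<lambda>t. \<rho> E t * \<rho> E t * (P E t * a E t)) has_integral X E) {0..1}"
      using conts unfolding X_def
      by eventually_elim (intro integrable_integral integrable_continuous_interval continuous_intros; simp)
  qed
  have Y_int: "\<forall>\<^sub>F E in at 0. ((\<lambda>t. d E t * d E t * (P E t * a E t) + a' E t * (R E t * d E t)) has_integral Y E) {0..1}"
    using conts ne unfolding Y_def d_def R_def
    by eventually_elim (intro integrable_integral integrable_continuous_interval continuous_intros; simp)
  \<comment> \<open>The cross term drops out because \<open>a'\<close> tends to 0 while
    \<open>R\<close> and \<open>d\<close> remain bounded.\<close>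
  have Y: "(Y \<longlongrightarrow> 4 * pi\<^sup>2 * integral {0..1} (\<lambda>t. (r t)\<^sup>2)) (at 0)"
  proof (rule uniform_limit_has_integral_tendsto[OF _ _ Y_int])
    have "uniform_limit {0..1} (\<lambda>E t. a' E t * (R E t * d E t)) (\<lambda>_. 0) (at 0)"
    proof (rule uniform_limit_bounded_mult_zero[OF a(2)])
      show "\<forall>\<^sub>F E in at 0. \<forall>t\<in>{0..1}. \<bar>R E t * d E t\<bar> \<le> 2 * C * C"
        using R_bound d_bound by eventually_elim (use C in \<open>auto simp: abs_mult intro!: mult_mono\<close>)
    qed
    then show "uniform_limit {0..1} (\<lambda>E t. d E t * d E t * (P E t * a E t) + a' E t * (R E t * d E t))
        (\<lambda>t. D t * D t * (1 * 1) + 0) (at 0)"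
      by (intro uniform_limit_add uniform_limit_mult_continuous dD P1 a continuous_intros contD)
    have "((\<lambda>t. 4 * pi\<^sup>2 * (r t)\<^sup>2) has_integral 4 * pi\<^sup>2 * integral {0..1} (\<lambda>t. (r t)\<^sup>2)) {0..1}"
      by (intro has_integral_mult_right integrable_integral integrable_continuous_interval continuous_intros r)
    then show "((\<lambda>t. D t * D t * (1 * 1) + 0) has_integral 4 * pi\<^sup>2 * integral {0..1} (\<lambda>t. (r t)\<^sup>2)) {0..1}"
      by (simp add: D power2_eq_square mult_ac)
  qed
  have "\<forall>\<^sub>F E in at 0. X E \<noteq> 0"
    using order_tendstoD(1)[OF X, of 0] by (auto elim: eventually_mono)
  then have "\<forall>\<^sub>F E in at 0. Y E / X E = ((lam E)\<^sup>2 - mu E) / E\<^sup>2"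
    using PQ ode Y_int ne conts
  proof eventually_elim
    case (elim E)
    have Xi: "((\<lambda>t. \<rho> E t * \<rho> E t * (P E t * a E t)) has_integral X E) {0..1}"
      using elim(6) unfolding X_def
      by (intro integrable_integral integrable_continuous_interval continuous_intros) auto
    have "((\<lambda>t. ((lam E)\<^sup>2 - mu E) * ((\<rho> E t)\<^sup>2 * P E t * a E t) -
      ((lam E * \<rho> E t - 2 * pi)\<^sup>2 * P E t * a E t + (lam E * \<rho> E t - 2 * pi) * Q E t * a' E t)) has_integral 0) {0..1}"
      using elim(2,3) by (intro spin_laplace_identity) auto
    moreover have "((\<lambda>t. ((lam E)\<^sup>2 - mu E) * (\<rho> E t * \<rho> E t * (P E t * a E t)) -
        E\<^sup>2 * (d E t * d E t * (P E t * a E t) + a' E t * (R E t * d E t)))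
        has_integral ((lam E)\<^sup>2 - mu E) * X E - E\<^sup>2 * Y E) {0..1}"
      by (intro has_integral_diff has_integral_mult_right Xi elim)
    moreover have "((lam E)\<^sup>2 - mu E) * (\<rho> E t * \<rho> E t * (P E t * a E t)) -
        E\<^sup>2 * (d E t * d E t * (P E t * a E t) + a' E t * (R E t * d E t)) =
        ((lam E)\<^sup>2 - mu E) * ((\<rho> E t)\<^sup>2 * P E t * a E t) -
      ((lam E * \<rho> E t - 2 * pi)\<^sup>2 * P E t * a E t + (lam E * \<rho> E t - 2 * pi) * Q E t * a' E t)" for t
    proof -
      have "lam E * \<rho> E t - 2 * pi = E * d E t" "Q E t = E * R E t"
        using elim(5) by (simp_all add: d_def R_def)
      then show ?thesis by (simp only: power2_eq_square) (simp add: algebra_simps)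
    qed
    ultimately have "((lam E)\<^sup>2 - mu E) * X E - E\<^sup>2 * Y E = 0"
      by (simp only: has_integral_unique)
    then show ?case using elim(1,5) by (simp add: field_simps)
  qed
  moreover have "((\<lambda>E. Y E / X E) \<longlongrightarrow> 4 * pi\<^sup>2 * integral {0..1} (\<lambda>t. (r t)\<^sup>2) / 1) (at 0)"
    by (intro tendsto_divide X Y) simp
  ultimately show ?thesis using Lim_transform_eventually by fastforce
qed

theorem mainTheorem4:
  fixes J :: "real set" and h :: "real \<Rightarrow> real \<Rightarrow> real" and H G :: "real \<Rightarrow> real"
    and mu1 mu2 mu3 lamsq1 lamsq2 lamsq3 :: "real \<Rightarrow> real"
  assumes deformation: "flat_deformation J h"
    and expansion: "\<And>t. (\<lambda>E. h E t ^ 4 - (1 + E * H t + E\<^sup>2 * G t)) \<in> O[at 0](\<lambda>E. E ^ 3)"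
    and symmetric: "\<And>E t. E \<in> J \<Longrightarrow> h E t ^ 4 = h E (1 - t) ^ 4"
    and H_sin: "integral {0..1} (\<lambda>t. H t * (sin (2 * pi * t))\<^sup>2) = 0"
    and H_cos: "integral {0..1} (\<lambda>t. H t * (cos (2 * pi * t))\<^sup>2) = 0"
    and branch_mu1: "spectral_branch J (\<lambda>E. laplace_potential (h E) 0) (\<lambda>t. of_real (sin (2 * pi * t))) mu1"
    and branch_mu2: "spectral_branch J (\<lambda>E. laplace_potential (h E) 0) (\<lambda>t. of_real (cos (2 * pi * t))) mu2"
    and branch_mu3: "\<And>k. k \<in> {1, -1} \<Longrightarrow>
      spectral_branch J (\<lambda>E. laplace_potential (h E) k) (\<lambda>t. 1) mu3"
    and branch_lambda1_sin:
      "spectral_branch J (\<lambda>E. dirac_potential (h E) 0) (\<lambda>t. of_real (sin (2 * pi * t))) lamsq1"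
    and branch_lambda1_cos:
      "spectral_branch J (\<lambda>E. dirac_potential (h E) 0) (\<lambda>t. of_real (cos (2 * pi * t))) lamsq1"
    and lambda1_mult: "\<And>E. E \<in> J \<Longrightarrow> multiplicity_is (dirac_potential (h E) 0 (lamsq1 E)) 2"
    and branch_lambda2: "spectral_branch J (\<lambda>E. dirac_potential (h E) (-1)) (\<lambda>t. 1) lamsq2"
    and branch_lambda3: "spectral_branch J (\<lambda>E. dirac_potential (h E) 1) (\<lambda>t. 1) lamsq3"
    and simple: "\<And>E. E \<in> J \<Longrightarrow> E \<noteq> 0 \<Longrightarrow>
      mu1 E \<noteq> mu2 E \<and>
      multiplicity_is (laplace_potential (h E) 0 (mu1 E)) 1 \<and>
      multiplicity_is (laplace_potential (h E) 0 (mu2 E)) 1"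
  shows "deriv (deriv lamsq3) 0 = deriv (deriv mu3) 0 + 2 * pi\<^sup>2 * integral {0..1} (\<lambda>t. (H t)\<^sup>2) \<and>
    (\<forall>\<^sub>F E in at 0. mu3 E < lamsq3 E) \<and>
    (\<forall>\<^sub>F E in at 0. laplace_first_eigenvalue (h E) < dirac_sq_first_eigenvalue (h E))"
proof -
  obtain dh ht htt where J: "open J" "0 \<in> J"
    and h: "\<And>E t. E \<in> J \<Longrightarrow> 0 < h E t" "\<And>E t. E \<in> J \<Longrightarrow> h E (t + 1) = h E t" "\<And>t. h 0 t = 1"
    and h_smooth: "\<And>E. E \<in> J \<Longrightarrow> smooth_on UNIV (\<lambda>p :: real \<times> real. h E (fst p))"
    and dh: "\<And>t. ((\<lambda>E. h E t) has_real_derivative dh t) (at 0)"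
    and ht: "\<And>E t. E \<in> J \<Longrightarrow> (h E has_real_derivative ht E t) (at t)"
      "\<And>E t. E \<in> J \<Longrightarrow> (ht E has_real_derivative htt E t) (at t)"
    and dh_cont: "continuous_on UNIV dh"
    and h_lim: "uniform_limit {0..1} h (\<lambda>_. 1) (at 0)" "uniform_limit {0..1} (\<lambda>E t. (h E t - 1) / E) dh (at 0)"
    using deformation by (rule flat_deformation_derivatives) (rule that)
  obtain a a' where a: "\<And>E t. E \<in> J \<Longrightarrow> (a E has_real_derivative a' E t) (at t)"
      "\<And>E t. E \<in> J \<Longrightarrow> (a' E has_real_derivative - ((mu3 E * ((h E t)\<^sup>2)\<^sup>2 - (2 * pi)\<^sup>2) * a E t)) (at t)"
      "\<And>E. E \<in> J \<Longrightarrow> a E 1 = a E 0" "\<And>E. E \<in> J \<Longrightarrow> a' E 1 = a' E 0"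
    and a_lim: "uniform_limit {0..1} a (\<lambda>_. 1) (at 0)" "uniform_limit {0..1} a' (\<lambda>_. 0) (at 0)"
    using laplace_branch_near_constant[OF J branch_mu3[of 1]] by auto
  have branch: "smooth_on J m \<and> m 0 = 4 * pi\<^sup>2 \<and> (\<exists>A. smooth_on (J \<times> UNIV) (\<lambda>(E, t). A E t) \<and>
      (\<forall>E\<in>J. periodic_solution (Q E (m E)) (A E) \<and> (\<exists>t. A E t \<noteq> 0)))"
    if "spectral_branch J Q A0 m" for Q A0 m
    using that unfolding spectral_branch_def by blast
  have slice: "smooth_on UNIV (\<lambda>p :: real \<times> real. A E (fst p))"
    if "smooth_on (J \<times> UNIV) (\<lambda>(E, t). A E t)" "E \<in> J" for A :: "real \<Rightarrow> real \<Rightarrow> complex" and E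
    using smooth_on_slice[OF that bounded_linear_fst] by simp
  have evJ: "\<forall>\<^sub>F E in at 0. E \<in> J \<and> E \<noteq> 0"
    using eventually_at_in_open'[OF J] by (simp add: eventually_conj eventually_at_filter)
  have close: "\<forall>\<^sub>F E in at 0. 4 * pi\<^sup>2 - \<epsilon> < m E \<and> m E < 4 * pi\<^sup>2 + \<epsilon>" if "spectral_branch J Q A0 m" "0 < \<epsilon>" for Q A0 m \<epsilon>
  proof -
    have "isCont m 0"
      using smooth_on_has_real_derivative[of J m 0] branch[OF that(1)] J by (auto intro: DERIV_isCont)
    then have "(m \<longlongrightarrow> 4 * pi\<^sup>2) (at 0)" using branch[OF that(1)] by (simp add: isCont_def)
    from order_tendstoD(1)[OF this, of "4 * pi\<^sup>2 - \<epsilon>"] order_tendstoD(2)[OF this, of "4 * pi\<^sup>2 + \<epsilon>"]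
    show ?thesis using that(2) by (simp add: eventually_conj)
  qed
  \<comment> \<open>This tolerance around the branch value turns into the factor
    \<open>1 + 1 / 4000\<close> demanded by the gap estimates.\<close>
  have eps: "0 < 4 * pi\<^sup>2 / 4000" "4 * pi\<^sup>2 + 4 * pi\<^sup>2 / 4000 = 4 * pi\<^sup>2 * (1 + 1 / 4000)"
    by (simp_all add: algebra_simps)
  \<comment> \<open>With tolerance 1 around \<open>4 * pi\<^sup>2\<close>, this makes the branches
    positive.\<close>
  have pi2: "36 \<le> 4 * pi\<^sup>2" using power_mono[of 3 pi 2] pi_gt3 by simp

  define \<rho> where "\<rho> E t = (h E t)\<^sup>2" for E t
  have \<rho>_cont: "continuous_on S (\<rho> E)" if "E \<in> J" for E S
    unfolding \<rho>_def using ht(1)[OF that]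
    by (intro continuous_intros continuous_at_imp_continuous_on ballI DERIV_isCont)
  have \<rho>_lim: "uniform_limit {0..1} \<rho> (\<lambda>_. 1) (at 0)"
    using uniform_limit_mult_continuous[OF h_lim(1) h_lim(1)] by (simp add: \<rho>_def[abs_def] power2_eq_square)
  have H: "H t = 4 * dh t" for t
    using first_variation_unique[of "\<lambda>E. h E t", OF dh h(3) expansion] .
  \<comment> \<open>Since \<open>\<rho>\<close> is the square root of \<open>h ^ 4\<close>, its
    first variation is half of \<open>H\<close>.\<close>
  have \<rho>_diff: "uniform_limit {0..1} (\<lambda>E t. (\<rho> E t - 1) / E) (\<lambda>t. H t / 2) (at 0)"
  proof -
    have "uniform_limit {0..1} (\<lambda>E t. (h E t - 1) / E * (h E t + 1)) (\<lambda>t. dh t * (1 + 1)) (at 0)"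
      by (intro uniform_limit_mult_continuous uniform_limit_add h_lim uniform_limit_const
          continuous_intros continuous_on_subset[OF dh_cont]) simp
    moreover have "(\<lambda>E t. (h E t - 1) / E * (h E t + 1)) = (\<lambda>E t. (\<rho> E t - 1) / E)"
      by (auto simp: \<rho>_def fun_eq_iff power2_eq_square algebra_simps)
    ultimately show ?thesis by (simp add: H mult.commute)
  qed
  have H_cont: "continuous_on S H" for S
  proof -
    have "continuous_on S (\<lambda>t. 4 * dh t)" by (intro continuous_intros continuous_on_subset[OF dh_cont]) simp
    then show ?thesis using H by presburger
  qed
  \<comment> \<open>The sine and cosine conditions add up to the vanishing of the mean of
    \<open>H\<close>.\<close>
  have "((\<lambda>t. H t * (sin (2 * pi * t))\<^sup>2 + H t * (cos (2 * pi * t))\<^sup>2) has_integral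
      integral {0..1} (\<lambda>t. H t * (sin (2 * pi * t))\<^sup>2) + integral {0..1} (\<lambda>t. H t * (cos (2 * pi * t))\<^sup>2)) {0..1}"
    by (intro has_integral_add integrable_integral integrable_continuous_interval continuous_intros H_cont)
  then have H_int: "(H has_integral 0) {0..1}"
    unfolding H_sin H_cos by (simp flip: distrib_left)

  have near: "\<forall>\<^sub>F E in at 0. E \<in> J \<and> E \<noteq> 0 \<and> (\<forall>t. \<bar>\<rho> E t - 1\<bar> \<le> 1 / 4000) \<and>
      (\<forall>t\<in>{0..1}. 1 / 2 \<le> a E t \<and> a E t \<le> 2 \<and> \<bar>a' E t\<bar> \<le> 1 / 32)"
  proof -
    have "\<forall>\<^sub>F E in at 0. \<forall>t\<in>{0..1}. dist (\<rho> E t) 1 < 1 / 4000"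
      "\<forall>\<^sub>F E in at 0. \<forall>t\<in>{0..1}. dist (a E t) 1 < 1 / 2"
      "\<forall>\<^sub>F E in at 0. \<forall>t\<in>{0..1}. dist (a' E t) 0 < 1 / 32"
      by (rule uniform_limitD[OF \<rho>_lim] uniform_limitD[OF a_lim(1)] uniform_limitD[OF a_lim(2)]; simp)+
    with evJ show ?thesis
    proof eventually_elim
      case (elim E)
      have "\<bar>\<rho> E t - 1\<bar> \<le> 1 / 4000" for t
      proof -
        obtain s where "s \<in> {0..1}" "h E t = h E s"
          using periodic_reduce_unit_interval[of "h E" t] h(2) elim(1) by blast
        then show ?thesis using elim(2) by (force simp: \<rho>_def dist_real_def)
      qed
      moreover have "1 / 2 \<le> a E t \<and> a E t \<le> 2 \<and> \<bar>a' E t\<bar> \<le> 1 / 32" if "t \<in> {0..1}" for t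
      proof -
        have "\<bar>a E t - 1\<bar> < 1 / 2" "\<bar>a' E t\<bar> < 1 / 32"
          using elim(3,4) that by (simp_all add: dist_real_def)
        then show ?thesis by linarith
      qed
      ultimately show ?case using elim(1) by blast
    qed
  qed
  \<comment> \<open>Simplicity of \<open>mu1 E\<close> enters here and replaces any nondegeneracy
    assumption on \<open>H\<close>.\<close>
  have nonconst: "\<forall>\<^sub>F E in at 0. \<exists>s\<in>{0..1}. \<exists>t\<in>{0..1}. \<rho> E s \<noteq> \<rho> E t"
    using near close[OF branch_mu1 zero_less_one]
  proof eventually_elim
    case (elim E)
    then obtain A t0 where "periodic_solution (laplace_potential (h E) 0 (mu1 E)) A" "A t0 \<noteq> 0"
      using branch[OF branch_mu1] by blast
    moreover have "0 < mu1 E" using elim(2) pi2 by linarith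
    ultimately show ?case
      using simple_eigenvalue_nonconstant[of "h E" "mu1 E" A t0] simple h elim(1) by (simp add: \<rho>_def)
  qed

  define lam where "lam E = sqrt (lamsq3 E)" for E
  have lam_sq: "\<forall>\<^sub>F E in at 0. 0 < lamsq3 E \<and> 0 < lam E \<and> (lam E)\<^sup>2 = lamsq3 E"
    using close[OF branch_lambda3 zero_less_one]
  proof eventually_elim
    case (elim E)
    then have "0 < lamsq3 E" using pi2 by linarith
    then show ?case by (simp add: lam_def)
  qed
  have sys: "\<forall>\<^sub>F E in at 0. \<exists>p q t. spin_system (2 * pi) (lam E) (\<rho> E) p q \<and> (p t \<noteq> 0 \<or> q t \<noteq> 0)"
    using near lam_sq
  proof eventually_elim
    case (elim E)
    then obtain A t0 where "periodic_solution (dirac_potential (h E) 1 (lamsq3 E)) A" "A t0 \<noteq> 0"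
      using branch[OF branch_lambda3] by blast
    from dirac_periodic_solution_spin_system[OF this, of "ht E" "htt E"] show ?case
      using elim h ht by (simp add: lam_def \<rho>_def[abs_def])
  qed

  have gap: "\<forall>\<^sub>F E in at 0. mu3 E < lamsq3 E"
    using near nonconst lam_sq sys close[OF branch_lambda3 eps(1)]
  proof eventually_elim
    case (elim E)
    obtain p q t0 where pq: "spin_system (2 * pi) (lam E) (\<rho> E) p q" "p t0 \<noteq> 0 \<or> q t0 \<noteq> 0"
      using elim(4) by blast
    have inJ: "E \<in> J" using elim(1) by blast
    have "lamsq3 E \<le> 4 * pi\<^sup>2 * (1 + 1 / 4000)" using elim(5) unfolding eps(2) by simp
    \<comment> \<open>Squaring the factor turns a bound for the squared eigenvalue into one for
      \<open>lam E\<close>.\<close>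
    also have "\<dots> \<le> (2 * pi * (1 + 1 / 4000))\<^sup>2" by (simp add: power2_eq_square)
    finally have "(lam E)\<^sup>2 \<le> (2 * pi * (1 + 1 / 4000))\<^sup>2" using elim(3) by simp
    then have lam_le: "lam E \<le> 2 * pi * (1 + 1 / 4000)" by (rule power2_le_imp_le) simp
    have "mu3 E + (integral {0..1} (\<lambda>t. (\<rho> E t)\<^sup>2) - (integral {0..1} (\<rho> E))\<^sup>2) / 100 \<le> (lam E)\<^sup>2"
    proof (rule spin_laplace_gap_near_flat[where A = "a E" and A' = "a' E" and p = p and q = q, OF pq _ lam_le])
      show "(a' E has_real_derivative - ((mu3 E * (\<rho> E t)\<^sup>2 - (2 * pi)\<^sup>2) * a E t)) (at t)" for t
        unfolding \<rho>_def by (rule a(2)[OF inJ])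
    qed (use elim(1,3) a inJ \<rho>_cont in auto)
    moreover have "0 < (integral {0..1} (\<lambda>t. (\<rho> E t)\<^sup>2) - (integral {0..1} (\<rho> E))\<^sup>2) / 100"
      using elim(2) square_integral_le(2)[OF \<rho>_cont[OF inJ]] by auto
    moreover have "(lam E)\<^sup>2 = lamsq3 E" using elim(3) by blast
    ultimately show ?case by (metis less_add_same_cancel1 order_less_le_trans)
  qed
  have one: "1 \<in> {1, -1 :: int}" by simp
  \<comment> \<open>The value \<open>mu3 E\<close> competes in the Laplace infimum, and
    \<open>lamsq1 E\<close> witnesses that the set of positive Dirac eigenvalues is
    nonempty.\<close>
  have first: "\<forall>\<^sub>F E in at 0. laplace_first_eigenvalue (h E) < dirac_sq_first_eigenvalue (h E)"
    using near nonconst close[OF branch_mu3[OF one] eps(1)]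
      close[OF branch_mu3[OF one] zero_less_one] close[OF branch_lambda1_sin zero_less_one]
  proof eventually_elim
    case (elim E)
    have inJ: "E \<in> J" using elim(1) by blast
    obtain A t0 where A: "smooth_on (J \<times> UNIV) (\<lambda>(E, t). A E t)"
      "periodic_solution (laplace_potential (h E) 1 (mu3 E)) (A E)" "A E t0 \<noteq> 0"
      using branch[OF branch_mu3[of 1]] inJ by auto
    obtain B t1 where B: "smooth_on (J \<times> UNIV) (\<lambda>(E, t). B E t)"
      "periodic_solution (dirac_potential (h E) 0 (lamsq1 E)) (B E)" "B E t1 \<noteq> 0"
      using branch[OF branch_lambda1_sin] inJ by blast
    show ?case
    proof (rule laplace_less_dirac_near_flat[where h = "h E" and A = "a E" and A' = "a' E" and h' = "ht E"])
      show "torus_eigenvalue (laplace_op (h E)) (mu3 E)"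
        by (rule laplace_torus_eigenvalue[OF slice[OF A(1) inJ] A(2,3) h(1)[OF inJ]])
      show "torus_eigenvalue (\<lambda>\<psi>. dirac_op (h E) (dirac_op (h E) \<psi>)) (lamsq1 E)"
        by (rule dirac_torus_eigenvalue[OF slice[OF B(1) inJ] B(2,3) h(1)[OF inJ] ht[OF inJ]])
      have "(2 * pi)\<^sup>2 = 4 * pi\<^sup>2" by simp
      then show "mu3 E \<le> (2 * pi)\<^sup>2 * (1 + 1 / 4000)" using elim(3) unfolding eps(2) by (simp only: less_imp_le)
      show "0 < mu3 E" "0 < lamsq1 E" using elim(4,5) pi2 by linarith+
      show "\<bar>(h E t)\<^sup>2 - 1\<bar> \<le> 1 / 4000" for t using elim(1) by (simp add: \<rho>_def)
      show "\<exists>s\<in>{0..1}. \<exists>t\<in>{0..1}. (h E s)\<^sup>2 \<noteq> (h E t)\<^sup>2" using elim(2) by (simp add: \<rho>_def)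
    qed (use elim(1) h h_smooth ht a inJ in auto)
  qed

  \<comment> \<open>The derivative at 0 of the square root of the branch, by the chain rule with
    \<open>lam 0 = 2 * pi\<close>.\<close>
  define \<kappa> where "\<kappa> = frechet_derivative lamsq3 (at 0) 1 / (2 * (2 * pi))"
  have "(lam has_real_derivative \<kappa>) (at 0)"
  proof -
    have "(lamsq3 has_real_derivative frechet_derivative lamsq3 (at 0) 1) (at 0)"
      using branch[OF branch_lambda3] J by (intro smooth_on_has_real_derivative) auto
    moreover have "lamsq3 0 = (2 * pi)\<^sup>2" using branch[OF branch_lambda3] by simp
    ultimately show ?thesis
      unfolding lam_def[abs_def] \<kappa>_def by (auto intro!: derivative_eq_intros simp: real_sqrt_mult field_simps)
  qed
  moreover have "lam 0 = 2 * pi"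
    using branch[OF branch_lambda3] by (simp add: lam_def real_sqrt_mult)
  ultimately have lam_diff: "((\<lambda>E. (lam E - 2 * pi) / E) \<longlongrightarrow> \<kappa>) (at 0)"
    by (simp add: has_field_derivative_iff)
  have H2: "continuous_on {0..1} (\<lambda>t. H t / 2)" "((\<lambda>t. H t / 2) has_integral 0) {0..1}"
    using H_cont has_integral_divide[OF H_int, of 2] by (auto intro!: continuous_intros)
  have "((\<lambda>E. ((lam E)\<^sup>2 - mu3 E) / E\<^sup>2) \<longlongrightarrow> 4 * pi\<^sup>2 * integral {0..1} (\<lambda>t. (H t / 2)\<^sup>2)) (at 0)"
  proof (rule spectral_gap_limit[OF \<rho>_lim \<rho>_diff H2 lam_diff _ a_lim])
    show "\<forall>\<^sub>F E in at 0. continuous_on UNIV (\<rho> E) \<and> (\<forall>t. \<rho> E (t + 1) = \<rho> E t) \<and>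
      (\<exists>p q t. spin_system (2 * pi) (lam E) (\<rho> E) p q \<and> (p t \<noteq> 0 \<or> q t \<noteq> 0))"
      using evJ sys by eventually_elim (use \<rho>_cont h(2) in \<open>simp add: \<rho>_def\<close>)
    show "\<forall>\<^sub>F E in at 0. (\<forall>t. (a E has_real_derivative a' E t) (at t)) \<and>
      (\<forall>t. (a' E has_real_derivative - ((mu3 E * (\<rho> E t)\<^sup>2 - (2 * pi)\<^sup>2) * a E t)) (at t)) \<and>
      a E 1 = a E 0 \<and> a' E 1 = a' E 0"
      using evJ by eventually_elim (use a in \<open>auto simp only: \<rho>_def\<close>)
  qed
  moreover have "\<forall>\<^sub>F E in at 0. ((lam E)\<^sup>2 - mu3 E) / E\<^sup>2 = (lamsq3 E - mu3 E) / E\<^sup>2"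
    using lam_sq by eventually_elim simp
  \<comment> \<open>Halving \<open>H\<close> cancels the 4; the factor 2 in the theorem comes from
    reading the second derivative off a quadratic limit.\<close>
  moreover have "4 * pi\<^sup>2 * integral {0..1} (\<lambda>t. (H t / 2)\<^sup>2) = pi\<^sup>2 * integral {0..1} (\<lambda>t. (H t)\<^sup>2)"
    by (simp add: power_divide)
  ultimately have "((\<lambda>E. (lamsq3 E - mu3 E) / E\<^sup>2) \<longlongrightarrow> pi\<^sup>2 * integral {0..1} (\<lambda>t. (H t)\<^sup>2)) (at 0)"
    using Lim_transform_eventually by fastforce
  from second_derivatives_quadratic_limit[OF J _ _ _ this]
  have "deriv (deriv lamsq3) 0 = deriv (deriv mu3) 0 + 2 * pi\<^sup>2 * integral {0..1} (\<lambda>t. (H t)\<^sup>2)"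
    using branch[OF branch_lambda3] branch[OF branch_mu3[of 1]] by simp
  with gap first show ?thesis by blast
qed

end
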